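(* Fix integers $N\ge2$ and $m\ge1$ and a positive constant $\beta$. Fix also $a>0$, $a\ne1$, and $Z>0$. Let $(X,d)$ be the metric space with $X=Y_{m\beta(1/4)}(S^{N-1}(0,1/2))$ and $d$ the Hausdorff distance. Let $\Omega=B_N(0,1)$, and let $L\ge2$ electrodes $e_l\subset\partial\Omega$, $l=1,\ldots,L$, be fixed which are open, connected, with smooth boundary and with pairwise disjoint closures, with surface impedances $z_l\ge Z$, $l=1,\ldots,L$. Then there are positive constants $\varepsilon_1$ and $\tilde C$, depending on $N$, $m$, $\beta$, $a$, $Z$ and the electrodes only, so that for any $\varepsilon$, $0<\varepsilon<\varepsilon_1$, there exist $D_1$ and $D_2$ belonging to $X$ such that $$d(D_j,\overline{B_N(0,1/2)})\le\varepsilon\ \text{ for } j=1,2;\qquad d(D_1,D_2)\ge\varepsilon;$$ $$\|R(D_1)-R(D_2)\|\le\tilde C\exp(-\varepsilon^{-(N-1)/(2mN)}).$$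
   Context: $B_N(x,r)=\{y\in\mathbb{R}^N:\|y-x\|<r\}$, $S^{N-1}(x,r)=\partial B_N(x,r)$. $Y_{m\beta\varepsilon}(S^{N-1}(x,r))$ is the set of all radial subgraphs $$\{y\in\mathbb{R}^N:\ y=x+\rho\,\tfrac{\omega-x}{r},\ 0\le\rho\le g(\omega),\ \omega\in S^{N-1}(x,r)\}$$ of functions $g\in C^m(S^{N-1}(x,r))$ with $r\le g\le r+\varepsilon$ and $\|g-r\|_{C^m(S^{N-1}(x,r))}\le\beta$. Here $x=0$, $r=1/2$ and the parameter $\varepsilon$ is $1/4$. Resistance matrix $R(D)$ for $D\in X$: the $z_l$ are real constants. For a current pattern $I\in\mathbb{R}^L$, $\sum_{l=1}^LI_l=0$, there is a unique pair $(u,U)\in H^1(\Omega)\times\mathbb{R}^L$ with $\sum_{l=1}^L(|e_l|U_l-z_lI_l)=0$ solving (weakly) $$\mathrm{div}((1+(a-1)\chi_D)\nabla u)=0\ \text{ in }\Omega,\qquad u+z_l\frac{\partial u}{\partial\nu}=U_l\ \text{ on }e_l,\ l=1,\ldots,L,$$ $$\frac{\partial u}{\partial\nu}=0\ \text{ on }\partial\Omega\setminus\bigcup_{l=1}^Le_l,\qquad \int_{e_l}\frac{\partial u}{\partial\nu}=I_l,\ l=1,\ldots,L,$$ where $\chi_D$ is the characteristic function of $D$ and $|e_l|$ is the surface measure of $e_l$. The corresponding voltage pattern is $V\in\mathbb{R}^L$, $V_l=\int_{e_l}u=|e_l|U_l-z_lI_l$, so that $\sum_lV_l=0$. The $L\times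 L$ matrix $R(D)$ is defined by $R(D)I=V$ for every current pattern $I$ and $R(D)[1]=0$, where $[1]$ is the vector with all components equal to $1$. Its norm is the norm of linear operators from $\mathbb{R}^L$ into itself. *)

theory Defs
  imports "HOL-Analysis.Analysis"
begin

section \<open>Partial derivatives and functions of class $C^k$\<close>

definition partial_deriv :: "'a::euclidean_space \<Rightarrow> ('a \<Rightarrow> real) \<Rightarrow> 'a \<Rightarrow> real" where
  "partial_deriv b f x = frechet_derivative f (at x) b"

definition grad :: "('a::euclidean_space \<Rightarrow> real) \<Rightarrow> 'a \<Rightarrow> 'a" where
  "grad f x = (\<Sum>b\<in>Basis. partial_deriv b f x *\<^sub>R b)"

primrec iter_partial_deriv ::
  "'a::euclidean_space list \<Rightarrow> ('a \<Rightarrow> real) \<Rightarrow> 'a \<Rightarrow> real" where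
  "iter_partial_deriv [] f = f"
| "iter_partial_deriv (b # bs) f = partial_deriv b (iter_partial_deriv bs f)"

text \<open>Derivatives are taken with respect to the full filter \<^term>\<open>at x\<close>, so the following two
  notions are meant for open sets only.\<close>

primrec Ck_on :: "nat \<Rightarrow> ('a::euclidean_space \<Rightarrow> real) \<Rightarrow> 'a set \<Rightarrow> bool" where
  "Ck_on 0 f S \<longleftrightarrow> continuous_on S f"
| "Ck_on (Suc k) f S \<longleftrightarrow>
     (\<forall>x\<in>S. f differentiable (at x)) \<and> (\<forall>b\<in>Basis. Ck_on k (partial_deriv b f) S)"

definition smooth_on :: "('a::euclidean_space \<Rightarrow> real) \<Rightarrow> 'a set \<Rightarrow> bool" where
  "smooth_on f S \<longleftrightarrow> (\<forall>k. Ck_on k f S)"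


section \<open>Functions of class $C^m$ on a sphere and radial subgraphs\<close>

text \<open>A function on the sphere of centre \<open>x\<close> and radius \<open>r\<close> is represented by a function on the
  whole space whose values off the sphere are irrelevant. It is differentiated through its extension
  that is constant along the rays from \<open>x\<close>; this extension is of class $C^m$ off \<open>x\<close> exactly when
  the function is of class $C^m$ on the sphere, regarded as a smooth manifold. On the sphere the
  radial derivative of the extension vanishes, so that its gradient is the tangential gradient.\<close>

definition radial_ext :: "'a::euclidean_space \<Rightarrow> real \<Rightarrow> ('a \<Rightarrow> real) \<Rightarrow> 'a \<Rightarrow> real" where
  "radial_ext x r g y = g (x + (r / norm (y - x)) *\<^sub>R (y - x))"

definition Cm_sphere :: "nat \<Rightarrow> 'a::euclidean_space \<Rightarrow> real \<Rightarrow> ('a \<Rightarrow> real) \<Rightarrow> bool" where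
  "Cm_sphere m x r g \<longleftrightarrow> Ck_on m (radial_ext x r g) (- {x})"

text \<open>The $C^m$ norm: the largest absolute value, over the sphere, of all partial derivatives
  of order at most \<open>m\<close> of the extension. For \<^term>\<open>Cm_sphere m x r g\<close> these are continuous on
  the compact sphere, so the supremum is finite.\<close>

definition Cm_sphere_norm :: "nat \<Rightarrow> 'a::euclidean_space \<Rightarrow> real \<Rightarrow> ('a \<Rightarrow> real) \<Rightarrow> real" where
  "Cm_sphere_norm m x r g =
     (SUP (bs, y) \<in> {bs. set bs \<subseteq> Basis \<and> length bs \<le> m} \<times> sphere x r.
        \<bar>iter_partial_deriv bs (radial_ext x r g) y\<bar>)"

definition radial_subgraph :: "'a::euclidean_space \<Rightarrow> real \<Rightarrow> ('a \<Rightarrow> real) \<Rightarrow> 'a set" where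
  "radial_subgraph x r g =
     {x + \<rho> *\<^sub>R ((\<omega> - x) /\<^sub>R r) | \<rho> \<omega>. 0 \<le> \<rho> \<and> \<rho> \<le> g \<omega> \<and> \<omega> \<in> sphere x r}"

definition Y_class ::
  "nat \<Rightarrow> real \<Rightarrow> real \<Rightarrow> 'a::euclidean_space \<Rightarrow> real \<Rightarrow> 'a set set" where
  "Y_class m \<beta> \<epsilon> x r =
     {radial_subgraph x r g | g.
        Cm_sphere m x r g \<and>
        (\<forall>\<omega>\<in>sphere x r. r \<le> g \<omega> \<and> g \<omega> \<le> r + \<epsilon>) \<and>
        Cm_sphere_norm m x r (\<lambda>\<omega>. g \<omega> - r) \<le> \<beta>}"

text \<open>For nonempty bounded sets only (otherwise the suprema or \<^const>\<open>infdist\<close> take default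
  values).\<close>

definition hausdorff_dist :: "'a::metric_space set \<Rightarrow> 'a set \<Rightarrow> real" where
  "hausdorff_dist A B = max (SUP x\<in>A. infdist x B) (SUP y\<in>B. infdist y A)"


section \<open>Surface measure of the unit sphere\<close>

text \<open>The surface measure of a Borel subset \<open>A\<close> of the unit sphere of $R^N$ is $N$ times the
  volume of the cone of all \<open>t \<omega>\<close> with \<open>0 < t < 1\<close> and \<open>\<omega> \<in> A\<close> (polar coordinates). It is
  realised as a measure on the Borel sets of the whole space which is concentrated on the sphere;
  \<^term>\<open>sgn x\<close> is the vector \<open>x / norm x\<close>.\<close>

definition sphere_measure :: "'a::euclidean_space measure" where
  "sphere_measure =
     distr (density lborel (\<lambda>x. of_nat DIM('a) * indicator (ball 0 1) x)) borel sgn"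

text \<open>Smoothness of the boundary, relative to the unit sphere, of a relatively open subset \<open>e\<close>:
  near each of its relative boundary points, \<open>e\<close> is the part of the sphere where a smooth function
  with nonvanishing tangential differential is negative.\<close>

definition smooth_boundary_in_sphere :: "'a::euclidean_space set \<Rightarrow> bool" where
  "smooth_boundary_in_sphere e \<longleftrightarrow>
     (\<forall>p \<in> closure e - e. \<exists>U \<phi>. open U \<and> p \<in> U \<and> smooth_on \<phi> U \<and>
        (\<exists>v. v \<bullet> p = 0 \<and> frechet_derivative \<phi> (at p) v \<noteq> 0) \<and>
        e \<inter> U = {y \<in> sphere 0 1 \<inter> U. \<phi> y < 0})"


section \<open>The Sobolev space $H^1$ and traces\<close>

definition square_integrable ::
  "'a measure \<Rightarrow> ('a \<Rightarrow> 'b::euclidean_space) \<Rightarrow> bool" where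
  "square_integrable M f \<longleftrightarrow> f \<in> borel_measurable M \<and> integrable M (\<lambda>x. (norm (f x))\<^sup>2)"

definition test_function_on :: "'a::euclidean_space set \<Rightarrow> ('a \<Rightarrow> real) \<Rightarrow> bool" where
  "test_function_on \<Omega> \<phi> \<longleftrightarrow>
     smooth_on \<phi> UNIV \<and> (\<exists>K. compact K \<and> K \<subseteq> \<Omega> \<and> (\<forall>x. x \<notin> K \<longrightarrow> \<phi> x = 0))"

text \<open>\<open>H1_on \<Omega> u G\<close>: the function \<open>u\<close> belongs to $H^1(\Omega)$ and \<open>G\<close> is its weak gradient. Both
  matter only up to null sets.\<close>

definition H1_on ::
  "'a::euclidean_space set \<Rightarrow> ('a \<Rightarrow> real) \<Rightarrow> ('a \<Rightarrow> 'a) \<Rightarrow> bool" where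
  "H1_on \<Omega> u G \<longleftrightarrow>
     square_integrable (lebesgue_on \<Omega>) u \<and> square_integrable (lebesgue_on \<Omega>) G \<and>
     (\<forall>\<phi>. test_function_on \<Omega> \<phi> \<longrightarrow> (\<forall>b\<in>Basis.
        (LINT x|lebesgue_on \<Omega>. u x * partial_deriv b \<phi> x) =
        - (LINT x|lebesgue_on \<Omega>. (G x \<bullet> b) * \<phi> x)))"

text \<open>The trace on the unit sphere of a function \<open>u\<close> of class $H^1$ on the unit ball, with weak
  gradient \<open>G\<close>: the extension by continuity of the restriction of smooth functions to the sphere.\<close>

definition has_trace ::
  "('a::euclidean_space \<Rightarrow> real) \<Rightarrow> ('a \<Rightarrow> 'a) \<Rightarrow> ('a \<Rightarrow> real) \<Rightarrow> bool" where
  "has_trace u G t \<longleftrightarrow>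
     H1_on (ball 0 1) u G \<and> square_integrable sphere_measure t \<and>
     (\<exists>w. (\<forall>k. smooth_on (w k) UNIV) \<and>
        (\<lambda>k::nat. LINT x|lebesgue_on (ball 0 1). (w k x - u x)\<^sup>2) \<longlonglongrightarrow> 0 \<and>
        (\<lambda>k. LINT x|lebesgue_on (ball 0 1). (norm (grad (w k) x - G x))\<^sup>2) \<longlonglongrightarrow> 0 \<and>
        (\<lambda>k. LINT x|sphere_measure. (w k x - t x)\<^sup>2) \<longlonglongrightarrow> 0)"


section \<open>Resistance matrix of the complete electrode model in the unit ball\<close>

text \<open>Weak form of \<open>div ((1 + (a - 1) \<chi>\<^sub>D) grad u) = 0\<close> in the unit ball with conormal
  derivative \<open>h\<close> on the sphere. When \<open>D\<close> has positive distance from the sphere the coefficient is 1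
  near the sphere and \<open>h\<close> is the normal derivative of \<open>u\<close>.\<close>

definition weak_solution_with_normal_deriv ::
  "real \<Rightarrow> 'a::euclidean_space set \<Rightarrow> ('a \<Rightarrow> 'a) \<Rightarrow> ('a \<Rightarrow> real) \<Rightarrow> bool" where
  "weak_solution_with_normal_deriv a D G h \<longleftrightarrow>
     square_integrable sphere_measure h \<and>
     (\<forall>v Gv s. H1_on (ball 0 1) v Gv \<and> has_trace v Gv s \<longrightarrow>
        (LINT x|lebesgue_on (ball 0 1). (1 + (a - 1) * indicator D x) * (G x \<bullet> Gv x)) =
        (LINT x|sphere_measure. h x * s x))"

text \<open>The pair \<open>(u, U)\<close> solves the problem for the current pattern \<open>I\<close>; \<open>G\<close>, \<open>t\<close> and \<open>h\<close> are the
  weak gradient, the trace and the normal derivative of \<open>u\<close>.\<close>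

definition cem_solution ::
  "real \<Rightarrow> ('l::finite \<Rightarrow> 'a::euclidean_space set) \<Rightarrow> ('l \<Rightarrow> real) \<Rightarrow> 'a set \<Rightarrow> real ^ 'l \<Rightarrow>
   ('a \<Rightarrow> real) \<Rightarrow> ('a \<Rightarrow> 'a) \<Rightarrow> ('a \<Rightarrow> real) \<Rightarrow> ('a \<Rightarrow> real) \<Rightarrow> real ^ 'l \<Rightarrow> bool" where
  "cem_solution a e z D I u G t h U \<longleftrightarrow>
     H1_on (ball 0 1) u G \<and> has_trace u G t \<and>
     weak_solution_with_normal_deriv a D G h \<and>
     (\<forall>l. AE x in sphere_measure. x \<in> e l \<longrightarrow> t x + z l * h x = U $ l) \<and>
     (AE x in sphere_measure. x \<notin> (\<Union>l. e l) \<longrightarrow> h x = 0) \<and>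
     (\<forall>l. (LINT x:e l|sphere_measure. h x) = I $ l) \<and>
     (\<Sum>l\<in>UNIV. measure sphere_measure (e l) * U $ l - z l * I $ l) = 0"

definition is_resistance_matrix ::
  "real \<Rightarrow> ('l::finite \<Rightarrow> 'a::euclidean_space set) \<Rightarrow> ('l \<Rightarrow> real) \<Rightarrow> 'a set \<Rightarrow>
   real ^ 'l ^ 'l \<Rightarrow> bool" where
  "is_resistance_matrix a e z D R \<longleftrightarrow>
     (\<forall>I. (\<Sum>l\<in>UNIV. I $ l) = 0 \<longrightarrow>
        (\<exists>u G t h U. cem_solution a e z D I u G t h U \<and>
           R *v I = (\<chi> l. LINT x:e l|sphere_measure. t x))) \<and>
     R *v (\<chi> l. 1) = 0"

definition resistance_matrix ::
  "real \<Rightarrow> ('l::finite \<Rightarrow> 'a::euclidean_space set) \<Rightarrow> ('l \<Rightarrow> real) \<Rightarrow> 'a set \<Rightarrow> real ^ 'l ^ 'l" where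
  "resistance_matrix a e z D = (THE R. is_resistance_matrix a e z D R)"

end

theory Submission
  imports Defs "HOL-Computational_Algebra.Polynomial"
begin

text \<open>A resistance matrix has \<open>L * L\<close> entries, so the class of inclusions is mapped into a space of
  fixed finite dimension, and the map is bounded. Instability is then a matter of counting: there are far
  more inclusions at pairwise distance at least \<open>\<epsilon>\<close> than matrices of bounded size that
  differ pairwise by more than \<open>\<eta> = exp (- \<epsilon> powr - \<alpha>)\<close>, where
  \<open>\<alpha> = (N - 1) / (2 m N)\<close>.

  Many inclusions. The radial profile of the inclusions depends on one coordinate of the direction only
  (\<open>zonal_body\<close>). The range of this coordinate contains \<open>n\<close> slots of length \<open>1 / n\<close>, and a
  set \<open>S\<close> of slots gives the profile which rises from \<open>1 / 2\<close> by a $C^m$ bump of height exactly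
  \<open>\<epsilon>\<close> on each slot in \<open>S\<close>. Its $C^m$ norm is at most a constant times
  \<open>\<epsilon> * n ^ m\<close> (\<open>zonal_body_in_Y_class\<close>). If the slots are wide compared with
  \<open>\<epsilon>\<close>, the top of a bump of one body is at distance at least \<open>\<epsilon>\<close> from any body that
  has no bump there (\<open>hausdorff_dist_zonal_bodies\<close>). There are \<open>2 ^ n\<close> such bodies.

  Few matrices. The entries of all resistance matrices are bounded by one constant \<open>M\<close>
  (\<open>resistance_matrix_bounded\<close>), so up to \<open>\<eta>\<close> there are at most
  \<open>(2 M / \<eta> + 2) ^ (L * L)\<close> of them, the exponential of a multiple of
  \<open>\<epsilon> powr - \<alpha>\<close>. With \<open>n\<close> a large multiple of \<open>\<epsilon> powr - \<alpha>\<close> the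
  number \<open>2 ^ n\<close> is larger, and \<open>\<epsilon> * n ^ m\<close> is still small for small \<open>\<epsilon>\<close>
  because \<open>m \<alpha> < 1 / 2\<close> (\<open>count_of_bumps\<close>). Two of the bodies therefore have almost the
  same matrix.

  Boundedness. Let \<open>u\<close> solve the problem with current pattern \<open>I\<close>, voltage pattern \<open>V\<close> and
  normal derivative \<open>h\<close>. Testing the equation with \<open>u\<close> gives the dissipated power as the sum of
  \<open>U l * I l\<close> minus \<open>z l\<close> times the integral of \<open>h^2\<close> over \<open>e l\<close>. By Cauchy-Schwarz
  the subtracted terms absorb all that depends on the impedances, and the sum of \<open>I l * V l / |e l|\<close>
  remains as an upper bound (\<open>electrode_power_le\<close>). Conversely \<open>V\<close> is bounded by the norm of the
  gradient, since the entries of \<open>V\<close> sum to zero and a Poincare inequality controls the differences of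
  the averages of the trace over the electrodes (\<open>gradient_with_trace_averages\<close>). Together this bounds
  \<open>V\<close> by \<open>I\<close>, uniformly in the inclusion and the impedances. Applied to the difference of two
  solutions, the same estimate shows that the resistance matrix is unique (\<open>voltage_difference_bound\<close>).

  For a smooth function \<open>w\<close>, averages over parts of the sphere become averages over cones by the
  divergence theorem for the field \<open>w x * x\<close>. It is radial, so the theorem reduces to the behaviour of
  volume under dilations (\<open>sphere_integral_eq_cone_integral\<close>). In the ball, the mean difference of the
  values of \<open>w\<close> at two points is bounded by integrating the gradient along the segment between them
  (\<open>poincare_inequality_ball\<close>).\<close>


section \<open>Bumps on the line\<close>

lemma has_real_derivative_pos_part_power:
  fixes v :: real
  shows "((\<lambda>v. max 0 v ^ Suc (Suc k)) has_real_derivative real (Suc (Suc k)) * max 0 v ^ Suc k) (at v)"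
proof -
  consider "v > 0" | "v < 0" | "v = 0" by linarith
  then show ?thesis
  proof cases
    case 1
    have "((\<lambda>v. v ^ Suc (Suc k)) has_real_derivative real (Suc (Suc k)) * v ^ Suc k) (at v)"
      by (rule derivative_eq_intros refl)+ simp
    then have "((\<lambda>v. max 0 v ^ Suc (Suc k)) has_real_derivative real (Suc (Suc k)) * v ^ Suc k) (at v)"
      by (rule has_field_derivative_transform_within_open[where S = "{0<..}"]) (use 1 in auto)
    then show ?thesis using 1 by simp
  next
    case 2
    have "((\<lambda>v. 0) has_real_derivative 0) (at v)" by simp
    then have "((\<lambda>v. max 0 v ^ Suc (Suc k)) has_real_derivative 0) (at v)"
      by (rule has_field_derivative_transform_within_open[where S = "{..<0}"]) (use 2 in auto)
    then show ?thesis using 2 by simp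
  next
    case 3
    have "continuous_on UNIV (\<lambda>v::real. max 0 v ^ Suc k)"
      by (intro continuous_intros)
    then have c: "isCont (\<lambda>v::real. max 0 v ^ Suc k) 0"
      using continuous_on_eq_continuous_at open_UNIV by blast
    \<comment> \<open>the difference quotient at 0 is again a power, continuous with value 0\<close>
    have "max 0 z ^ Suc (Suc k) - max 0 0 ^ Suc (Suc k) = max 0 z ^ Suc k * (z - 0)" for z :: real
      by (cases "z \<le> 0") (auto simp: max_def)
    with c have "((\<lambda>v. max 0 v ^ Suc (Suc k)) has_real_derivative 0) (at 0)"
      unfolding CARAT_DERIV by (intro exI[of _ "\<lambda>v. max 0 v ^ Suc k"]) auto
    then show ?thesis using 3 by simp
  qed
qed

text \<open>The bump is the power \<open>m + 1\<close> of the positive part of \<open>4 x (1 - x)\<close>, which is 1 at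
  \<open>1 / 2\<close>. Each differentiation lowers the exponent by one; \<open>bump_factor m j\<close> is the polynomial
  that multiplies the remaining power in the derivative of order \<open>j\<close>.\<close>
primrec bump_factor :: "nat \<Rightarrow> nat \<Rightarrow> real poly" where
  "bump_factor m 0 = 1"
| "bump_factor m (Suc j) =
     smult (real (m + 1 - j)) [:4, -8:] * bump_factor m j + [:0, 4, -4:] * pderiv (bump_factor m j)"

definition bump_deriv :: "nat \<Rightarrow> nat \<Rightarrow> real \<Rightarrow> real" where
  "bump_deriv m j x = max 0 (4 * x * (1 - x)) ^ (m + 1 - j) * poly (bump_factor m j) x"

lemma has_real_derivative_bump_deriv:
  assumes "j < m"
  shows "(bump_deriv m j has_real_derivative bump_deriv m (Suc j) x) (at x)"
proof -
  define k where "k = m - Suc j"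
  have k: "m + 1 - j = Suc (Suc k)" and k': "m + 1 - Suc j = Suc k" using assms by (auto simp: k_def)
  let ?v = "\<lambda>x::real. 4 * x * (1 - x)"
  have v: "(?v has_real_derivative (4 - 8 * x)) (at x)"
    by (rule derivative_eq_intros refl)+ (simp add: algebra_simps)
  have "((\<lambda>x. max 0 (?v x) ^ Suc (Suc k)) has_real_derivative
      (real (Suc (Suc k)) * max 0 (?v x) ^ Suc k) * (4 - 8 * x)) (at x)"
    by (rule DERIV_chain2[OF has_real_derivative_pos_part_power v])
  then have "((\<lambda>x. max 0 (?v x) ^ Suc (Suc k) * poly (bump_factor m j) x) has_real_derivative
      (real (Suc (Suc k)) * max 0 (?v x) ^ Suc k) * (4 - 8 * x) * poly (bump_factor m j) x +
      poly (pderiv (bump_factor m j)) x * max 0 (?v x) ^ Suc (Suc k)) (at x)"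
    by (rule DERIV_mult[OF _ poly_DERIV])
  moreover have "max 0 (?v x) ^ Suc (Suc k) = max 0 (?v x) ^ Suc k * ?v x"
    by (cases "?v x \<le> 0") (auto simp: max_def)
  moreover have "poly (bump_factor m (Suc j)) x = real (Suc (Suc k)) * (4 - 8 * x) *
      poly (bump_factor m j) x + ?v x * poly (pderiv (bump_factor m j)) x"
    unfolding bump_factor.simps k by (simp add: algebra_simps)
  ultimately show ?thesis
    unfolding bump_deriv_def[abs_def] k k'
    by (elim DERIV_cong) (simp only: distrib_left distrib_right mult_ac)
qed

lemma bump_deriv_eq_0: "j \<le> m \<Longrightarrow> x \<notin> {0<..<1} \<Longrightarrow> bump_deriv m j x = 0"
proof -
  assume j: "j \<le> m" and "x \<notin> {0<..<1}"
  then have "x \<le> 0 \<or> 1 \<le> x" by auto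
  then have "x * (1 - x) \<le> 0"
    by (auto simp: mult_le_0_iff)
  then have "max 0 (4 * x * (1 - x)) = 0" by simp
  then show ?thesis using j by (simp add: bump_deriv_def)
qed

lemma continuous_bump_deriv: "continuous_on A (bump_deriv m j)"
  unfolding bump_deriv_def[abs_def] by (intro continuous_intros)

lemma bump_range: "0 \<le> bump_deriv m 0 x" "bump_deriv m 0 x \<le> 1"
proof -
  have "4 * x * (1 - x) = 1 - (2 * x - 1)\<^sup>2" by (simp add: power2_eq_square algebra_simps)
  then have "4 * x * (1 - x) \<le> 1" by simp
  then show "bump_deriv m 0 x \<le> 1"
    unfolding bump_deriv_def by (simp add: power_le_one del: power_Suc)
qed (simp add: bump_deriv_def)

lemma bump_half: "bump_deriv m 0 (1/2) = 1"
  by (simp add: bump_deriv_def)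

lemma bump_deriv_bounded: "\<exists>M>0. \<forall>j\<le>m. \<forall>x. \<bar>bump_deriv m j x\<bar> \<le> M"
proof -
  have "\<exists>M. \<forall>x. \<bar>bump_deriv m j x\<bar> \<le> M" if "j \<le> m" for j
  proof -
    have "compact (bump_deriv m j ` {0..1})"
      by (intro compact_continuous_image continuous_bump_deriv) auto
    then obtain M where M: "\<And>x. x \<in> {0..1} \<Longrightarrow> \<bar>bump_deriv m j x\<bar> \<le> M"
      by (metis bounded_iff compact_imp_bounded imageI real_norm_def)
    have "\<bar>bump_deriv m j x\<bar> \<le> M" for x
    proof (cases "x \<in> {0..1}")
      case False
      then show ?thesis using M[of 0] bump_deriv_eq_0[OF that, of x] by auto
    qed (rule M)
    then show ?thesis by blast
  qed
  then obtain M where M: "\<And>j x. j \<le> m \<Longrightarrow> \<bar>bump_deriv m j x\<bar> \<le> M j" by metis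
  have "\<bar>bump_deriv m j x\<bar> \<le> Max (M ` {..m})" if "j \<le> m" for j x
    using M[OF that, of x] that by (meson Max_ge atMost_iff finite_atMost finite_imageI imageI order_trans)
  then show ?thesis
    by (intro exI[of _ "max 1 (Max (M ` {..m}))"]) (auto simp: le_max_iff_disj)
qed

text \<open>\<open>profile m n S j\<close> is the derivative of order \<open>j\<close> of the sum of the bumps squeezed into the
  slots \<open>(i / n, (i + 1) / n)\<close> with \<open>i\<close> in \<open>S\<close>.\<close>
definition profile :: "nat \<Rightarrow> nat \<Rightarrow> nat set \<Rightarrow> nat \<Rightarrow> real \<Rightarrow> real" where
  "profile m n S j s = real n ^ j * (\<Sum>i\<in>S. bump_deriv m j (real n * s - real i))"

text \<open>The bumps have disjoint supports, so at each point at most one summand is left. Therefore a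
  sum of bumps obeys the same bounds as a single one.\<close>
lemma profile_eq:
  assumes "finite S" "j \<le> m"
  shows "profile m n S j s = real n ^ j *
    (if nat \<lfloor>real n * s\<rfloor> \<in> S then bump_deriv m j (real n * s - real (nat \<lfloor>real n * s\<rfloor>)) else 0)"
proof -
  let ?k = "nat \<lfloor>real n * s\<rfloor>"
  have "bump_deriv m j (real n * s - real i) = 0" if "i \<noteq> ?k" for i
  proof (rule bump_deriv_eq_0[OF assms(2)])
    show "real n * s - real i \<notin> {0<..<1}"
    proof
      assume "real n * s - real i \<in> {0<..<1}"
      then have "real i < real n * s" "real n * s < real i + 1" by auto
      then have "\<lfloor>real n * s\<rfloor> = int i" by linarith
      with that show False by simp
    qed
  qed
  then have "(\<Sum>i\<in>S. bump_deriv m j (real n * s - real i)) =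
      (\<Sum>i\<in>S. if i = ?k then bump_deriv m j (real n * s - real i) else 0)"
    by (intro sum.cong) auto
  then show ?thesis using assms(1) by (simp add: profile_def)
qed

lemma profile_range:
  assumes "finite S"
  shows "0 \<le> profile m n S 0 s" "profile m n S 0 s \<le> 1"
  by (auto simp: profile_eq[OF assms] bump_range)

lemma profile_bound:
  assumes "finite S" "j \<le> m" "n \<ge> 1" and M: "\<And>x. \<bar>bump_deriv m j x\<bar> \<le> M" "M \<ge> 0"
  shows "\<bar>profile m n S j s\<bar> \<le> real n ^ m * M"
proof -
  have "\<bar>profile m n S j s\<bar> \<le> real n ^ j * M"
    using M by (auto simp: profile_eq[OF assms(1,2)] abs_mult intro!: mult_left_mono)
  also have "\<dots> \<le> real n ^ m * M"
    using assms by (intro mult_right_mono power_increasing) auto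
  finally show ?thesis .
qed

lemma has_real_derivative_profile:
  assumes "finite S" "j < m"
  shows "(profile m n S j has_real_derivative profile m n S (Suc j) s) (at s)"
proof -
  have "((\<lambda>s. bump_deriv m j (real n * s - real i)) has_real_derivative
      bump_deriv m (Suc j) (real n * s - real i) * real n) (at s)" for i
    by (rule DERIV_chain2[OF has_real_derivative_bump_deriv[OF assms(2)]])
      (rule derivative_eq_intros refl | simp)+
  then have "((\<lambda>s. real n ^ j * (\<Sum>i\<in>S. bump_deriv m j (real n * s - real i))) has_real_derivative
     real n ^ j * (\<Sum>i\<in>S. bump_deriv m (Suc j) (real n * s - real i) * real n)) (at s)"
    by (intro DERIV_cmult DERIV_sum) auto
  moreover have "real n ^ j * (\<Sum>i\<in>S. bump_deriv m (Suc j) (real n * s - real i) * real n) =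
      profile m n S (Suc j) s"
    by (simp add: profile_def sum_distrib_left mult_ac)
  ultimately show ?thesis
    by (simp add: profile_def[abs_def])
qed

lemma continuous_profile: "continuous_on A (profile m n S j)"
  unfolding profile_def[abs_def]
  by (intro continuous_intros continuous_on_compose2[OF continuous_bump_deriv[of UNIV]]) auto

lemma profile_centre:
  assumes "finite S" "n \<ge> 1"
  shows "profile m n S 0 ((real i + 1/2) / real n) = (if i \<in> S then 1 else 0)"
proof -
  have *: "real n * ((real i + 1/2) / real n) = real i + 1/2" using assms by simp
  have "\<lfloor>real i + 1/2\<rfloor> = int i" by linarith
  then have "nat \<lfloor>real i + 1/2\<rfloor> = i" by simp
  then show ?thesis using bump_half[of m] unfolding profile_eq[OF assms(1) le0] * by simp
qed

lemma profile_outside: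
  assumes "finite S" "n \<ge> 1" "i \<notin> S" "\<bar>s - (real i + 1/2) / real n\<bar> < 1 / (2 * real n)"
  shows "profile m n S 0 s = 0"
proof -
  have n: "real n > 0" using assms by simp
  have "\<bar>real n * s - (real i + 1/2)\<bar> = real n * \<bar>s - (real i + 1/2) / real n\<bar>"
    using n by (simp add: abs_mult_pos' right_diff_distrib)
  also have "\<dots> < real n * (1 / (2 * real n))"
    using n assms(4) by (intro mult_strict_left_mono)
  finally have "\<bar>real n * s - (real i + 1/2)\<bar> < 1/2" using n by simp
  then have "\<lfloor>real n * s\<rfloor> = int i" by linarith
  then show ?thesis using assms by (simp add: profile_eq)
qed

section \<open>Derivatives of functions of the height\<close>

text \<open>A class of functions that contains the height \<open>y \<bullet> b / norm y\<close>, is closed under partial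
  derivatives, and whose members are bounded on spheres about 0: enough to control the chain rule for functions of the
  height without computing its coefficients.\<close>
inductive algebraic_off_0 :: "('a::euclidean_space \<Rightarrow> real) \<Rightarrow> bool" where
  const: "algebraic_off_0 (\<lambda>y. c)"
| coord: "algebraic_off_0 (\<lambda>y. y \<bullet> b)"
| inv_norm: "algebraic_off_0 (\<lambda>y. inverse (norm y))"
| add: "algebraic_off_0 f \<Longrightarrow> algebraic_off_0 g \<Longrightarrow> algebraic_off_0 (\<lambda>y. f y + g y)"
| mult: "algebraic_off_0 f \<Longrightarrow> algebraic_off_0 g \<Longrightarrow> algebraic_off_0 (\<lambda>y. f y * g y)"

lemma partial_deriv_eq: "(f has_derivative f') (at y) \<Longrightarrow> partial_deriv c f y = f' c"
  unfolding partial_deriv_def using frechet_derivative_at by metis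

lemma has_derivative_partial_deriv: 
  "f differentiable at y \<Longrightarrow> (f has_derivative (\<lambda>c. partial_deriv c f y)) (at y)"
  unfolding partial_deriv_def using frechet_derivative_works by (metis eta_contract_eq)

lemma has_derivative_inverse_norm:
  fixes y :: "'a::euclidean_space"
  assumes "y \<noteq> 0"
  shows "((\<lambda>y. inverse (norm y)) has_derivative (\<lambda>c. - (y \<bullet> c) * inverse (norm y) ^ 3)) (at y)"
proof -
  have "((\<lambda>y. inverse (norm y)) has_derivative
      (\<lambda>c. - (inverse (norm y) * (c \<bullet> sgn y) * inverse (norm y)))) (at y)"
    by (rule has_derivative_compose[OF has_derivative_norm[OF assms] has_derivative_inverse', unfolded o_def])
      (use assms in auto)
  then show ?thesis
    by (rule has_derivative_eq_rhs) (auto simp: sgn_div_norm power3_eq_cube inner_commute algebra_simps divide_inverse)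
qed

lemma algebraic_off_0_differentiable:
  "algebraic_off_0 f \<Longrightarrow> y \<noteq> 0 \<Longrightarrow> f differentiable at y"
proof (induction rule: algebraic_off_0.induct)
  case (coord b)
  show ?case by (rule differentiableI[of _ "\<lambda>y. y \<bullet> b"]) (auto intro!: derivative_eq_intros)
next
  case inv_norm
  then show ?case by (rule differentiableI[OF has_derivative_inverse_norm])
qed auto

lemma algebraic_off_0_partial_deriv:
  "algebraic_off_0 f \<Longrightarrow> \<exists>f'. algebraic_off_0 f' \<and> (\<forall>y. y \<noteq> 0 \<longrightarrow> partial_deriv c f y = f' y)"
proof (induction rule: algebraic_off_0.induct)
  case (const d)
  have "partial_deriv c (\<lambda>y. d) y = 0" for y :: 'a
    by (subst partial_deriv_eq[OF has_derivative_const]) simp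
  then show ?case by (intro exI[of _ "\<lambda>y. 0"]) (simp add: algebraic_off_0.const)
next
  case (coord b)
  have "partial_deriv c (\<lambda>y::'a. y \<bullet> b) y = c \<bullet> b" for y
    by (rule partial_deriv_eq) (auto intro!: derivative_eq_intros)
  then show ?case
    by (intro exI[of _ "\<lambda>y. c \<bullet> b"]) (simp add: algebraic_off_0.const)
next
  case inv_norm
  let ?i = "\<lambda>y::'a. inverse (norm y)"
  let ?f = "\<lambda>y. (-1) * ((y \<bullet> c) * (?i y * (?i y * ?i y)))"
  have "algebraic_off_0 ?f"
    by (intro algebraic_off_0.intros)
  moreover have "partial_deriv c ?i y = ?f y" if "y \<noteq> 0" for y
    using partial_deriv_eq[OF has_derivative_inverse_norm[OF that], of c] by (simp add: power3_eq_cube mult_ac)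
  ultimately show ?case by blast
next
  case (add f g)
  then obtain f' g' where *: "algebraic_off_0 f'" "algebraic_off_0 g'"
    "\<And>y. y \<noteq> 0 \<Longrightarrow> partial_deriv c f y = f' y" "\<And>y. y \<noteq> 0 \<Longrightarrow> partial_deriv c g y = g' y" by auto
  have "partial_deriv c (\<lambda>y. f y + g y) y = f' y + g' y" if "y \<noteq> 0" for y
    using partial_deriv_eq[OF has_derivative_add[OF has_derivative_partial_deriv has_derivative_partial_deriv], of f y g c]
      algebraic_off_0_differentiable add.hyps that * by auto
  then show ?case using * algebraic_off_0.add by blast
next
  case (mult f g)
  then obtain f' g' where *: "algebraic_off_0 f'" "algebraic_off_0 g'"
    "\<And>y. y \<noteq> 0 \<Longrightarrow> partial_deriv c f y = f' y" "\<And>y. y \<noteq> 0 \<Longrightarrow> partial_deriv c g y = g' y" by auto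
  have "partial_deriv c (\<lambda>y. f y * g y) y = f y * g' y + f' y * g y" if "y \<noteq> 0" for y
    using partial_deriv_eq[OF has_derivative_mult[OF has_derivative_partial_deriv has_derivative_partial_deriv], of f y g c]
      algebraic_off_0_differentiable mult.hyps that * by auto
  then show ?case using * mult.hyps
    by (intro exI[of _ "\<lambda>y. f y * g' y + f' y * g y"]) (auto intro!: algebraic_off_0.intros)
qed

lemma algebraic_off_0_continuous:
  "algebraic_off_0 f \<Longrightarrow> 0 \<notin> S \<Longrightarrow> continuous_on S f"
  by (intro continuous_at_imp_continuous_on ballI differentiable_imp_continuous_within
      algebraic_off_0_differentiable) auto

lemma partial_deriv_cong_open:
  assumes "open S" "\<And>y. y \<in> S \<Longrightarrow> f y = g y" "y \<in> S"
  shows "partial_deriv c f y = partial_deriv c g y"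
proof -
  have "(f has_derivative f') (at y) \<longleftrightarrow> (g has_derivative f') (at y)" for f'
    using assms has_derivative_transform_within_open[of f f' y UNIV S g]
      has_derivative_transform_within_open[of g f' y UNIV S f] by auto
  then show ?thesis by (simp add: partial_deriv_def frechet_derivative_def)
qed

lemma differentiable_cong_open:
  assumes "open S" "\<And>y. y \<in> S \<Longrightarrow> f y = g y" "y \<in> S"
  shows "f differentiable at y \<longleftrightarrow> g differentiable at y"
  unfolding differentiable_def
    using assms has_derivative_transform_within_open[of f _ y UNIV S g]
      has_derivative_transform_within_open[of g _ y UNIV S f] by (metis (no_types, lifting))

lemma Ck_on_cong_open:
  assumes "open S" "\<And>y. y \<in> S \<Longrightarrow> f y = g y"
  shows "Ck_on k f S \<longleftrightarrow> Ck_on k g S"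
  using assms(2)
proof (induction k arbitrary: f g)
  case 0
  then show ?case by (simp cong: continuous_on_cong)
next
  case (Suc k)
  have "Ck_on k (partial_deriv b f) S = Ck_on k (partial_deriv b g) S" for b
    by (intro Suc.IH partial_deriv_cong_open[OF assms(1)]) (use Suc.prems in auto)
  then show ?case using differentiable_cong_open[OF assms(1) Suc.prems] by simp
qed

definition height :: "'a::euclidean_space \<Rightarrow> 'a \<Rightarrow> real" where
  "height b y = (y \<bullet> b) * inverse (norm y)"

lemma algebraic_off_0_height: "algebraic_off_0 (height b)"
  unfolding height_def[abs_def] by (intro algebraic_off_0.intros)

text \<open>A $C^m$ function \<open>\<Psi> 0\<close> on the line together with its derivatives \<open>\<Psi> 1, ..., \<Psi> m\<close>.\<close>
definition jet :: "nat \<Rightarrow> (nat \<Rightarrow> real \<Rightarrow> real) \<Rightarrow> bool" where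
  "jet m \<Psi> \<longleftrightarrow> (\<forall>j<m. \<forall>s. (\<Psi> j has_real_derivative \<Psi> (Suc j) s) (at s)) \<and> continuous_on UNIV (\<Psi> m)"

text \<open>The form of all partial derivatives of order \<open>k\<close> of a function of the height, by the chain rule.\<close>
definition zonal :: "'a::euclidean_space \<Rightarrow> nat \<Rightarrow> (nat \<Rightarrow> real \<Rightarrow> real) \<Rightarrow> (nat \<Rightarrow> 'a \<Rightarrow> real) \<Rightarrow> 'a \<Rightarrow> real" where
  "zonal b k \<Psi> P y = (\<Sum>j\<le>k. \<Psi> j (height b y) * P j y)"

lemma jet_continuous:
  assumes "jet m \<Psi>" "j \<le> m" shows "continuous_on UNIV (\<Psi> j)"
proof (cases "j = m")
  case False
  then have "\<forall>s. isCont (\<Psi> j) s" using assms DERIV_isCont unfolding jet_def by (metis le_neq_implies_less)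
  then show ?thesis by (simp add: continuous_on_eq_continuous_at)
qed (use assms in \<open>simp add: jet_def\<close>)

text \<open>The new coefficients \<open>P'\<close> are chosen before \<open>\<Psi>\<close>. Therefore the bounds below are linear
  in the size of \<open>\<Psi>\<close>, with a factor that depends on the order and the dimension only.\<close>
lemma zonal_partial_deriv:
  fixes P :: "nat \<Rightarrow> 'a::euclidean_space \<Rightarrow> real"
  assumes P: "\<And>j. algebraic_off_0 (P j)"
  shows "\<exists>P'. (\<forall>j. algebraic_off_0 (P' j)) \<and> (\<forall>m \<Psi> y. jet m \<Psi> \<longrightarrow> k < m \<longrightarrow> y \<noteq> 0 \<longrightarrow>
      zonal b k \<Psi> P differentiable at y \<and> partial_deriv c (zonal b k \<Psi> P) y = zonal b (Suc k) \<Psi> P' y)"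
proof -
  obtain P1 where P1: "\<And>j. algebraic_off_0 (P1 j)" "\<And>j y. y \<noteq> 0 \<Longrightarrow> partial_deriv c (P j) y = P1 j y"
    using algebraic_off_0_partial_deriv[OF P] by metis
  obtain h1 where h1: "algebraic_off_0 h1" "\<And>y. y \<noteq> 0 \<Longrightarrow> partial_deriv c (height b) y = h1 y"
    using algebraic_off_0_partial_deriv[OF algebraic_off_0_height] by metis
  \<comment> \<open>the derivative falls on the coefficient or raises the order of \<open>\<Psi>\<close> by one\<close>
  define P' where "P' j y = (if j \<le> k then P1 j y else 0) + (case j of 0 \<Rightarrow> 0 | Suc i \<Rightarrow> h1 y * P i y)" for j y
  have "algebraic_off_0 (P' j)" for j
    unfolding P'_def[abs_def] using P P1(1) h1(1)
    by (cases j; cases "j \<le> k") (auto intro!: algebraic_off_0.intros)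
  moreover have "zonal b k \<Psi> P differentiable at y \<and> partial_deriv c (zonal b k \<Psi> P) y = zonal b (Suc k) \<Psi> P' y"
    if \<Psi>: "jet m \<Psi>" and "k < m" and y: "y \<noteq> 0" for m \<Psi> y
  proof -
    have h: "(height b has_derivative (\<lambda>c. partial_deriv c (height b) y)) (at y)"
      by (intro has_derivative_partial_deriv algebraic_off_0_differentiable[OF algebraic_off_0_height] y)
    have p: "(P j has_derivative (\<lambda>c. partial_deriv c (P j) y)) (at y)" for j
      by (intro has_derivative_partial_deriv algebraic_off_0_differentiable[OF P] y)
    have "((\<lambda>y. \<Psi> j (height b y)) has_derivative
        (\<lambda>c. \<Psi> (Suc j) (height b y) * partial_deriv c (height b) y)) (at y)" if "j \<le> k" for j
      by (rule has_derivative_compose[OF h]) (use \<Psi> that \<open>k < m\<close> in \<open>simp add: jet_def has_field_derivative_def\<close>)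
    then have "(zonal b k \<Psi> P has_derivative (\<lambda>c. \<Sum>j\<le>k. \<Psi> j (height b y) * partial_deriv c (P j) y +
        \<Psi> (Suc j) (height b y) * partial_deriv c (height b) y * P j y)) (at y)"
      unfolding zonal_def[abs_def] by (intro has_derivative_sum has_derivative_mult p) auto
    then have "zonal b k \<Psi> P differentiable at y" 
      and "partial_deriv c (zonal b k \<Psi> P) y = (\<Sum>j\<le>k. \<Psi> j (height b y) * P1 j y + \<Psi> (Suc j) (height b y) * h1 y * P j y)"
      using P1(2)[OF y] h1(2)[OF y] by (auto simp: partial_deriv_eq intro: differentiableI)
    moreover have "zonal b (Suc k) \<Psi> P' y = (\<Sum>j\<le>Suc k. if j \<le> k then \<Psi> j (height b y) * P1 j y else 0) +
       (\<Sum>j\<le>Suc k. \<Psi> j (height b y) * (case j of 0 \<Rightarrow> 0 | Suc i \<Rightarrow> h1 y * P i y))"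
      unfolding zonal_def P'_def by (subst sum.distrib[symmetric]) (auto intro!: sum.cong simp: distrib_left)
    moreover have "(\<Sum>j\<le>Suc k. if j \<le> k then \<Psi> j (height b y) * P1 j y else 0) = (\<Sum>j\<le>k. \<Psi> j (height b y) * P1 j y)"
      by simp
    moreover have "(\<Sum>j\<le>Suc k. \<Psi> j (height b y) * (case j of 0 \<Rightarrow> 0 | Suc i \<Rightarrow> h1 y * P i y)) =
       (\<Sum>j\<le>k. \<Psi> (Suc j) (height b y) * h1 y * P j y)"
      by (subst sum.atMost_Suc_shift) (simp add: mult_ac)
    ultimately show ?thesis by (simp add: sum.distrib)
  qed
  ultimately show ?thesis by blast
qed

lemma iter_partial_deriv_zonal:
  "\<exists>P. (\<forall>j. algebraic_off_0 (P j)) \<and> (\<forall>m \<Psi> y. jet m \<Psi> \<longrightarrow> length bs \<le> m \<longrightarrow> y \<noteq> 0 \<longrightarrow>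
      iter_partial_deriv bs (\<lambda>y. \<Psi> 0 (height b y)) y = zonal b (length bs) \<Psi> P y)"
proof (induction bs)
  case Nil
  show ?case
    by (intro exI[of _ "\<lambda>j y. 1"]) (auto simp: zonal_def algebraic_off_0.const)
next
  case (Cons c bs)
  then obtain P where P: "\<And>j. algebraic_off_0 (P j)" "\<And>m \<Psi> y. jet m \<Psi> \<Longrightarrow> length bs \<le> m \<Longrightarrow> y \<noteq> 0 \<Longrightarrow>
      iter_partial_deriv bs (\<lambda>y. \<Psi> 0 (height b y)) y = zonal b (length bs) \<Psi> P y" by blast
  obtain P' where P': "\<And>j. algebraic_off_0 (P' j)" "\<And>m \<Psi> y. jet m \<Psi> \<Longrightarrow> length bs < m \<Longrightarrow> y \<noteq> 0 \<Longrightarrow>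
      partial_deriv c (zonal b (length bs) \<Psi> P) y = zonal b (Suc (length bs)) \<Psi> P' y"
    using zonal_partial_deriv[of P "length bs" b c, OF P(1)] by blast
  have "iter_partial_deriv (c # bs) (\<lambda>y. \<Psi> 0 (height b y)) y = zonal b (length (c # bs)) \<Psi> P' y"
    if "jet m \<Psi>" "length (c # bs) \<le> m" "y \<noteq> 0" for m \<Psi> y
  proof -
    have "partial_deriv c (iter_partial_deriv bs (\<lambda>y. \<Psi> 0 (height b y))) y =
        partial_deriv c (zonal b (length bs) \<Psi> P) y"
      by (rule partial_deriv_cong_open[of "-{0}"]) (use P(2) that in auto)
    then show ?thesis using P'(2) that by simp
  qed
  then show ?case using P'(1) by blast
qed

lemma Ck_on_zonal:
  assumes "jet m \<Psi>" "k + i \<le> m" "\<And>j. algebraic_off_0 (P j)"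
  shows "Ck_on i (zonal b k \<Psi> P) (- {0})"
  using assms(2,3)
proof (induction i arbitrary: k P)
  case 0
  show ?case unfolding zonal_def[abs_def] Ck_on.simps
  proof (intro continuous_intros)
    fix j assume "j \<in> {..k}"
    then have "continuous_on UNIV (\<Psi> j)" using 0 by (intro jet_continuous[OF assms(1)]) auto
    then show "continuous_on (- {0}) (\<lambda>y. \<Psi> j (height b y))"
      by (rule continuous_on_compose2) (auto intro: algebraic_off_0_continuous algebraic_off_0_height)
    show "continuous_on (- {0}) (P j)" by (rule algebraic_off_0_continuous[OF 0(2)]) simp
  qed
next
  case (Suc i)
  have k: "k < m" using Suc.prems(1) by simp
  have "Ck_on i (partial_deriv c (zonal b k \<Psi> P)) (- {0})" for c
  proof -
    obtain P' where P': "\<And>j. algebraic_off_0 (P' j)"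
      and eq: "\<And>y. y \<noteq> 0 \<Longrightarrow> partial_deriv c (zonal b k \<Psi> P) y = zonal b (Suc k) \<Psi> P' y"
      using zonal_partial_deriv[of P k b c, OF Suc.prems(2)] assms(1) k by blast
    have "Ck_on i (zonal b (Suc k) \<Psi> P') (- {0})"
      using Suc.prems(1) by (intro Suc.IH P') simp
    moreover have "Ck_on i (partial_deriv c (zonal b k \<Psi> P)) (- {0}) \<longleftrightarrow>
        Ck_on i (zonal b (Suc k) \<Psi> P') (- {0})"
      by (rule Ck_on_cong_open) (use eq in auto)
    ultimately show ?thesis by simp
  qed
  moreover have "zonal b k \<Psi> P differentiable at y" if "y \<noteq> 0" for y
    using zonal_partial_deriv[of P k b 0, OF Suc.prems(2)] assms(1) k that by blast
  ultimately show ?case by simp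
qed

lemma iter_partial_deriv_zonal_bound:
  fixes b :: "'a::euclidean_space"
  assumes "r > 0"
  shows "\<exists>C>0. \<forall>\<Psi> M bs y. jet m \<Psi> \<longrightarrow> (\<forall>j\<le>m. \<forall>s. \<bar>\<Psi> j s\<bar> \<le> M) \<longrightarrow> set bs \<subseteq> Basis \<longrightarrow> length bs \<le> m \<longrightarrow>
     y \<in> sphere 0 r \<longrightarrow> \<bar>iter_partial_deriv bs (\<lambda>y. \<Psi> 0 (height b y)) y\<bar> \<le> C * M"
proof -
  have "\<exists>C. \<forall>\<Psi> M y. jet m \<Psi> \<longrightarrow> (\<forall>j\<le>m. \<forall>s. \<bar>\<Psi> j s\<bar> \<le> M) \<longrightarrow>
     y \<in> sphere 0 r \<longrightarrow> \<bar>iter_partial_deriv bs (\<lambda>y. \<Psi> 0 (height b y)) y\<bar> \<le> C * M"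
    if len: "length bs \<le> m" for bs
  proof -
    obtain P where P: "\<And>j. algebraic_off_0 (P j)" "\<And>\<Psi> y. jet m \<Psi> \<Longrightarrow> y \<noteq> 0 \<Longrightarrow>
      iter_partial_deriv bs (\<lambda>y. \<Psi> 0 (height b y)) y = zonal b (length bs) \<Psi> P y"
      using iter_partial_deriv_zonal[of bs b] len by blast
    have "\<exists>C. \<forall>y\<in>sphere 0 r. \<bar>P j y\<bar> \<le> C" for j
    proof -
      have "compact (P j ` sphere 0 r)"
        using assms by (intro compact_continuous_image algebraic_off_0_continuous P) auto
      then show ?thesis by (metis bounded_iff compact_imp_bounded imageI real_norm_def)
    qed
    then obtain C where C: "\<And>j y. y \<in> sphere 0 r \<Longrightarrow> \<bar>P j y\<bar> \<le> C j" by metis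
    have "\<bar>iter_partial_deriv bs (\<lambda>y. \<Psi> 0 (height b y)) y\<bar> \<le> (\<Sum>j\<le>length bs. C j) * M"
      if \<Psi>: "jet m \<Psi>" "\<forall>j\<le>m. \<forall>s. \<bar>\<Psi> j s\<bar> \<le> M" and y: "y \<in> sphere 0 r" for \<Psi> M y
    proof -
      have "y \<noteq> 0" using y assms by auto
      then have "\<bar>iter_partial_deriv bs (\<lambda>y. \<Psi> 0 (height b y)) y\<bar> = \<bar>\<Sum>j\<le>length bs. \<Psi> j (height b y) * P j y\<bar>"
        using P(2)[OF \<Psi>(1)] by (simp add: zonal_def)
      also have "\<dots> \<le> (\<Sum>j\<le>length bs. M * C j)"
      proof (rule order_trans[OF sum_abs sum_mono])
        fix j assume "j \<in> {..length bs}"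
        then have "\<bar>\<Psi> j (height b y)\<bar> \<le> M" using \<Psi>(2) len by auto
        moreover have "0 \<le> M" using calculation by linarith
        ultimately show "\<bar>\<Psi> j (height b y) * P j y\<bar> \<le> M * C j"
          unfolding abs_mult using C[OF y] by (intro mult_mono) auto
      qed
      finally show ?thesis by (simp add: sum_distrib_left mult.commute)
    qed
    then show ?thesis by blast
  qed
  then obtain C where C: "\<And>bs \<Psi> M y. length bs \<le> m \<Longrightarrow> jet m \<Psi> \<Longrightarrow> (\<forall>j\<le>m. \<forall>s. \<bar>\<Psi> j s\<bar> \<le> M) \<Longrightarrow>
     y \<in> sphere 0 r \<Longrightarrow> \<bar>iter_partial_deriv bs (\<lambda>y. \<Psi> 0 (height b y)) y\<bar> \<le> C bs * M" by metis
  let ?L = "{bs. set bs \<subseteq> (Basis :: 'a set) \<and> length bs \<le> m}"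
  have fin: "finite ?L" by (rule finite_lists_length_le) simp
  define K where "K = max 1 (Max (C ` ?L))"
  have "\<bar>iter_partial_deriv bs (\<lambda>y. \<Psi> 0 (height b y)) y\<bar> \<le> K * M"
    if \<Psi>: "jet m \<Psi>" "\<forall>j\<le>m. \<forall>s. \<bar>\<Psi> j s\<bar> \<le> M" and bs: "bs \<in> ?L" and y: "y \<in> sphere 0 r" for \<Psi> M bs y
  proof -
    have "0 \<le> \<bar>\<Psi> 0 0\<bar>" by simp
    also have "\<dots> \<le> M" using \<Psi>(2) by blast
    finally have M: "0 \<le> M" .
    have "C bs \<le> Max (C ` ?L)" using fin bs by (intro Max_ge) auto
    then have "C bs \<le> K" by (simp add: K_def)
    then have "C bs * M \<le> K * M" using M by (rule mult_right_mono)
    moreover have "\<bar>iter_partial_deriv bs (\<lambda>y. \<Psi> 0 (height b y)) y\<bar> \<le> C bs * M"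
      using C[OF _ \<Psi> y, of bs] bs by simp
    ultimately show ?thesis by linarith
  qed
  moreover have "K > 0" by (simp add: K_def)
  ultimately show ?thesis by blast
qed

section \<open>Radial subgraphs with zonal profile\<close>

text \<open>In \<open>y = 0\<close> the height takes the value 0, which is harmless for nonnegative \<open>\<psi>\<close>: the origin
  belongs to the body.\<close>
definition zonal_body :: "'a::euclidean_space \<Rightarrow> (real \<Rightarrow> real) \<Rightarrow> 'a set" where
  "zonal_body b \<psi> = {y. norm y \<le> 1/2 + \<psi> (height b y)}"

lemma height_scaleR: "t > 0 \<Longrightarrow> height b (t *\<^sub>R y) = height b y"
  by (simp add: height_def)

lemma radial_subgraph_zonal:
  fixes b :: "'a::euclidean_space"
  assumes \<psi>: "\<And>s. 0 \<le> \<psi> s"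
  shows "radial_subgraph 0 (1/2) (\<lambda>\<omega>. 1/2 + \<psi> (height b \<omega>)) = zonal_body b \<psi>"
proof (intro set_eqI iffI)
  fix y assume "y \<in> radial_subgraph 0 (1/2) (\<lambda>\<omega>. 1/2 + \<psi> (height b \<omega>))"
  then obtain \<rho> \<omega> where y: "y = \<rho> *\<^sub>R (\<omega> /\<^sub>R (1/2))" "0 \<le> \<rho>" "\<rho> \<le> 1/2 + \<psi> (height b \<omega>)" "norm \<omega> = 1/2"
    by (auto simp: radial_subgraph_def)
  have n: "norm y = \<rho>" using y by simp
  show "y \<in> zonal_body b \<psi>"
  proof (cases "\<rho> = 0")
    case True
    then show ?thesis using y \<psi>[of 0] by (simp add: zonal_body_def height_def)
  next
    case False
    then have "height b y = height b \<omega>"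
      using y height_scaleR[of "\<rho> * 2" b \<omega>] by simp
    then show ?thesis using y(3) unfolding zonal_body_def mem_Collect_eq n by simp
  qed
next
  fix y assume y: "y \<in> zonal_body b \<psi>"
  obtain c :: 'a where c: "norm c = 1" by (metis norm_Basis nonempty_Basis ex_in_conv)
  show "y \<in> radial_subgraph 0 (1/2) (\<lambda>\<omega>. 1/2 + \<psi> (height b \<omega>))"
  proof (cases "y = 0")
    case True
    then show ?thesis using c \<psi>[of "height b (c /\<^sub>R 2)"]
      unfolding radial_subgraph_def by (auto intro!: exI[of _ 0] exI[of _ "c /\<^sub>R 2"])
  next
    case False
    let ?\<omega> = "(1 / (2 * norm y)) *\<^sub>R y"
    have "height b ?\<omega> = height b y" using False by (intro height_scaleR) simp
    moreover have "norm ?\<omega> = 1/2" "y = norm y *\<^sub>R (?\<omega> /\<^sub>R (1/2))" using False by auto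
    ultimately show ?thesis using y
      unfolding radial_subgraph_def zonal_body_def by (intro CollectI exI[of _ "norm y"] exI[of _ ?\<omega>]) auto
  qed
qed

lemma radial_ext_zonal: "radial_ext 0 (1/2) (\<lambda>\<omega>. f (height b \<omega>)) = (\<lambda>y. f (height b y))"
proof
  fix y :: 'a
  show "radial_ext 0 (1/2) (\<lambda>\<omega>. f (height b \<omega>)) y = f (height b y)"
    by (cases "y = 0") (auto simp: radial_ext_def height_scaleR)
qed

text \<open>Adding the constant \<open>1 / 2\<close> changes no derivative, so \<open>\<Psi>\<close> serves for the norm of the
  difference to the radius and, with its first entry shifted, for the regularity of the profile itself.\<close>
lemma zonal_body_in_Y_class:
  fixes b :: "'a::euclidean_space"
  shows "\<exists>C>0. \<forall>\<Psi> M. jet m \<Psi> \<longrightarrow> (\<forall>j\<le>m. \<forall>s. \<bar>\<Psi> j s\<bar> \<le> M) \<longrightarrow> (\<forall>s. 0 \<le> \<Psi> 0 s \<and> \<Psi> 0 s \<le> \<epsilon>) \<longrightarrow>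
    C * M \<le> \<beta> \<longrightarrow> zonal_body b (\<Psi> 0) \<in> Y_class m \<beta> \<epsilon> 0 (1/2)"
proof -
  obtain C where C: "C > 0" "\<And>\<Psi> M bs y. jet m \<Psi> \<Longrightarrow> (\<forall>j\<le>m. \<forall>s. \<bar>\<Psi> j s\<bar> \<le> M) \<Longrightarrow> set bs \<subseteq> Basis \<Longrightarrow>
     length bs \<le> m \<Longrightarrow> y \<in> sphere 0 (1/2) \<Longrightarrow> \<bar>iter_partial_deriv bs (\<lambda>y. \<Psi> 0 (height b y)) y\<bar> \<le> C * M"
    using iter_partial_deriv_zonal_bound[of "1/2" m b] by auto
  have "zonal_body b (\<Psi> 0) \<in> Y_class m \<beta> \<epsilon> 0 (1/2)"
    if \<Psi>: "jet m \<Psi>" "\<forall>j\<le>m. \<forall>s. \<bar>\<Psi> j s\<bar> \<le> M" "\<forall>s. 0 \<le> \<Psi> 0 s \<and> \<Psi> 0 s \<le> \<epsilon>" and M: "C * M \<le> \<beta>" for \<Psi> M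
  proof -
    let ?g = "\<lambda>\<omega>. 1/2 + \<Psi> 0 (height b \<omega>)"
    define \<Phi> where "\<Phi> j = (if j = 0 then (\<lambda>s. 1/2 + \<Psi> 0 s) else \<Psi> j)" for j
    have jet: "jet m \<Phi>"
      unfolding jet_def
    proof (intro conjI allI impI)
      fix j s assume "j < m"
      then have "(\<Psi> j has_real_derivative \<Psi> (Suc j) s) (at s)" using \<Psi>(1) by (simp add: jet_def)
      then show "(\<Phi> j has_real_derivative \<Phi> (Suc j) s) (at s)"
        by (auto simp: \<Phi>_def intro!: derivative_eq_intros)
    next
      show "continuous_on UNIV (\<Phi> m)"
        using \<Psi>(1) by (auto simp: \<Phi>_def jet_def intro!: continuous_intros)
    qed
    have "Ck_on m (zonal b 0 \<Phi> (\<lambda>_ _. 1)) (- {0})"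
      by (rule Ck_on_zonal[OF jet]) (auto intro: algebraic_off_0.const)
    moreover have "zonal b 0 \<Phi> (\<lambda>_ _. 1) = radial_ext 0 (1/2) ?g"
      unfolding radial_ext_zonal[of "\<lambda>s. 1/2 + \<Psi> 0 s"] by (simp add: zonal_def \<Phi>_def fun_eq_iff)
    ultimately have "Cm_sphere m 0 (1/2) ?g" by (simp add: Cm_sphere_def)
    moreover have "Cm_sphere_norm m 0 (1/2) (\<lambda>\<omega>. ?g \<omega> - 1/2) \<le> \<beta>"
    proof -
      have "radial_ext 0 (1/2) (\<lambda>\<omega>. ?g \<omega> - 1/2) = (\<lambda>y. \<Psi> 0 (height b y))"
        using radial_ext_zonal[of "\<Psi> 0" b] by simp
      then have "Cm_sphere_norm m 0 (1/2) (\<lambda>\<omega>. ?g \<omega> - 1/2) =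
          (SUP (bs, y) \<in> {bs. set bs \<subseteq> Basis \<and> length bs \<le> m} \<times> sphere 0 (1/2).
            \<bar>iter_partial_deriv bs (\<lambda>y. \<Psi> 0 (height b y)) y\<bar>)"
        by (simp add: Cm_sphere_norm_def)
      also have "\<dots> \<le> C * M"
      proof (rule cSUP_least)
        have "sphere (0::'a) (1/2) \<noteq> {}" by simp
        moreover have "([]::'a list) \<in> {bs. set bs \<subseteq> Basis \<and> length bs \<le> m}" by simp
        ultimately show "{bs. set bs \<subseteq> (Basis::'a set) \<and> length bs \<le> m} \<times> sphere (0::'a) (1/2) \<noteq> {}" by blast
        fix p assume "p \<in> {bs. set bs \<subseteq> (Basis::'a set) \<and> length bs \<le> m} \<times> sphere (0::'a) (1/2)"
        then show "(case p of (bs, y) \<Rightarrow> \<bar>iter_partial_deriv bs (\<lambda>y. \<Psi> 0 (height b y)) y\<bar>) \<le> C * M"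
          using C(2)[OF \<Psi>(1,2), of "fst p" "snd p"] by (cases p) (simp del: mem_sphere)
      qed
      finally show ?thesis using M by linarith
    qed
    ultimately show ?thesis
      unfolding Y_class_def using radial_subgraph_zonal[of "\<Psi> 0" b] \<Psi>(3)
      by (intro CollectI exI[of _ ?g]) auto
  qed
  then show ?thesis using C(1) by blast
qed

lemma zonal_body_borel:
  assumes "continuous_on UNIV \<psi>"
  shows "zonal_body b \<psi> \<in> sets borel"
proof -
  have [measurable]: "\<psi> \<in> borel_measurable borel" by (rule borel_measurable_continuous_onI[OF assms])
  show ?thesis unfolding zonal_body_def height_def by measurable
qed

lemma hausdorff_dist_commute: "hausdorff_dist A B = hausdorff_dist B A"
  by (simp add: hausdorff_dist_def max.commute)

lemma hausdorff_dist_zonal_body_cball: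
  assumes \<psi>: "\<And>s. 0 \<le> \<psi> s" "\<And>s. \<psi> s \<le> \<epsilon>"
  shows "hausdorff_dist (zonal_body b \<psi>) (cball 0 (1/2)) \<le> \<epsilon>"
proof -
  have \<epsilon>: "0 \<le> \<epsilon>" using \<psi>[of 0] by linarith
  have sub: "cball 0 (1/2) \<subseteq> zonal_body b \<psi>"
    using \<psi>(1) by (auto simp: zonal_body_def intro: add_increasing2)
  have ne: "zonal_body b \<psi> \<noteq> {}" using sub by auto
  have "infdist x (cball 0 (1/2)) \<le> \<epsilon>" if "x \<in> zonal_body b \<psi>" for x
  proof (cases "norm x \<le> 1/2")
    case True
    then show ?thesis using \<epsilon> by (simp add: infdist_zero)
  next
    case False
    then have x0: "norm x > 0" by linarith
    have "dist x ((1 / (2 * norm x)) *\<^sub>R x) = norm ((1 - 1 / (2 * norm x)) *\<^sub>R x)"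
      by (simp add: dist_norm algebra_simps)
    also have "\<dots> = norm x - 1/2" using False x0 by (simp add: field_simps)
    also have "\<dots> \<le> \<epsilon>" using that \<psi>(2)[of "height b x"] by (simp add: zonal_body_def)
    finally have "dist x ((1 / (2 * norm x)) *\<^sub>R x) \<le> \<epsilon>" .
    moreover have "(1 / (2 * norm x)) *\<^sub>R x \<in> cball 0 (1/2)" using x0 by simp
    ultimately show ?thesis by (rule infdist_le2[rotated])
  qed
  moreover have "infdist y (zonal_body b \<psi>) \<le> \<epsilon>" if "y \<in> cball 0 (1/2)" for y
    using that sub \<epsilon> by (simp add: infdist_zero subsetD)
  ultimately show ?thesis
    unfolding hausdorff_dist_def using ne by (intro max.boundedI cSUP_least) auto
qed

text \<open>Radial projection onto the sphere of radius \<open>1 / 2\<close> does not increase distances outside that sphere.\<close>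
lemma norm_diff_ge_angle:
  fixes u v :: "'a::real_inner"
  assumes "norm u = 1" "norm v = 1" "r \<ge> 1/2" "s \<ge> 1/2"
  shows "norm (u - v) / 2 \<le> norm (r *\<^sub>R u - s *\<^sub>R v)"
proof -
  have uv: "u \<bullet> u = 1" "v \<bullet> v = 1" using assms by (simp_all add: norm_eq_1)
  have "u \<bullet> v \<le> 1" using norm_cauchy_schwarz[of u v] assms by simp
  moreover have "1/4 \<le> r * s" using mult_mono[of "1/2" r "1/2" s] assms by simp
  ultimately have "1/4 * (1 - u \<bullet> v) \<le> r * s * (1 - u \<bullet> v)" by (intro mult_right_mono) auto
  then have "0 + 2 * (1/4 * (1 - u \<bullet> v)) \<le> (r - s)\<^sup>2 + 2 * (r * s * (1 - u \<bullet> v))"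
    by (intro add_mono mult_left_mono) auto
  then have "(2 - 2 * (u \<bullet> v)) / 4 \<le> (r - s)\<^sup>2 + 2 * (r * s * (1 - u \<bullet> v))"
    by simp
  moreover have "(norm (u - v) / 2)\<^sup>2 = (2 - 2 * (u \<bullet> v)) / 4"
    using uv by (simp add: power_divide power2_norm_eq_inner inner_diff_left inner_diff_right inner_commute)
  moreover have "(norm (r *\<^sub>R u - s *\<^sub>R v))\<^sup>2 = (r - s)\<^sup>2 + 2 * (r * s * (1 - u \<bullet> v))"
    unfolding power2_norm_eq_inner using uv
    by (simp add: inner_diff_left inner_diff_right inner_commute power2_eq_square algebra_simps)
  ultimately have "(norm (u - v) / 2)\<^sup>2 \<le> (norm (r *\<^sub>R u - s *\<^sub>R v))\<^sup>2" by simp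
  then show ?thesis by (rule power2_le_imp_le) simp
qed

text \<open>The top of the bump of \<open>\<psi>\<close> at \<open>s0\<close> has distance at least \<open>\<epsilon>\<close> from the
  other body: points of that body in directions of height near \<open>s0\<close> lie in the ball of radius \<open>1 / 2\<close>, and
  its points outside this ball have a direction that differs by at least \<open>\<delta>\<close>, hence are
  at least \<open>\<delta> / 2\<close> away. Dimension two is needed for a direction of height \<open>s0\<close> to exist.\<close>
lemma hausdorff_dist_zonal_bodies:
  fixes b :: "'a::euclidean_space"
  assumes b: "b \<in> Basis" and dim: "DIM('a) \<ge> 2"
    and \<psi>: "\<And>s. 0 \<le> \<psi> s" "\<And>s. \<psi> s \<le> \<epsilon>" "\<psi> s0 = \<epsilon>" "\<bar>s0\<bar> \<le> 1"
    and \<phi>: "\<And>s. 0 \<le> \<phi> s" "\<And>s. \<phi> s \<le> \<epsilon>" "\<And>s. \<bar>s - s0\<bar> < \<delta> \<Longrightarrow> \<phi> s = 0"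
    and \<epsilon>: "2 * \<epsilon> \<le> \<delta>"
  shows "\<epsilon> \<le> hausdorff_dist (zonal_body b \<psi>) (zonal_body b \<phi>)"
proof -
  have \<epsilon>0: "0 \<le> \<epsilon>" using \<psi>(1,2)[of 0] by linarith
  obtain c where c: "c \<in> Basis" "c \<noteq> b"
  proof -
    have "Basis \<noteq> {b}" using dim by (metis card_1_singleton_iff Suc_1 not_less_eq_eq order_refl One_nat_def)
    then show ?thesis using that b by blast
  qed
  have ip: "b \<bullet> b = 1" "c \<bullet> c = 1" "b \<bullet> c = 0" "c \<bullet> b = 0" using b c by (auto simp: inner_Basis)
  \<comment> \<open>a unit vector of height \<open>s0\<close>\<close>
  define \<omega> where "\<omega> = s0 *\<^sub>R b + sqrt (1 - s0\<^sup>2) *\<^sub>R c"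
  have s0: "s0\<^sup>2 \<le> 1" using \<psi>(4) by (simp add: abs_square_le_1)
  have "\<omega> \<bullet> \<omega> = 1" unfolding \<omega>_def using ip s0
    by (simp add: inner_add_left inner_add_right power2_eq_square[symmetric])
  then have \<omega>1: "norm \<omega> = 1" by (simp add: norm_eq_1)
  have \<omega>b: "\<omega> \<bullet> b = s0" unfolding \<omega>_def using ip by (simp add: inner_add_left)
  define p where "p = (1/2 + \<epsilon>) *\<^sub>R \<omega>"
  have np: "norm p = 1/2 + \<epsilon>" using \<epsilon>0 \<omega>1 by (simp add: p_def)
  have "height b p = s0" using \<epsilon>0 height_scaleR[of "1/2 + \<epsilon>" b \<omega>] \<omega>1 \<omega>b by (simp add: p_def height_def)
  then have p: "p \<in> zonal_body b \<psi>" using np \<psi>(3) by (simp add: zonal_body_def)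
  have sub: "zonal_body b \<psi> \<subseteq> cball 0 (1/2 + \<epsilon>)"
  proof
    fix y assume "y \<in> zonal_body b \<psi>"
    then show "y \<in> cball 0 (1/2 + \<epsilon>)"
      using \<psi>(2)[of "height b y"] by (simp add: zonal_body_def)
  qed
  have z: "0 \<in> zonal_body b \<phi>" using \<phi>(1) by (simp add: zonal_body_def add_nonneg_nonneg)
  have "\<epsilon> \<le> infdist p (zonal_body b \<phi>)"
    unfolding infdist_def
  proof (subst if_not_P, use z in blast, rule cINF_greatest)
    show "zonal_body b \<phi> \<noteq> {}" using z by blast
    fix q assume q: "q \<in> zonal_body b \<phi>"
    show "\<epsilon> \<le> dist p q"
    proof (cases "norm q \<le> 1/2")
      case True
      then show ?thesis using np norm_triangle_ineq2[of p q] by (simp add: dist_norm)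
    next
      case False
      then have "\<phi> (height b q) \<noteq> 0" using q by (auto simp: zonal_body_def)
      then have far: "\<delta> \<le> \<bar>height b q - s0\<bar>" using \<phi>(3) by force
      have q0: "norm q > 0" using False by linarith
      let ?\<eta> = "q /\<^sub>R norm q"
      have \<eta>: "norm ?\<eta> = 1" "norm q *\<^sub>R ?\<eta> = q" using q0 by auto
      have "height b q - s0 = (?\<eta> - \<omega>) \<bullet> b"
        by (simp add: height_def inner_diff_left \<omega>b)
      then have "\<delta> \<le> norm (?\<eta> - \<omega>)" using far Basis_le_norm[OF b, of "?\<eta> - \<omega>"] by simp
      also have "\<dots> = norm (\<omega> - ?\<eta>)" by (rule norm_minus_commute)
      also have "\<dots> \<le> 2 * norm ((1/2 + \<epsilon>) *\<^sub>R \<omega> - norm q *\<^sub>R ?\<eta>)"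
        using norm_diff_ge_angle[OF \<omega>1 \<eta>(1), of "1/2 + \<epsilon>" "norm q"] \<epsilon>0 False by simp
      also have "\<dots> = 2 * dist p q" unfolding \<eta>(2) by (simp add: p_def dist_norm)
      finally show ?thesis using \<epsilon> by simp
    qed
  qed
  also have "\<dots> \<le> (SUP x\<in>zonal_body b \<psi>. infdist x (zonal_body b \<phi>))"
  proof (rule cSUP_upper[OF p])
    show "bdd_above ((\<lambda>x. infdist x (zonal_body b \<phi>)) ` zonal_body b \<psi>)"
      using sub infdist_le[OF z] by (intro bdd_aboveI2[of _ _ "1/2 + \<epsilon>"]) (force intro: order_trans)
  qed
  also have "\<dots> \<le> hausdorff_dist (zonal_body b \<psi>) (zonal_body b \<phi>)"
    by (simp add: hausdorff_dist_def)
  finally show ?thesis .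
qed

lemma jet_profile:
  assumes "finite S"
  shows "jet m (\<lambda>j s. \<epsilon> * profile m n S j s)"
  unfolding jet_def
  using has_real_derivative_profile[OF assms] continuous_profile[of UNIV m n S m]
  by (auto intro!: DERIV_cmult continuous_on_mult_left)

text \<open>One body for each set of slots. The three smallness conditions place the profile between \<open>1 / 2\<close> and
  \<open>3 / 4\<close>, make half a slot at least \<open>2 \<epsilon>\<close> wide, and bound the $C^m$ norm.\<close>
lemma exists_many_zonal_bodies:
  fixes b :: "'a::euclidean_space"
  assumes b: "b \<in> Basis" and dim: "DIM('a) \<ge> 2" and \<beta>: "\<beta> > 0"
  shows "\<exists>\<kappa>>0. \<forall>\<epsilon> n. 0 < \<epsilon> \<longrightarrow> \<epsilon> \<le> 1/4 \<longrightarrow> 1 \<le> n \<longrightarrow> 4 * \<epsilon> * real n \<le> 1 \<longrightarrow> \<epsilon> * real n ^ m \<le> \<kappa> \<longrightarrow>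
    (\<exists>D. \<forall>S \<subseteq> {..<n}. D S \<in> Y_class m \<beta> (1/4) 0 (1/2) \<and> D S \<in> sets (borel :: 'a measure) \<and>
       hausdorff_dist (D S) (cball 0 (1/2)) \<le> \<epsilon> \<and>
       (\<forall>T \<subseteq> {..<n}. S \<noteq> T \<longrightarrow> \<epsilon> \<le> hausdorff_dist (D S) (D T)))"
proof -
  obtain B where B: "B > 0" "\<forall>j\<le>m. \<forall>x. \<bar>bump_deriv m j x\<bar> \<le> B" using bump_deriv_bounded by blast
  obtain C where C: "C > 0" "\<And>\<Psi> M. jet m \<Psi> \<Longrightarrow> (\<forall>j\<le>m. \<forall>s. \<bar>\<Psi> j s\<bar> \<le> M) \<Longrightarrow> (\<forall>s. 0 \<le> \<Psi> 0 s \<and> \<Psi> 0 s \<le> 1/4) \<Longrightarrow>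
    C * M \<le> \<beta> \<Longrightarrow> zonal_body b (\<Psi> 0) \<in> Y_class m \<beta> (1/4) 0 (1/2)"
    using zonal_body_in_Y_class[of m "1/4" \<beta> b] by blast
  define \<kappa> where "\<kappa> = \<beta> / (C * B)"
  have "\<exists>D. \<forall>S \<subseteq> {..<n}. D S \<in> Y_class m \<beta> (1/4) 0 (1/2) \<and> D S \<in> sets (borel :: 'a measure) \<and>
       hausdorff_dist (D S) (cball 0 (1/2)) \<le> \<epsilon> \<and>
       (\<forall>T \<subseteq> {..<n}. S \<noteq> T \<longrightarrow> \<epsilon> \<le> hausdorff_dist (D S) (D T))"
    if \<epsilon>: "0 < \<epsilon>" "\<epsilon> \<le> 1/4" and n: "1 \<le> n" "4 * \<epsilon> * real n \<le> 1" and \<epsilon>n: "\<epsilon> * real n ^ m \<le> \<kappa>" for \<epsilon> n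
  proof -
    define \<psi> where "\<psi> S s = \<epsilon> * profile m n S 0 s" for S s
    define D where "D S = zonal_body b (\<psi> S)" for S
    have range: "0 \<le> \<psi> S s" "\<psi> S s \<le> \<epsilon>" if "S \<subseteq> {..<n}" for S s
      using profile_range[of S m n s] finite_subset[OF that] \<epsilon> by (auto simp: \<psi>_def mult_left_le)
    have sep: "\<epsilon> \<le> hausdorff_dist (D S) (D T)"
      if S: "S \<subseteq> {..<n}" and T: "T \<subseteq> {..<n}" and i: "i \<in> S" "i \<notin> T" for S T i
      unfolding D_def
    proof (rule hausdorff_dist_zonal_bodies[OF b dim range(1)[OF S] range(2)[OF S] _ _ range(1)[OF T] range(2)[OF T]])
      have fin: "finite S" "finite T" using S T finite_subset by blast+
      show "\<psi> S ((real i + 1/2) / real n) = \<epsilon>"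
        using profile_centre[OF fin(1) n(1), of m i] i by (simp add: \<psi>_def)
      show "\<bar>(real i + 1/2) / real n\<bar> \<le> 1"
        using i S n(1) by (auto simp: field_simps)
      show "\<psi> T s = 0" if "\<bar>s - (real i + 1/2) / real n\<bar> < 1 / (2 * real n)" for s
        using profile_outside[OF fin(2) n(1) i(2) that] by (simp add: \<psi>_def)
      \<comment> \<open>the slots have half width \<open>1 / (2 n)\<close>\<close>
      show "2 * \<epsilon> \<le> 1 / (2 * real n)" using n by (simp add: field_simps)
    qed
    have "D S \<in> Y_class m \<beta> (1/4) 0 (1/2) \<and> D S \<in> sets borel \<and> hausdorff_dist (D S) (cball 0 (1/2)) \<le> \<epsilon> \<and>
       (\<forall>T \<subseteq> {..<n}. S \<noteq> T \<longrightarrow> \<epsilon> \<le> hausdorff_dist (D S) (D T))" if S: "S \<subseteq> {..<n}" for S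
    proof (intro conjI allI impI)
      have fin: "finite S" using S finite_subset by blast
      show "D S \<in> Y_class m \<beta> (1/4) 0 (1/2)"
        unfolding D_def \<psi>_def[abs_def]
      proof (rule C(2)[OF jet_profile[OF fin]])
        show "\<forall>j\<le>m. \<forall>s. \<bar>\<epsilon> * profile m n S j s\<bar> \<le> \<epsilon> * (real n ^ m * B)"
          using profile_bound[OF fin _ n(1), of _ m B] B \<epsilon> by (auto simp: abs_mult intro!: mult_left_mono)
        show "\<forall>s. 0 \<le> \<epsilon> * profile m n S 0 s \<and> \<epsilon> * profile m n S 0 s \<le> 1/4"
          using range[OF S] \<epsilon>(2) unfolding \<psi>_def by (meson order_trans)
        show "C * (\<epsilon> * (real n ^ m * B)) \<le> \<beta>"
          using \<epsilon>n C(1) B(1) by (simp add: \<kappa>_def field_simps)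
      qed
      show "D S \<in> sets borel"
        unfolding D_def \<psi>_def by (intro zonal_body_borel continuous_intros continuous_profile)
      show "hausdorff_dist (D S) (cball 0 (1/2)) \<le> \<epsilon>"
        unfolding D_def by (rule hausdorff_dist_zonal_body_cball[OF range[OF S]])
      fix T assume T: "T \<subseteq> {..<n}" and "S \<noteq> T"
      then consider i where "i \<in> S" "i \<notin> T" | i where "i \<in> T" "i \<notin> S" by blast
      then show "\<epsilon> \<le> hausdorff_dist (D S) (D T)"
        using sep[OF S T] sep[OF T S] by cases (auto simp: hausdorff_dist_commute[of "D S"])
    qed
    then show ?thesis by blast
  qed
  moreover have "\<kappa> > 0" using \<beta> C(1) B(1) by (simp add: \<kappa>_def)
  ultimately show ?thesis by blast
qed

section \<open>Surface measure and volume\<close>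

lemma integral_lborel_scaleR:
  fixes f :: "'a::euclidean_space \<Rightarrow> real"
  assumes [measurable]: "f \<in> borel_measurable borel" and "c > 0"
  shows "(\<integral>x. f x \<partial>lborel) = c ^ DIM('a) * (\<integral>x. f (c *\<^sub>R x) \<partial>lborel)"
  by (subst lborel_affine[of c 0]) (use assms(2) in \<open>simp_all add: integral_density integral_distr\<close>)

lemma nn_integral_lborel_affine:
  fixes f :: "'a::euclidean_space \<Rightarrow> ennreal"
  assumes [measurable]: "f \<in> borel_measurable borel" and "c > 0"
  shows "(\<integral>\<^sup>+x. f x \<partial>lborel) = ennreal (c ^ DIM('a)) * (\<integral>\<^sup>+x. f (t + c *\<^sub>R x) \<partial>lborel)"
  by (subst lborel_affine[of c t]) (use assms(2) in \<open>simp_all add: nn_integral_density nn_integral_distr nn_integral_cmult\<close>)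

text \<open>The set whose volume determines the surface measure of \<open>A\<close>.\<close>
definition solid_cone :: "'a::euclidean_space set \<Rightarrow> 'a set" where
  "solid_cone A = {x \<in> ball 0 1. sgn x \<in> A}"

lemma ball_borel [measurable]: "ball x r \<in> sets borel"
  by (rule borel_open[OF open_ball])

lemma solid_cone_borel [measurable]:
  assumes "A \<in> sets borel"
  shows "solid_cone A \<in> sets borel"
proof -
  have "sgn -` A \<inter> space borel \<in> sets (borel :: 'a measure)"
    by (rule measurable_sets[OF borel_measurable_sgn assms])
  moreover have "solid_cone A = ball 0 1 \<inter> (sgn -` A \<inter> space borel)"
    by (auto simp: solid_cone_def)
  ultimately show ?thesis by simp
qed

text \<open>Integrals of Borel functions are taken over restrictions of the Borel measure, because dilations and product
  measures are handled there; the passage to the completed measure comes with the Sobolev functions.\<close>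
abbreviation lborel_on :: "'a::euclidean_space set \<Rightarrow> 'a measure" where
  "lborel_on C \<equiv> restrict_space lborel C"

lemma finite_measure_lborel_on:
  fixes C :: "'a::euclidean_space set"
  assumes "C \<in> sets borel" "C \<subseteq> ball 0 1"
  shows "finite_measure (lborel_on C)"
proof
  have "emeasure lborel C \<le> emeasure lborel (ball 0 1 :: 'a set)"
    using assms by (intro emeasure_mono) auto
  also have "\<dots> < \<infinity>" by (rule emeasure_bounded_finite) simp
  finally show "emeasure (lborel_on C) (space (lborel_on C)) \<noteq> \<infinity>"
    using assms by (simp add: space_restrict_space emeasure_restrict_space)
qed

lemma integrable_bounded_lborel_on:
  fixes f :: "'a::euclidean_space \<Rightarrow> real"
  assumes "C \<in> sets borel" "C \<subseteq> ball 0 1" "f \<in> borel_measurable borel" "\<And>x. x \<in> C \<Longrightarrow> \<bar>f x\<bar> \<le> K"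
  shows "integrable (lborel_on C) f"
proof -
  interpret finite_measure "lborel_on C" by (rule finite_measure_lborel_on[OF assms(1,2)])
  show ?thesis
    by (rule integrable_const_bound[where B = K])
      (use assms in \<open>auto simp: space_restrict_space measurable_restrict_space1\<close>)
qed

lemma bounded_on_cball:
  fixes f :: "'a::euclidean_space \<Rightarrow> 'b::real_normed_vector"
  assumes "continuous_on UNIV f"
  obtains K where "K \<ge> 0" "\<And>x. x \<in> cball 0 1 \<Longrightarrow> norm (f x) \<le> K"
proof -
  have "compact (f ` cball 0 1)"
    by (intro compact_continuous_image continuous_on_subset[OF assms]) auto
  then obtain K where K: "\<And>x. x \<in> cball 0 1 \<Longrightarrow> norm (f x) \<le> K"
    by (metis bounded_iff compact_imp_bounded imageI)
  have "0 \<le> norm (f 0)" by simp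
  also have "\<dots> \<le> K" by (rule K) simp
  finally show ?thesis using K that by blast
qed

lemma sets_sphere_measure [simp, measurable_cong]: "sets sphere_measure = sets borel"
  by (simp add: sphere_measure_def)

lemma space_sphere_measure [simp]: "space sphere_measure = UNIV"
  by (simp add: sphere_measure_def)

lemma integral_sphere_measure:
  fixes f :: "'a::euclidean_space \<Rightarrow> real"
  assumes [measurable]: "f \<in> borel_measurable borel"
  shows "(\<integral>x. f x \<partial>sphere_measure) = real DIM('a) * (\<integral>x. f (sgn x) \<partial>lborel_on (ball 0 1))"
proof -
  have eq: "of_nat DIM('a) * indicator (ball 0 1) x = ennreal (real DIM('a) * indicator (ball 0 1) x)" for x :: 'a
    by (simp add: ennreal_mult'' ennreal_of_nat_eq_real_of_nat split: split_indicator)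
  have "(\<integral>x. f x \<partial>sphere_measure) = (\<integral>x. f (sgn x) \<partial>density lborel (\<lambda>x. ennreal (real DIM('a) * indicator (ball 0 1) x)))"
    unfolding sphere_measure_def eq by (rule integral_distr) simp_all
  also have "\<dots> = (\<integral>x. (real DIM('a) * indicator (ball 0 1) x) *\<^sub>R f (sgn x) \<partial>lborel)"
    by (rule integral_density) simp_all
  also have "\<dots> = (\<integral>x. real DIM('a) * (indicator (ball 0 1) x *\<^sub>R f (sgn x)) \<partial>lborel)"
    by (simp add: mult.assoc)
  also have "\<dots> = real DIM('a) * (\<integral>x. indicator (ball 0 1) x *\<^sub>R f (sgn x) \<partial>lborel)"
    by (rule integral_mult_right_zero)
  finally show ?thesis by (simp add: integral_restrict_space)
qed

lemma finite_measure_sphere_measure: "finite_measure (sphere_measure :: 'a::euclidean_space measure)"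
proof
  have fin: "emeasure lborel (ball 0 1 :: 'a set) < \<infinity>" by (rule emeasure_bounded_finite) simp
  have "emeasure (sphere_measure :: 'a measure) (space sphere_measure) =
      (\<integral>\<^sup>+x. of_nat DIM('a) * indicator (ball 0 1 :: 'a set) x \<partial>lborel)"
    unfolding sphere_measure_def by (subst emeasure_distr) (simp_all add: emeasure_density)
  also have "\<dots> = of_nat DIM('a) * emeasure lborel (ball 0 1 :: 'a set)"
    by (simp add: nn_integral_cmult)
  finally show "emeasure (sphere_measure :: 'a measure) (space sphere_measure) \<noteq> \<infinity>"
    using fin by (simp add: ennreal_mult_eq_top_iff)
qed

lemma integral_sphere_measure_indicator:
  fixes f :: "'a::euclidean_space \<Rightarrow> real"
  assumes [measurable]: "f \<in> borel_measurable borel" "A \<in> sets borel"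
  shows "(\<integral>x. indicator A x * f x \<partial>sphere_measure) = real DIM('a) * (\<integral>x. f (sgn x) \<partial>lborel_on (solid_cone A))"
proof -
  have "indicator (ball 0 1) x * (indicator A (sgn x) * f (sgn x)) = indicator (solid_cone A) x * f (sgn x)" for x
    by (auto simp: solid_cone_def split: split_indicator)
  then have "(\<integral>x. indicator (ball 0 1) x * (indicator A (sgn x) * f (sgn x)) \<partial>lborel) =
      (\<integral>x. indicator (solid_cone A) x * f (sgn x) \<partial>lborel)"
    by (intro Bochner_Integration.integral_cong refl)
  then show ?thesis
    by (simp add: integral_sphere_measure integral_restrict_space)
qed

lemma measure_sphere_measure:
  fixes A :: "'a::euclidean_space set"
  assumes A[measurable]: "A \<in> sets borel"
  shows "measure sphere_measure A = real DIM('a) * measure lborel (solid_cone A)"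
proof -
  have "(\<integral>x. indicator A x * 1 \<partial>sphere_measure) = real DIM('a) * (\<integral>x. 1 \<partial>lborel_on (solid_cone A))"
    by (rule integral_sphere_measure_indicator) simp_all
  then show ?thesis using A by (simp add: measure_restrict_space space_restrict_space)
qed

lemma gradient_continuous:
  fixes w :: "'a::euclidean_space \<Rightarrow> real"
  assumes "\<And>x. (w has_derivative (\<lambda>h. g x \<bullet> h)) (at x)"
  shows "continuous_on UNIV w"
  using assms by (meson continuous_at_imp_continuous_on has_derivative_continuous)

lemma lipschitz_on_cball:
  fixes w :: "'a::euclidean_space \<Rightarrow> real"
  assumes D: "\<And>x. (w has_derivative (\<lambda>h. g x \<bullet> h)) (at x)" and K: "\<And>x. x \<in> cball 0 1 \<Longrightarrow> norm (g x) \<le> K"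
    and xy: "x \<in> cball 0 1" "y \<in> cball 0 1"
  shows "\<bar>w x - w y\<bar> \<le> K * norm (x - y)"
proof -
  have "onorm (\<lambda>h. g z \<bullet> h) \<le> K" if "z \<in> cball 0 1" for z
  proof (rule onorm_le)
    fix h
    have "norm (g z \<bullet> h) \<le> norm (g z) * norm h" by (rule Cauchy_Schwarz_ineq2[folded real_norm_def])
    also have "\<dots> \<le> K * norm h" by (intro mult_right_mono K that) simp
    finally show "norm (g z \<bullet> h) \<le> K * norm h" .
  qed
  then show ?thesis
    using differentiable_bound[of "cball 0 1" w "\<lambda>x h. g x \<bullet> h" K y x] xy has_derivative_at_withinI[OF D]
    by (simp add: norm_minus_commute)
qed

text \<open>A cone is mapped by the dilation with factor \<open>s\<close> onto its part inside the ball of radius \<open>s\<close>.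
  The restriction to subsets of the sphere keeps the origin out of the cone.\<close>
lemma integral_on_cone_scaled:
  fixes f :: "'a::euclidean_space \<Rightarrow> real"
  assumes [measurable]: "f \<in> borel_measurable borel" "A \<in> sets borel" and A: "A \<subseteq> sphere 0 1" and s: "0 < s" "s < 1"
  shows "s ^ DIM('a) * (\<integral>x. f (s *\<^sub>R x) \<partial>lborel_on (solid_cone A)) =
    (\<integral>y. indicator (ball 0 s) y * f y \<partial>lborel_on (solid_cone A))"
proof -
  have "indicator (solid_cone A) (s *\<^sub>R x) * (indicator (ball 0 s) (s *\<^sub>R x) * f (s *\<^sub>R x)) =
      indicator (solid_cone A) x * f (s *\<^sub>R x)" for x
  proof -
    have "sgn (s *\<^sub>R x) = sgn x" using s by (simp add: sgn_scaleR)
    moreover have "s * norm x < 1" if "norm x < 1" using that s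
      using mult_strict_mono[of s 1 "norm x" 1] by simp
    ultimately show ?thesis using s by (auto simp: solid_cone_def split: split_indicator)
  qed
  then have "(\<integral>x. indicator (solid_cone A) (s *\<^sub>R x) * (indicator (ball 0 s) (s *\<^sub>R x) * f (s *\<^sub>R x)) \<partial>lborel) =
      (\<integral>x. indicator (solid_cone A) x * f (s *\<^sub>R x) \<partial>lborel)"
    by (intro Bochner_Integration.integral_cong refl)
  then show ?thesis
    using integral_lborel_scaleR[of "\<lambda>y. indicator (solid_cone A) y * (indicator (ball 0 s) y * f y)" s] s
    by (simp add: integral_restrict_space)
qed

text \<open>The divergence theorem on a cone for the field \<open>w x * x\<close>, which is tangential to the lateral surface and
  has divergence \<open>N w + g \<bullet> x\<close>. In the proof the integral of \<open>w\<close> over the shell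
  \<open>s \<le> norm x < 1\<close> of the cone, divided by \<open>1 - s\<close>, is evaluated twice. As a difference of two
  dilated cones it tends to the right hand side. On the other hand \<open>w\<close> differs little from \<open>w (sgn x)\<close>
  on the shell, and the integral of a function that is constant along rays over the shell is \<open>1 - s ^ N\<close> times that
  over the cone, which gives the left hand side.\<close>
lemma sphere_integral_eq_cone_integral:
  fixes w :: "'a::euclidean_space \<Rightarrow> real"
  assumes D: "\<And>x. (w has_derivative (\<lambda>h. g x \<bullet> h)) (at x)" and g: "continuous_on UNIV g"
    and A[measurable]: "A \<in> sets borel" and AS: "A \<subseteq> sphere 0 1"
  shows "(\<integral>x. indicator A x * w x \<partial>sphere_measure) =
    (\<integral>x. real DIM('a) * w x + g x \<bullet> x \<partial>lborel_on (solid_cone A))"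
proof -
  define C where "C = solid_cone A"
  let ?M = "lborel_on C" and ?N = "real DIM('a)"
  have C: "C \<in> sets borel" "C \<subseteq> ball 0 1" unfolding C_def by (auto simp: solid_cone_def[of A])
  have cw: "continuous_on UNIV w"
    by (rule gradient_continuous[OF D])
  have [measurable]: "w \<in> borel_measurable borel" "g \<in> borel_measurable borel"
    by (auto intro!: borel_measurable_continuous_onI cw g)
  obtain K where K: "K \<ge> 0" "\<And>x. x \<in> cball 0 1 \<Longrightarrow> norm (g x) \<le> K" using bounded_on_cball[OF g] by blast
  obtain L where L: "L \<ge> 0" "\<And>x. x \<in> cball 0 1 \<Longrightarrow> \<bar>w x\<bar> \<le> L" using bounded_on_cball[OF cw] by (metis real_norm_def)
  note lip = lipschitz_on_cball[OF D K(2)]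
  have norm_C: "norm x < 1" "x \<noteq> 0" "norm (sgn x) = 1" if "x \<in> C" for x
    using that AS by (auto simp: C_def solid_cone_def norm_sgn)
  have sc: "s *\<^sub>R x \<in> cball 0 1" if "x \<in> C" "0 < s" "s < 1" for s x
    using mult_mono[of s 1 "norm x" 1] norm_C[OF that(1)] that by simp
  define s where "s n = 1 - 1 / (real n + 2)" for n
  have s: "0 < s n" "s n < 1" for n by (auto simp: s_def)
  have s1: "s \<longlonglongrightarrow> 1"
  proof -
    have "(\<lambda>n. 1 - 1 / real (Suc (Suc n))) \<longlonglongrightarrow> 1 - 0"
      by (intro tendsto_intros LIMSEQ_Suc[OF lim_1_over_n, THEN LIMSEQ_Suc])
    then show ?thesis by (simp add: s_def[abs_def] add.commute)
  qed
  define V where "V = measure ?M (space ?M)"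
  interpret finite_measure ?M by (rule finite_measure_lborel_on[OF C])
  have int: "integrable ?M f" if "f \<in> borel_measurable borel" "\<And>x. x \<in> C \<Longrightarrow> \<bar>f x\<bar> \<le> B" for f :: "'a \<Rightarrow> real" and B
    by (rule integrable_bounded_lborel_on[OF C that])
  have i_w: "integrable ?M w" by (rule int[of _ L]) (use C L in auto)
  have i_ws: "integrable ?M (\<lambda>x. w (s n *\<^sub>R x))" for n by (rule int[of _ L]) (use L sc[OF _ s] in auto)
  have i_W: "integrable ?M (\<lambda>x. w (sgn x))" by (rule int[of _ L]) (use L norm_C in auto)
  have i_g: "integrable ?M (\<lambda>x. g x \<bullet> x)"
  proof (rule int[of _ K])
    fix x assume "x \<in> C"
    then have x: "norm x < 1" by (rule norm_C)
    have "\<bar>g x \<bullet> x\<bar> \<le> norm (g x) * norm x" by (rule Cauchy_Schwarz_ineq2)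
    also have "\<dots> \<le> K * 1" using K x by (intro mult_mono) auto
    finally show "\<bar>g x \<bullet> x\<bar> \<le> K" by simp
  qed simp
  \<comment> \<open>\<open>a n\<close> is the quotient of \<open>1 - s ^ N\<close> and \<open>1 - s\<close>\<close>
  define a where "a n = (\<Sum>i<DIM('a). s n ^ i)" for n
  have a: "1 - s n ^ DIM('a) = (1 - s n) * a n" for n by (simp add: a_def one_diff_power_eq)
  have a_lim: "a \<longlonglongrightarrow> ?N"
  proof -
    have "a \<longlonglongrightarrow> (\<Sum>i<DIM('a). 1 ^ i)" unfolding a_def by (intro tendsto_intros s1)
    then show ?thesis by simp
  qed
  \<comment> \<open>the difference of the two evaluations of the shell integral, divided by \<open>1 - s\<close>\<close>
  define Q where "Q n = (\<integral>x. (w x - w (s n *\<^sub>R x)) / (1 - s n) \<partial>?M) + a n * (\<integral>x. w (s n *\<^sub>R x) \<partial>?M)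
      - a n * (\<integral>x. w (sgn x) \<partial>?M)" for n
  \<comment> \<open>on the shell \<open>w\<close> and \<open>w (sgn x)\<close> differ by at most \<open>K (1 - s)\<close>\<close>
  have Q_bound: "\<bar>Q n\<bar> \<le> K * (1 - s n) * a n * V" for n
  proof -
    let ?s = "s n" and ?S = "\<lambda>x. 1 - indicator (ball 0 (s n)) x :: real"
    have i_S: "integrable ?M ?S" by (rule int[of _ 1]) (auto split: split_indicator)
    have i_Sw: "integrable ?M (\<lambda>x. indicator (ball 0 ?s) x * w x)"
      by (rule int[of _ L]) (use L C in \<open>auto split: split_indicator\<close>)
    have i_SW: "integrable ?M (\<lambda>x. indicator (ball 0 ?s) x * w (sgn x))"
      by (rule int[of _ L]) (use L norm_C in \<open>auto split: split_indicator\<close>)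
    have i_Swd: "integrable ?M (\<lambda>x. ?S x * (w x - w (sgn x)))"
      using Bochner_Integration.integrable_diff[OF Bochner_Integration.integrable_diff[OF i_w i_W]
          Bochner_Integration.integrable_diff[OF i_Sw i_SW]]
      by (simp add: algebra_simps)
    have scale: "?s ^ DIM('a) * (\<integral>x. f (?s *\<^sub>R x) \<partial>?M) = (\<integral>y. indicator (ball 0 ?s) y * f y \<partial>?M)"
      if "f \<in> borel_measurable borel" for f
      unfolding C_def by (rule integral_on_cone_scaled[OF that A AS s])
    have "(1 - ?s) * Q n = (\<integral>x. w x - w (?s *\<^sub>R x) \<partial>?M) + (1 - ?s) * a n * (\<integral>x. w (?s *\<^sub>R x) \<partial>?M)
      - (1 - ?s) * a n * (\<integral>x. w (sgn x) \<partial>?M)"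
      using s[of n] by (simp add: Q_def right_diff_distrib distrib_left mult.assoc)
    also have "\<dots> = ((\<integral>x. w x \<partial>?M) - ?s ^ DIM('a) * (\<integral>x. w (?s *\<^sub>R x) \<partial>?M)) -
       ((\<integral>x. w (sgn x) \<partial>?M) - ?s ^ DIM('a) * (\<integral>x. w (sgn (?s *\<^sub>R x)) \<partial>?M))"
      unfolding a[symmetric] using s[of n] i_w i_ws by (simp add: algebra_simps sgn_scaleR)
    also have "\<dots> = (\<integral>x. ?S x * (w x - w (sgn x)) \<partial>?M)"
      unfolding scale[of w, simplified] scale[of "\<lambda>x. w (sgn x)", simplified]
      using i_w i_W i_Sw i_SW by (simp add: algebra_simps)
    finally have eq: "(1 - ?s) * Q n = (\<integral>x. ?S x * (w x - w (sgn x)) \<partial>?M)" .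
    have "\<bar>\<integral>x. ?S x * (w x - w (sgn x)) \<partial>?M\<bar> \<le> (\<integral>x. K * (1 - ?s) * ?S x \<partial>?M)"
    proof (rule integral_abs_bound_integral[OF i_Swd integrable_mult_right[OF i_S]])
      fix x assume "x \<in> space ?M"
      then have x: "x \<in> C" by (simp add: space_restrict_space)
      have "\<bar>w x - w (sgn x)\<bar> \<le> K * norm (x - sgn x)"
        using norm_C[OF x] by (intro lip) auto
      also have "x - sgn x = (1 - 1 / norm x) *\<^sub>R x"
        by (simp add: sgn_div_norm algebra_simps inverse_eq_divide)
      also have "norm \<dots> = 1 - norm x"
        using norm_C[OF x] by (simp add: abs_mult_pos field_simps)
      finally have *: "\<bar>w x - w (sgn x)\<bar> \<le> K * (1 - norm x)" .
      show "\<bar>?S x * (w x - w (sgn x))\<bar> \<le> K * (1 - ?s) * ?S x"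
      proof (cases "x \<in> ball 0 ?s")
        case False
        then have "K * (1 - norm x) \<le> K * (1 - ?s)" using K(1) by (intro mult_left_mono) auto
        then show ?thesis using * False by simp
      qed simp
    qed
    also have "\<dots> = K * (1 - ?s) * (V - ?s ^ DIM('a) * V)"
    proof -
      have "integrable ?M (indicator (ball 0 ?s) :: 'a \<Rightarrow> real)" by (rule int[of _ 1]) (auto split: split_indicator)
      then have "(\<integral>x. ?S x \<partial>?M) = V - (\<integral>x. indicator (ball 0 ?s) x * 1 \<partial>?M)"
        by (simp add: V_def)
      also have "\<dots> = V - ?s ^ DIM('a) * V" using scale[of "\<lambda>_. 1"] by (simp add: V_def)
      finally show ?thesis by simp
    qed
    also have "\<dots> = K * (1 - ?s) * ((1 - ?s ^ DIM('a)) * V)"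
      by (simp add: left_diff_distrib)
    also have "\<dots> = (1 - ?s) * (K * (1 - ?s) * a n * V)"
      unfolding a by (simp only: mult_ac)
    finally have "(1 - ?s) * \<bar>Q n\<bar> \<le> (1 - ?s) * (K * (1 - ?s) * a n * V)"
      using eq s[of n] by (metis abs_mult abs_of_pos diff_gt_0_iff_gt)
    then show ?thesis using s[of n] by (simp add: mult_le_cancel_left)
  qed
  have "(\<lambda>n. \<bar>Q n\<bar>) \<longlonglongrightarrow> 0"
  proof (rule tendsto_sandwich[OF _ _ tendsto_const])
    have "(\<lambda>n. K * (1 - s n) * a n * V) \<longlonglongrightarrow> K * (1 - 1) * ?N * V" by (intro tendsto_intros s1 a_lim)
    then show "(\<lambda>n. K * (1 - s n) * a n * V) \<longlonglongrightarrow> 0" by simp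
  qed (use Q_bound in auto)
  then have Q0: "Q \<longlonglongrightarrow> 0" by (rule tendsto_rabs_zero_cancel)
  have l1: "(\<lambda>n. \<integral>x. (w x - w (s n *\<^sub>R x)) / (1 - s n) \<partial>?M) \<longlonglongrightarrow> (\<integral>x. g x \<bullet> x \<partial>?M)"
  proof (rule integral_dominated_convergence[where w = "\<lambda>_. K"])
    show "AE x in ?M. (\<lambda>n. (w x - w (s n *\<^sub>R x)) / (1 - s n)) \<longlonglongrightarrow> g x \<bullet> x"
    proof (rule AE_I2)
      fix x
      have "((\<lambda>t. w (t *\<^sub>R x)) has_derivative (\<lambda>t. g x \<bullet> (t *\<^sub>R x))) (at 1)"
        by (rule has_derivative_compose[where g = w and f = "\<lambda>t. t *\<^sub>R x"]) 
          (use D[of x] in \<open>auto intro!: derivative_eq_intros\<close>)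
      then have "((\<lambda>t. w (t *\<^sub>R x)) has_real_derivative (g x \<bullet> x)) (at 1)"
        by (rule has_derivative_imp_has_field_derivative) simp
      then have "((\<lambda>t. (w (t *\<^sub>R x) - w x) / (t - 1)) \<longlongrightarrow> g x \<bullet> x) (at 1)"
        by (simp add: has_field_derivative_iff)
      moreover have "filterlim s (at 1) sequentially"
        using s1 s by (auto simp: filterlim_at less_imp_neq)
      ultimately have "(\<lambda>n. (w (s n *\<^sub>R x) - w x) / (s n - 1)) \<longlonglongrightarrow> g x \<bullet> x"
        by (rule filterlim_compose)
      moreover have "(w (s n *\<^sub>R x) - w x) / (s n - 1) = (w x - w (s n *\<^sub>R x)) / (1 - s n)" for n
        using minus_divide_divide[of "w x - w (s n *\<^sub>R x)" "1 - s n"] by simp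
      ultimately show "(\<lambda>n. (w x - w (s n *\<^sub>R x)) / (1 - s n)) \<longlonglongrightarrow> g x \<bullet> x" by simp
    qed
    show "AE x in ?M. norm ((w x - w (s n *\<^sub>R x)) / (1 - s n)) \<le> K" for n
    proof (rule AE_I2)
      fix x assume "x \<in> space ?M"
      then have x: "x \<in> C" by (simp add: space_restrict_space)
      have "\<bar>w x - w (s n *\<^sub>R x)\<bar> \<le> K * norm (x - s n *\<^sub>R x)"
        using norm_C[OF x] sc[OF x s] by (intro lip) auto
      also have "x - s n *\<^sub>R x = (1 - s n) *\<^sub>R x" by (simp add: algebra_simps)
      also have "K * norm \<dots> \<le> K * (1 - s n)" using s[of n] K(1) norm_C[OF x] by (intro mult_left_mono) (auto simp: mult_left_le)
      finally show "norm ((w x - w (s n *\<^sub>R x)) / (1 - s n)) \<le> K"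
        using s[of n] by (simp add: divide_le_eq)
    qed
  qed (use i_g i_w i_ws in auto)
  have l2: "(\<lambda>n. \<integral>x. w (s n *\<^sub>R x) \<partial>?M) \<longlonglongrightarrow> (\<integral>x. w x \<partial>?M)"
  proof (rule integral_dominated_convergence[where w = "\<lambda>_. L"])
    show "AE x in ?M. (\<lambda>n. w (s n *\<^sub>R x)) \<longlonglongrightarrow> w x"
    proof (rule AE_I2)
      fix x :: 'a
      have "(\<lambda>n. s n *\<^sub>R x) \<longlonglongrightarrow> 1 *\<^sub>R x" by (rule tendsto_scaleR[OF s1 tendsto_const])
      then show "(\<lambda>n. w (s n *\<^sub>R x)) \<longlonglongrightarrow> w x"
        using continuous_on_tendsto_compose[OF cw, of "\<lambda>n. s n *\<^sub>R x" x sequentially] by simp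
    qed
    show "AE x in ?M. norm (w (s n *\<^sub>R x)) \<le> L" for n
      using L sc[OF _ s] by (intro AE_I2) (auto simp: space_restrict_space)
  qed (use i_w i_ws in auto)
  have "Q \<longlonglongrightarrow> (\<integral>x. g x \<bullet> x \<partial>?M) + ?N * (\<integral>x. w x \<partial>?M) - ?N * (\<integral>x. w (sgn x) \<partial>?M)"
    unfolding Q_def by (intro tendsto_intros l1 l2 a_lim)
  with Q0 have "(\<integral>x. g x \<bullet> x \<partial>?M) + ?N * (\<integral>x. w x \<partial>?M) - ?N * (\<integral>x. w (sgn x) \<partial>?M) = 0"
    by (rule LIMSEQ_unique[symmetric])
  then have "?N * (\<integral>x. w (sgn x) \<partial>?M) = (\<integral>x. ?N * w x + g x \<bullet> x \<partial>?M)"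
    using i_w i_g by simp
  then show ?thesis
    by (simp add: integral_sphere_measure_indicator C_def)
qed

section \<open>The Poincare inequality in the unit ball\<close>

lemma gradient_line:
  fixes w :: "'a::euclidean_space \<Rightarrow> real"
  assumes D: "\<And>x. (w has_derivative (\<lambda>h. g x \<bullet> h)) (at x)"
  shows "((\<lambda>s. w (x + s *\<^sub>R (y - x))) has_real_derivative g (x + s *\<^sub>R (y - x)) \<bullet> (y - x)) (at s)"
proof -
  have "((\<lambda>s. w (x + s *\<^sub>R (y - x))) has_derivative (\<lambda>t. g (x + s *\<^sub>R (y - x)) \<bullet> (t *\<^sub>R (y - x)))) (at s)"
    by (rule has_derivative_compose[where g = w and f = "\<lambda>s. x + s *\<^sub>R (y - x)"])
      (use D in \<open>auto intro!: derivative_eq_intros\<close>)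
  then show ?thesis by (rule has_derivative_imp_has_field_derivative) simp
qed

text \<open>Integration of the gradient over the half of the segment from \<open>x\<close> to \<open>y\<close> that is nearer to \<open>y\<close>.
  On it the parameter \<open>s\<close> is at least \<open>1 / 2\<close>, so that the substitution
  \<open>y \<mapsto> x + s (y - x)\<close> costs a bounded factor only.\<close>
lemma diff_midpoint_le_integral:
  fixes w :: "'a::euclidean_space \<Rightarrow> real"
  assumes D: "\<And>x. (w has_derivative (\<lambda>h. g x \<bullet> h)) (at x)" and g: "continuous_on UNIV g"
    and x: "x \<in> ball 0 1" and y: "y \<in> ball 0 1"
  shows "ennreal \<bar>w y - w ((1/2) *\<^sub>R (x + y))\<bar> \<le>
    (\<integral>\<^sup>+s. 2 * (ennreal (norm (g (x + s *\<^sub>R (y - x)))) * indicator {1/2..1} s) \<partial>lborel)"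
proof -
  let ?f = "\<lambda>s. g (x + s *\<^sub>R (y - x)) \<bullet> (y - x)"
  have cont: "continuous_on UNIV ?f"
    by (intro continuous_intros continuous_on_compose2[OF g]) auto
  have "has_bochner_integral lborel (\<lambda>s. ?f s * indicator {1/2..1} s)
      (w (x + 1 *\<^sub>R (y - x)) - w (x + (1/2) *\<^sub>R (y - x)))"
    using cont by (intro has_bochner_integral_FTC_Icc_real gradient_line[OF D]) (auto simp: continuous_on_eq_continuous_at)
  moreover have "x + (1/2) *\<^sub>R (y - x) = (1/2) *\<^sub>R (x + y)"
    by (simp add: algebra_simps flip: scaleR_add_left)
  ultimately have "has_bochner_integral lborel (\<lambda>s. ?f s * indicator {1/2..1} s) (w y - w ((1/2) *\<^sub>R (x + y)))"
    by simp
  then have "ennreal (norm (w y - w ((1/2) *\<^sub>R (x + y)))) \<le> (\<integral>\<^sup>+s. norm (?f s * indicator {1/2..1} s) \<partial>lborel)"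
    by (rule has_bochner_integral_norm_bound)
  also have "\<dots> \<le> (\<integral>\<^sup>+s. 2 * (ennreal (norm (g (x + s *\<^sub>R (y - x)))) * indicator {1/2..1} s) \<partial>lborel)"
  proof (rule nn_integral_mono)
    fix s
    have "norm (y - x) \<le> 2" using x y norm_triangle_ineq4[of y x] by simp
    then have "\<bar>?f s\<bar> \<le> norm (g (x + s *\<^sub>R (y - x))) * 2"
      using Cauchy_Schwarz_ineq2[of "g (x + s *\<^sub>R (y - x))" "y - x"] mult_left_mono[of "norm (y - x)" 2 "norm (g (x + s *\<^sub>R (y - x)))"]
      by simp
    then have "ennreal \<bar>?f s\<bar> \<le> ennreal (2 * norm (g (x + s *\<^sub>R (y - x))))"
      by (intro ennreal_leI) simp
    then show "ennreal (norm (?f s * indicator {1/2..1} s)) \<le> 2 * (ennreal (norm (g (x + s *\<^sub>R (y - x)))) * indicator {1/2..1} s)"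
      by (auto simp: ennreal_mult split: split_indicator)
  qed
  finally show ?thesis by simp
qed

text \<open>For fixed \<open>x\<close> and \<open>s\<close> the points \<open>x + s (y - x)\<close> stay in the ball by convexity, and their
  density is at most \<open>2 ^ N\<close>.\<close>
lemma integral_diff_midpoint:
  fixes w :: "'a::euclidean_space \<Rightarrow> real"
  assumes D: "\<And>x. (w has_derivative (\<lambda>h. g x \<bullet> h)) (at x)" and g: "continuous_on UNIV g"
    and x: "x \<in> ball 0 1"
  shows "(\<integral>\<^sup>+y. ennreal \<bar>w y - w ((1/2) *\<^sub>R (x + y))\<bar> \<partial>lborel_on (ball 0 1)) \<le>
    ennreal (2 ^ DIM('a)) * (\<integral>\<^sup>+y. ennreal (norm (g y)) \<partial>lborel_on (ball 0 1))"
proof -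
  have [measurable]: "g \<in> borel_measurable borel" by (rule borel_measurable_continuous_onI[OF g])
  let ?B = "ball 0 1 :: 'a set" and ?G = "\<lambda>p. ennreal (norm (g p)) * indicator (ball 0 1) p"
  define I where "I = (\<integral>\<^sup>+p. ?G p \<partial>lborel)"
  have inner: "(\<integral>\<^sup>+y. ennreal (norm (g (x + s *\<^sub>R (y - x)))) * indicator ?B y \<partial>lborel) \<le> ennreal (2 ^ DIM('a)) * I"
    if s: "s \<in> {1/2..1}" for s
  proof -
    have "(\<integral>\<^sup>+y. ennreal (norm (g (x + s *\<^sub>R (y - x)))) * indicator ?B y \<partial>lborel) \<le>
        (\<integral>\<^sup>+y. ?G ((1 - s) *\<^sub>R x + s *\<^sub>R y) \<partial>lborel)"
    proof (rule nn_integral_mono)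
      fix y
      have eq: "x + s *\<^sub>R (y - x) = (1 - s) *\<^sub>R x + s *\<^sub>R y" by (simp add: algebra_simps)
      have "(1 - s) *\<^sub>R x + s *\<^sub>R y \<in> ?B" if "y \<in> ?B"
        by (rule convexD[OF convex_ball x that]) (use s in auto)
      then show "ennreal (norm (g (x + s *\<^sub>R (y - x)))) * indicator ?B y \<le> ?G ((1 - s) *\<^sub>R x + s *\<^sub>R y)"
        unfolding eq by (auto split: split_indicator)
    qed
    also have "\<dots> = 1 * \<dots>" by simp
    also have "\<dots> \<le> ennreal (2 ^ DIM('a) * s ^ DIM('a)) * (\<integral>\<^sup>+y. ?G ((1 - s) *\<^sub>R x + s *\<^sub>R y) \<partial>lborel)"
    proof (rule mult_right_mono)
      have "1 \<le> (2 * s) ^ DIM('a)" using s by (intro one_le_power) auto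
      then show "1 \<le> ennreal (2 ^ DIM('a) * s ^ DIM('a))" by (simp add: power_mult_distrib)
    qed simp
    also have "\<dots> = ennreal (2 ^ DIM('a)) * I"
      unfolding I_def using s by (subst nn_integral_lborel_affine[of ?G s "(1 - s) *\<^sub>R x"]) (auto simp: ennreal_mult mult.assoc)
    finally show ?thesis .
  qed
  have "(\<integral>\<^sup>+y. ennreal \<bar>w y - w ((1/2) *\<^sub>R (x + y))\<bar> \<partial>lborel_on ?B) =
      (\<integral>\<^sup>+y. ennreal \<bar>w y - w ((1/2) *\<^sub>R (x + y))\<bar> * indicator ?B y \<partial>lborel)"
    by (simp add: nn_integral_restrict_space)
  also have "\<dots> \<le> (\<integral>\<^sup>+y. (\<integral>\<^sup>+s. 2 * (ennreal (norm (g (x + s *\<^sub>R (y - x)))) * indicator {1/2..1} s) * indicator ?B y \<partial>lborel) \<partial>lborel)"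
    by (intro nn_integral_mono) (use diff_midpoint_le_integral[OF D g x] in \<open>auto split: split_indicator\<close>)
  also have "\<dots> = (\<integral>\<^sup>+s. (\<integral>\<^sup>+y. 2 * (ennreal (norm (g (x + s *\<^sub>R (y - x)))) * indicator {1/2..1} s) * indicator ?B y \<partial>lborel) \<partial>lborel)"
    by (rule lborel_pair.Fubini'[symmetric]) measurable
  also have "\<dots> \<le> (\<integral>\<^sup>+s. 2 * (ennreal (2 ^ DIM('a)) * I) * indicator {1/2..1::real} s \<partial>lborel)"
  proof (rule nn_integral_mono)
    fix s :: real
    have "(\<integral>\<^sup>+y. 2 * (ennreal (norm (g (x + s *\<^sub>R (y - x)))) * indicator {1/2..1} s) * indicator ?B y \<partial>lborel) =
      (2 * indicator {1/2..1} s) * (\<integral>\<^sup>+y. ennreal (norm (g (x + s *\<^sub>R (y - x)))) * indicator ?B y \<partial>lborel)"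
      by (subst nn_integral_cmult[symmetric]) (auto simp: mult_ac)
    also have "\<dots> \<le> 2 * (ennreal (2 ^ DIM('a)) * I) * indicator {1/2..1} s"
      using inner[of s] by (auto intro!: mult_left_mono split: split_indicator)
    finally show "(\<integral>\<^sup>+y. 2 * (ennreal (norm (g (x + s *\<^sub>R (y - x)))) * indicator {1/2..1} s) * indicator ?B y \<partial>lborel)
        \<le> 2 * (ennreal (2 ^ DIM('a)) * I) * indicator {1/2..1} s" .
  qed
  also have "\<dots> = 2 * (ennreal (2 ^ DIM('a)) * I) * ennreal (1/2)"
    by (simp add: nn_integral_cmult)
  also have "\<dots> = (2 * ennreal (1/2)) * (ennreal (2 ^ DIM('a)) * I)"
    by (simp add: mult_ac)
  also have "2 * ennreal (1/2) = 1"
    using ennreal_mult[of 2 "1/2"] by simp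
  finally show ?thesis by (simp add: I_def nn_integral_restrict_space)
qed

lemma integral_diff_midpoint_real:
  fixes w :: "'a::euclidean_space \<Rightarrow> real"
  assumes D: "\<And>x. (w has_derivative (\<lambda>h. g x \<bullet> h)) (at x)" and g: "continuous_on UNIV g"
    and x: "x \<in> ball 0 1"
  shows "(\<integral>y. \<bar>w y - w ((1/2) *\<^sub>R (x + y))\<bar> \<partial>lborel_on (ball 0 1)) \<le>
    2 ^ DIM('a) * (\<integral>y. norm (g y) \<partial>lborel_on (ball 0 1))"
proof -
  have cw: "continuous_on UNIV w"
    by (rule gradient_continuous[OF D])
  have [measurable]: "g \<in> borel_measurable borel" "w \<in> borel_measurable borel"
    by (auto intro!: borel_measurable_continuous_onI g cw)
  obtain K where K: "K \<ge> 0" "\<And>x. x \<in> cball 0 1 \<Longrightarrow> norm (g x) \<le> K" using bounded_on_cball[OF g] by blast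
  have i: "integrable (lborel_on (ball 0 1)) (\<lambda>y. norm (g y))"
    by (rule integrable_bounded_lborel_on[where K = K]) (use K in auto)
  have "(\<integral>y. \<bar>w y - w ((1/2) *\<^sub>R (x + y))\<bar> \<partial>lborel_on (ball 0 1)) =
     enn2real (\<integral>\<^sup>+y. ennreal \<bar>w y - w ((1/2) *\<^sub>R (x + y))\<bar> \<partial>lborel_on (ball 0 1))"
    by (rule integral_eq_nn_integral) (auto simp: measurable_restrict_space1)
  also have "\<dots> \<le> enn2real (ennreal (2 ^ DIM('a)) * (\<integral>\<^sup>+y. ennreal (norm (g y)) \<partial>lborel_on (ball 0 1)))"
    by (rule enn2real_mono[OF integral_diff_midpoint[OF D g x]])
      (use i in \<open>auto simp: nn_integral_eq_integral ennreal_mult_less_top\<close>)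
  also have "\<dots> = 2 ^ DIM('a) * (\<integral>y. norm (g y) \<partial>lborel_on (ball 0 1))"
    using i by (simp add: nn_integral_eq_integral enn2real_mult)
  finally show ?thesis .
qed

text \<open>The segment from \<open>x\<close> to \<open>y\<close> is cut at its midpoint, and each half is estimated with its far end
  point held fixed.\<close>
lemma poincare_inequality_ball:
  fixes w :: "'a::euclidean_space \<Rightarrow> real"
  assumes D: "\<And>x. (w has_derivative (\<lambda>h. g x \<bullet> h)) (at x)" and g: "continuous_on UNIV g"
  defines "B \<equiv> ball 0 1 :: 'a set"
  shows "(\<integral>x. (\<integral>y. \<bar>w x - w y\<bar> \<partial>lborel_on B) \<partial>lborel_on B) \<le>
    2 * 2 ^ DIM('a) * measure lborel B * (\<integral>y. norm (g y) \<partial>lborel_on B)"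
proof -
  have cw: "continuous_on UNIV w"
    by (rule gradient_continuous[OF D])
  have [measurable]: "g \<in> borel_measurable borel" "w \<in> borel_measurable borel"
    by (auto intro!: borel_measurable_continuous_onI g cw)
  obtain L where L: "L \<ge> 0" "\<And>x. x \<in> cball 0 1 \<Longrightarrow> \<bar>w x\<bar> \<le> L" using bounded_on_cball[OF cw] by (metis real_norm_def)
  have B: "B \<in> sets borel" "B \<subseteq> ball 0 1" by (auto simp: B_def)
  let ?M = "lborel_on B" 
  let ?I = "\<integral>y. norm (g y) \<partial>?M" and ?d = "\<lambda>x y. \<bar>w y - w ((1/2) *\<^sub>R (x + y))\<bar>"
  interpret M: finite_measure ?M by (rule finite_measure_lborel_on[OF B])
  interpret P: pair_sigma_finite ?M ?M ..
  interpret PP: finite_measure "?M \<Otimes>\<^sub>M ?M"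
    by (rule finite_measure_pair_measure) (rule M.finite_measure_axioms)+
  have mid: "(1/2) *\<^sub>R (x + y) \<in> cball 0 1" if "x \<in> B" "y \<in> B" for x y
  proof -
    have "(1/2) *\<^sub>R x + (1/2) *\<^sub>R y \<in> ball 0 1"
      by (rule convexD[OF convex_ball]) (use that in \<open>auto simp: B_def\<close>)
    then show ?thesis by (simp add: scaleR_add_right)
  qed
  have d_bound: "?d x y \<le> 2 * L" if "x \<in> B" "y \<in> B" for x y
    using L(2)[OF mid[OF that]] L(2)[of y] that(2) by (auto simp: B_def)
  have m2: "f \<in> borel_measurable (?M \<Otimes>\<^sub>M ?M)" if "f \<in> borel_measurable (borel \<Otimes>\<^sub>M borel)" for f :: "'a \<times> 'a \<Rightarrow> real"
  proof -
    have id: "(\<lambda>x. x) \<in> ?M \<rightarrow>\<^sub>M borel"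
      by (rule measurable_restrict_space1) (simp add: measurable_ident_sets)
    have "(\<lambda>p. (fst p, snd p)) \<in> (?M \<Otimes>\<^sub>M ?M) \<rightarrow>\<^sub>M (borel \<Otimes>\<^sub>M borel)"
      by (intro measurable_Pair measurable_compose[OF measurable_fst id] measurable_compose[OF measurable_snd id])
    then show ?thesis using measurable_compose[OF _ that] by simp
  qed
  have i2: "integrable (?M \<Otimes>\<^sub>M ?M) (\<lambda>(x, y). ?d x y)"
    by (rule PP.integrable_const_bound[where B = "2 * L"])
      (use d_bound in \<open>auto intro!: AE_I2 m2 simp: space_pair_measure space_restrict_space\<close>)
  have i2': "integrable (?M \<Otimes>\<^sub>M ?M) (\<lambda>(x, y). ?d y x)"
    by (rule PP.integrable_const_bound[where B = "2 * L"])
      (use d_bound in \<open>auto intro!: AE_I2 m2 simp: space_pair_measure space_restrict_space\<close>)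
  have i1: "integrable ?M (?d x)" if "x \<in> B" for x
    by (rule integrable_bounded_lborel_on[OF B, of _ "2 * L"]) (use d_bound that in auto)
  have i1': "integrable ?M (\<lambda>y. ?d y x)" if "x \<in> B" for x
    by (rule integrable_bounded_lborel_on[OF B, of _ "2 * L"]) (use d_bound that in auto)
  have iw: "integrable ?M (\<lambda>y. \<bar>w x - w y\<bar>)" if "x \<in> B" for x
  proof (rule integrable_bounded_lborel_on[OF B, of _ "2 * L"])
    fix y assume "y \<in> B"
    then show "\<bar>\<bar>w x - w y\<bar>\<bar> \<le> 2 * L" using L(2)[of x] L(2)[of y] that by (auto simp: B_def)
  qed simp
  have I: "(\<integral>x. (\<integral>y. ?d x y \<partial>?M) \<partial>?M) \<le> 2 ^ DIM('a) * measure lborel B * ?I"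
  proof -
    have "(\<integral>x. (\<integral>y. ?d x y \<partial>?M) \<partial>?M) \<le> (\<integral>x. 2 ^ DIM('a) * ?I \<partial>?M)"
    proof (rule integral_mono)
      show "integrable ?M (\<lambda>x. \<integral>y. ?d x y \<partial>?M)" using P.integrable_fst'[OF i2] by simp
      fix x assume "x \<in> space ?M"
      then show "(\<integral>y. ?d x y \<partial>?M) \<le> 2 ^ DIM('a) * ?I"
        unfolding B_def by (intro integral_diff_midpoint_real[OF D g]) (auto simp: space_restrict_space)
    qed simp
    then show ?thesis using B by (simp add: measure_restrict_space space_restrict_space mult_ac)
  qed
  have I': "(\<integral>x. (\<integral>y. ?d y x \<partial>?M) \<partial>?M) = (\<integral>x. (\<integral>y. ?d x y \<partial>?M) \<partial>?M)"
    using P.Fubini_integral[OF i2] by simp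
  have "(\<integral>x. (\<integral>y. \<bar>w x - w y\<bar> \<partial>?M) \<partial>?M) \<le> (\<integral>x. (\<integral>y. ?d x y \<partial>?M) + (\<integral>y. ?d y x \<partial>?M) \<partial>?M)"
  proof (rule integral_mono)
    have "integrable (?M \<Otimes>\<^sub>M ?M) (\<lambda>(x, y). \<bar>w x - w y\<bar>)"
    proof (rule PP.integrable_const_bound[where B = "2 * L"])
      have "\<bar>w x - w y\<bar> \<le> 2 * L" if "x \<in> B" "y \<in> B" for x y
        using L(2)[of x] L(2)[of y] that by (auto simp: B_def)
      then show "AE p in ?M \<Otimes>\<^sub>M ?M. norm (case p of (x, y) \<Rightarrow> \<bar>w x - w y\<bar>) \<le> 2 * L"
        by (intro AE_I2) (auto simp: space_pair_measure space_restrict_space)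
    qed (auto intro!: m2)
    then show "integrable ?M (\<lambda>x. \<integral>y. \<bar>w x - w y\<bar> \<partial>?M)" using P.integrable_fst' by fastforce
    show "integrable ?M (\<lambda>x. (\<integral>y. ?d x y \<partial>?M) + (\<integral>y. ?d y x \<partial>?M))"
      using P.integrable_fst'[OF i2] P.integrable_fst'[OF i2'] by simp
    fix x assume "x \<in> space ?M"
    then have x: "x \<in> B" by (simp add: space_restrict_space)
    have "(\<integral>y. \<bar>w x - w y\<bar> \<partial>?M) \<le> (\<integral>y. ?d x y + ?d y x \<partial>?M)"
      using i1[OF x] i1'[OF x] iw[OF x] by (intro integral_mono) (auto simp: add.commute)
    then show "(\<integral>y. \<bar>w x - w y\<bar> \<partial>?M) \<le> (\<integral>y. ?d x y \<partial>?M) + (\<integral>y. ?d y x \<partial>?M)"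
      using i1[OF x] i1'[OF x] by simp
  qed
  also have "\<dots> = (\<integral>x. (\<integral>y. ?d x y \<partial>?M) \<partial>?M) + (\<integral>x. (\<integral>y. ?d y x \<partial>?M) \<partial>?M)"
    using P.integrable_fst'[OF i2] P.integrable_fst'[OF i2'] by simp
  finally show ?thesis using I I' by simp
qed

section \<open>Averages over two parts of the sphere\<close>

lemma square_integrable_mult:
  fixes f g :: "'a \<Rightarrow> real"
  assumes "square_integrable M f" "square_integrable M g"
  shows "integrable M (\<lambda>x. f x * g x)"
proof (rule Bochner_Integration.integrable_bound)
  show "integrable M (\<lambda>x. (norm (f x))\<^sup>2 + (norm (g x))\<^sup>2)"
    using assms by (intro Bochner_Integration.integrable_add) (auto simp: square_integrable_def)
  show "(\<lambda>x. f x * g x) \<in> borel_measurable M"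
    using assms by (auto simp: square_integrable_def)
  show "AE x in M. norm (f x * g x) \<le> norm ((norm (f x))\<^sup>2 + (norm (g x))\<^sup>2)"
  proof (rule AE_I2)
    fix x
    have "0 \<le> (\<bar>f x\<bar> - \<bar>g x\<bar>)\<^sup>2" by simp
    then have "2 * (\<bar>f x\<bar> * \<bar>g x\<bar>) \<le> \<bar>f x\<bar>\<^sup>2 + \<bar>g x\<bar>\<^sup>2" by (simp add: power2_diff)
    moreover have "0 \<le> \<bar>f x\<bar> * \<bar>g x\<bar>" by simp
    ultimately have "\<bar>f x\<bar> * \<bar>g x\<bar> \<le> \<bar>f x\<bar>\<^sup>2 + \<bar>g x\<bar>\<^sup>2" by linarith
    then show "norm (f x * g x) \<le> norm ((norm (f x))\<^sup>2 + (norm (g x))\<^sup>2)"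
      by (simp add: abs_mult)
  qed
qed

lemma norm_diff_power2_le:
  fixes x y :: "'a::real_inner"
  shows "(norm (x - y))\<^sup>2 \<le> 2 * (norm x)\<^sup>2 + 2 * (norm y)\<^sup>2"
  proof -
  have "0 \<le> (norm (x + y))\<^sup>2" by simp
  then show ?thesis
    unfolding power2_norm_eq_inner by (simp add: inner_diff_left inner_diff_right inner_add_left inner_add_right inner_commute)
qed

lemma square_integrable_diff:
  fixes f g :: "'a \<Rightarrow> 'b::euclidean_space"
  assumes "square_integrable M f" "square_integrable M g"
  shows "square_integrable M (\<lambda>x. f x - g x)"
  unfolding square_integrable_def
proof
  have [measurable]: "f \<in> borel_measurable M" "g \<in> borel_measurable M"
    using assms by (auto simp: square_integrable_def)
  show "(\<lambda>x. f x - g x) \<in> borel_measurable M" by measurable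
  show "integrable M (\<lambda>x. (norm (f x - g x))\<^sup>2)"
  proof (rule Bochner_Integration.integrable_bound)
    show "integrable M (\<lambda>x. 2 * (norm (f x))\<^sup>2 + 2 * (norm (g x))\<^sup>2)"
      using assms by (intro Bochner_Integration.integrable_add integrable_mult_right) (auto simp: square_integrable_def)
    show "AE x in M. norm ((norm (f x - g x))\<^sup>2) \<le> norm (2 * (norm (f x))\<^sup>2 + 2 * (norm (g x))\<^sup>2)"
      using norm_diff_power2_le by (intro AE_I2) auto
  qed measurable
qed

text \<open>Cauchy-Schwarz inequality, from the fact that the integral of \<open>(f - c g)^2\<close> is nonnegative for all \<open>c\<close>.\<close>
lemma integral_mult_le_square_integrals:
  fixes f g :: "'a \<Rightarrow> real"
  assumes f: "square_integrable M f" and g: "square_integrable M g"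
  shows "(\<integral>x. f x * g x \<partial>M)\<^sup>2 \<le> (\<integral>x. (f x)\<^sup>2 \<partial>M) * (\<integral>x. (g x)\<^sup>2 \<partial>M)"
proof -
  let ?F = "\<integral>x. (f x)\<^sup>2 \<partial>M" and ?G = "\<integral>x. (g x)\<^sup>2 \<partial>M" and ?P = "\<integral>x. f x * g x \<partial>M"
  have i: "integrable M (\<lambda>x. (f x)\<^sup>2)" "integrable M (\<lambda>x. (g x)\<^sup>2)" "integrable M (\<lambda>x. f x * g x)"
    using f g square_integrable_mult[OF f g] by (auto simp: square_integrable_def)
  have q: "0 \<le> ?F - 2 * c * ?P + c\<^sup>2 * ?G" for c
  proof -
    have "0 \<le> (\<integral>x. (f x - c * g x)\<^sup>2 \<partial>M)" by simp
    also have "(\<lambda>x. (f x - c * g x)\<^sup>2) = (\<lambda>x. (f x)\<^sup>2 - 2 * c * (f x * g x) + c\<^sup>2 * (g x)\<^sup>2)"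
      by (simp add: power2_eq_square algebra_simps fun_eq_iff)
    finally show ?thesis using i by simp
  qed
  show ?thesis
  proof (cases "?G = 0")
    case True
    have "?P = 0"
    proof (rule ccontr)
      assume "?P \<noteq> 0"
      then show False using q[of "(?F + 1) / (2 * ?P)"] True by simp
    qed
    then show ?thesis using True by simp
  next
    case False
    moreover have "0 \<le> ?G" by simp
    ultimately have G: "?G > 0" by linarith
    have "0 \<le> ?F - 2 * (?P / ?G) * ?P + (?P / ?G)\<^sup>2 * ?G" by (rule q)
    also have "\<dots> = ?F - ?P\<^sup>2 / ?G" using G by (simp add: power2_eq_square field_simps)
    finally show ?thesis using G by (simp add: field_simps)
  qed
qed

lemma integral_lborel_on_mono:
  fixes f :: "'a::euclidean_space \<Rightarrow> real"
  assumes "C \<in> sets borel" "B \<in> sets borel" "C \<subseteq> B" "B \<subseteq> ball 0 1" "\<And>x. 0 \<le> f x" "integrable (lborel_on B) f"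
  shows "(\<integral>x. f x \<partial>lborel_on C) \<le> (\<integral>x. f x \<partial>lborel_on B)"
proof -
  have i: "integrable lborel (\<lambda>x. indicator B x *\<^sub>R f x)"
    using assms by (subst (asm) integrable_restrict_space) auto
  have "integrable lborel (\<lambda>x. indicator C x *\<^sub>R (indicator B x *\<^sub>R f x))"
    by (rule integrable_mult_indicator) (use assms i in auto)
  moreover have "(\<lambda>x. indicator C x *\<^sub>R (indicator B x *\<^sub>R f x)) = (\<lambda>x. indicator C x *\<^sub>R f x)"
    using assms(3) by (auto simp: fun_eq_iff split: split_indicator)
  ultimately have i': "integrable lborel (\<lambda>x. indicator C x *\<^sub>R f x)" by (simp only:)
  have "(\<integral>x. indicator C x *\<^sub>R f x \<partial>lborel) \<le> (\<integral>x. indicator B x *\<^sub>R f x \<partial>lborel)"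
    by (rule integral_mono[OF i' i]) (use assms(3,5) in \<open>auto split: split_indicator\<close>)
  then show ?thesis using assms by (simp add: integral_restrict_space)
qed

lemma integrable_continuous_lborel_on:
  fixes f :: "'a::euclidean_space \<Rightarrow> real"
  assumes "continuous_on UNIV f" "C \<in> sets borel" "C \<subseteq> ball 0 1"
  shows "integrable (lborel_on C) f"
proof -
  obtain K where K: "K \<ge> 0" "\<And>x. x \<in> cball 0 1 \<Longrightarrow> norm (f x) \<le> K" using bounded_on_cball[OF assms(1)] by blast
  show ?thesis
    by (rule integrable_bounded_lborel_on[where K = K])
      (use assms K in \<open>auto intro!: borel_measurable_continuous_onI\<close>)
qed

text \<open>Both surface integrals are turned into cone integrals. The terms with \<open>w\<close> itself combine to the double
  integral of \<open>w x - w y\<close> over the two cones, which the Poincare inequality bounds; the radial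
  derivative is at most the gradient.\<close>
lemma sphere_averages_close:
  fixes w :: "'a::euclidean_space \<Rightarrow> real"
  assumes D: "\<And>x. (w has_derivative (\<lambda>h. g x \<bullet> h)) (at x)" and g: "continuous_on UNIV g"
    and A: "A \<in> sets borel" "A \<subseteq> sphere 0 1" and A': "A' \<in> sets borel" "A' \<subseteq> sphere 0 1"
  shows "\<bar>measure sphere_measure A' * (\<integral>x. indicator A x * w x \<partial>sphere_measure) -
      measure sphere_measure A * (\<integral>x. indicator A' x * w x \<partial>sphere_measure)\<bar> \<le>
    4 * (real DIM('a))\<^sup>2 * 2 ^ DIM('a) * measure lborel (ball 0 1 :: 'a set) * (\<integral>x. norm (g x) \<partial>lborel_on (ball 0 1))"
proof -
  let ?N = "real DIM('a)" and ?B = "ball 0 1 :: 'a set"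
  let ?V = "measure lborel ?B" and ?I = "\<integral>x. norm (g x) \<partial>lborel_on ?B"
  define C C' where "C = solid_cone A" and "C' = solid_cone A'"
  have C: "C \<in> sets borel" "C \<subseteq> ?B" and C': "C' \<in> sets borel" "C' \<subseteq> ?B"
    using A A' by (auto simp: C_def C'_def solid_cone_def[of A] solid_cone_def[of A'])
  have cw: "continuous_on UNIV w"
    by (rule gradient_continuous[OF D])
  note icont = integrable_continuous_lborel_on
  have iw: "integrable (lborel_on E) w" and ig: "integrable (lborel_on E) (\<lambda>x. g x \<bullet> x)"
    and ing: "integrable (lborel_on E) (\<lambda>x. norm (g x))"
    if "E \<in> sets borel" "E \<subseteq> ?B" for E
    by (auto intro!: icont[OF _ that] continuous_intros cw g)
  have V: "0 \<le> measure lborel E" "measure lborel E \<le> ?V" if "E \<in> sets borel" "E \<subseteq> ?B" for E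
    using that emeasure_bounded_finite[of ?B] by (auto intro!: measure_mono_fmeasurable simp: fmeasurable_def)
  have radial: "\<bar>\<integral>x. g x \<bullet> x \<partial>lborel_on E\<bar> \<le> ?I" if E: "E \<in> sets borel" "E \<subseteq> ?B" for E
  proof -
    have "\<bar>\<integral>x. g x \<bullet> x \<partial>lborel_on E\<bar> \<le> (\<integral>x. norm (g x) \<partial>lborel_on E)"
    proof (rule integral_abs_bound_integral[OF ig[OF E] ing[OF E]])
      fix x assume "x \<in> space (lborel_on E)"
      then have "norm x \<le> 1" using E by (auto simp: space_restrict_space)
      then have "norm (g x) * norm x \<le> norm (g x) * 1" by (intro mult_left_mono) auto
      then show "\<bar>g x \<bullet> x\<bar> \<le> norm (g x)" using Cauchy_Schwarz_ineq2[of "g x" x] by simp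
    qed
    also have "\<dots> \<le> ?I" using E ing by (intro integral_lborel_on_mono) auto
    finally show ?thesis .
  qed
  have wave: "\<bar>measure lborel C' * (\<integral>x. w x \<partial>lborel_on C) - measure lborel C * (\<integral>x. w x \<partial>lborel_on C')\<bar> \<le>
      2 * 2 ^ DIM('a) * ?V * ?I"
  proof -
    have inner: "(\<integral>y. w x - w y \<partial>lborel_on C') = measure lborel C' * w x - (\<integral>y. w y \<partial>lborel_on C')" for x
    proof -
      interpret finite_measure "lborel_on C'" by (rule finite_measure_lborel_on[OF C'])
      show ?thesis using iw[OF C'] C' by (simp add: measure_restrict_space space_restrict_space)
    qed
    have outer: "(\<integral>x. (\<integral>y. w x - w y \<partial>lborel_on C') \<partial>lborel_on C) =
        measure lborel C' * (\<integral>x. w x \<partial>lborel_on C) - measure lborel C * (\<integral>x. w x \<partial>lborel_on C')"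
    proof -
      interpret finite_measure "lborel_on C" by (rule finite_measure_lborel_on[OF C])
      show ?thesis using iw[OF C] C unfolding inner by (simp add: measure_restrict_space space_restrict_space)
    qed
    let ?h = "\<lambda>x. \<integral>y. \<bar>w x - w y\<bar> \<partial>lborel_on ?B"
    have h_int: "integrable (lborel_on E) ?h" if E: "E \<in> sets borel" "E \<subseteq> ?B" for E
    proof -
      obtain L where L: "L \<ge> 0" "\<And>x. x \<in> cball 0 1 \<Longrightarrow> \<bar>w x\<bar> \<le> L" using bounded_on_cball[OF cw] by (metis real_norm_def)
      interpret B: finite_measure "lborel_on ?B" by (rule finite_measure_lborel_on) auto
      have [measurable]: "w \<in> borel_measurable borel" by (intro borel_measurable_continuous_onI cw)
      have "?h \<in> borel_measurable borel"
      proof -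
        have "(\<lambda>x. \<integral>y. indicator ?B y * \<bar>w x - w y\<bar> \<partial>lborel) \<in> borel_measurable borel"
          by (intro lborel.borel_measurable_lebesgue_integral) measurable
        then show ?thesis by (simp add: integral_restrict_space)
      qed
      moreover have "\<bar>?h x\<bar> \<le> 2 * L * measure (lborel_on ?B) (space (lborel_on ?B))" if "x \<in> E" for x
      proof -
        have "?h x \<le> (\<integral>y. 2 * L \<partial>lborel_on ?B)"
        proof (rule integral_mono)
          show "integrable (lborel_on ?B) (\<lambda>y. \<bar>w x - w y\<bar>)"
            by (auto intro!: icont continuous_intros cw)
          fix y assume "y \<in> space (lborel_on ?B)"
          then have "y \<in> cball 0 1" "x \<in> cball 0 1" using that E by (auto simp: space_restrict_space)
          then show "\<bar>w x - w y\<bar> \<le> 2 * L" using L(2)[of x] L(2)[of y] by linarith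
        qed simp
        then show ?thesis by (simp add: mult_ac)
      qed
      ultimately show ?thesis by (intro integrable_bounded_lborel_on[OF E])
    qed
    have "\<bar>\<integral>x. (\<integral>y. w x - w y \<partial>lborel_on C') \<partial>lborel_on C\<bar> \<le> (\<integral>x. ?h x \<partial>lborel_on C)"
    proof (rule integral_abs_bound_integral[OF _ h_int[OF C]])
      show "integrable (lborel_on C) (\<lambda>x. \<integral>y. w x - w y \<partial>lborel_on C')"
        unfolding inner by (auto intro!: icont[OF _ C] continuous_intros cw)
      fix x
      have "\<bar>\<integral>y. w x - w y \<partial>lborel_on C'\<bar> \<le> (\<integral>y. \<bar>w x - w y\<bar> \<partial>lborel_on C')"
        by (rule integral_abs_bound)
      also have "\<dots> \<le> ?h x"
        using C' by (intro integral_lborel_on_mono) (auto intro!: icont continuous_intros cw)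
      finally show "\<bar>\<integral>y. w x - w y \<partial>lborel_on C'\<bar> \<le> ?h x" .
    qed
    also have "\<dots> \<le> (\<integral>x. ?h x \<partial>lborel_on ?B)"
      using C h_int[of ?B] by (intro integral_lborel_on_mono) auto
    also have "\<dots> \<le> 2 * 2 ^ DIM('a) * ?V * ?I" by (rule poincare_inequality_ball[OF D g])
    finally show ?thesis unfolding outer .
  qed
  have split: "(\<integral>x. indicator S x * w x \<partial>sphere_measure) =
      ?N * (\<integral>x. w x \<partial>lborel_on (solid_cone S)) + (\<integral>x. g x \<bullet> x \<partial>lborel_on (solid_cone S))"
    if "S \<in> sets borel" "S \<subseteq> sphere 0 1" "solid_cone S \<subseteq> ?B" for S
    using sphere_integral_eq_cone_integral[OF D g that(1,2)] iw[of "solid_cone S"] ig[of "solid_cone S"] that by simp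
  let ?X = "measure lborel C' * (\<integral>x. w x \<partial>lborel_on C) - measure lborel C * (\<integral>x. w x \<partial>lborel_on C')"
  let ?R = "\<integral>x. g x \<bullet> x \<partial>lborel_on C" and ?R' = "\<integral>x. g x \<bullet> x \<partial>lborel_on C'"
  have "measure sphere_measure A' * (\<integral>x. indicator A x * w x \<partial>sphere_measure) -
      measure sphere_measure A * (\<integral>x. indicator A' x * w x \<partial>sphere_measure) =
      ?N\<^sup>2 * ?X + (?N * measure lborel C' * ?R - ?N * measure lborel C * ?R')"
    using split[OF A] split[OF A'] C(2) C'(2) A A'
    by (simp add: measure_sphere_measure C_def[symmetric] C'_def[symmetric] power2_eq_square algebra_simps)
  then have "\<bar>measure sphere_measure A' * (\<integral>x. indicator A x * w x \<partial>sphere_measure) -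
      measure sphere_measure A * (\<integral>x. indicator A' x * w x \<partial>sphere_measure)\<bar> =
      \<bar>?N\<^sup>2 * ?X + (?N * measure lborel C' * ?R - ?N * measure lborel C * ?R')\<bar>"
    by (rule arg_cong)
  also have "\<dots> \<le> \<bar>?N\<^sup>2 * ?X\<bar> + (\<bar>?N * measure lborel C' * ?R\<bar> + \<bar>?N * measure lborel C * ?R'\<bar>)"
    by (rule order_trans[OF abs_triangle_ineq add_left_mono[OF abs_triangle_ineq4]])
  also have "\<dots> \<le> ?N\<^sup>2 * (2 * 2 ^ DIM('a) * ?V * ?I) +
      (?N\<^sup>2 * (2 ^ DIM('a) * ?V * ?I) + ?N\<^sup>2 * (2 ^ DIM('a) * ?V * ?I))"
  proof (intro add_mono)
    show "\<bar>?N\<^sup>2 * ?X\<bar> \<le> ?N\<^sup>2 * (2 * 2 ^ DIM('a) * ?V * ?I)"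
      unfolding abs_mult[of "?N\<^sup>2"] abs_power2 by (rule mult_left_mono[OF wave]) simp
    have "1 * 1 \<le> ?N * 2 ^ DIM('a)" by (intro mult_mono) auto
    then have *: "(?N * ?V * ?I) * 1 \<le> (?N * ?V * ?I) * (?N * 2 ^ DIM('a))"
      by (intro mult_left_mono mult_nonneg_nonneg) auto
    have bound: "\<bar>?N * v * r\<bar> \<le> ?N\<^sup>2 * (2 ^ DIM('a) * ?V * ?I)"
      if "0 \<le> v" "v \<le> ?V" "\<bar>r\<bar> \<le> ?I" for v r
    proof -
      have "\<bar>?N * v * r\<bar> = ?N * v * \<bar>r\<bar>" using that by (simp add: abs_mult)
      also have "\<dots> \<le> ?N * ?V * ?I" using that by (intro mult_mono) auto
      also have "\<dots> \<le> ?N\<^sup>2 * (2 ^ DIM('a) * ?V * ?I)"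
        using * by (simp only: power2_eq_square mult_ac mult_1_right)
      finally show ?thesis .
    qed
    show "\<bar>?N * measure lborel C' * ?R\<bar> \<le> ?N\<^sup>2 * (2 ^ DIM('a) * ?V * ?I)"
      by (rule bound[OF V[OF C'] radial[OF C]])
    show "\<bar>?N * measure lborel C * ?R'\<bar> \<le> ?N\<^sup>2 * (2 ^ DIM('a) * ?V * ?I)"
      by (rule bound[OF V[OF C] radial[OF C']])
  qed
  also have "\<dots> = 4 * ?N\<^sup>2 * 2 ^ DIM('a) * ?V * ?I"
    by simp
  finally show ?thesis .
qed

section \<open>Traces\<close>

lemma smooth_on_UNIV_grad:
  assumes "smooth_on w UNIV"
  shows "(w has_derivative (\<lambda>h. grad w x \<bullet> h)) (at x)" "continuous_on UNIV (grad w)"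
proof -
  have "Ck_on (Suc 0) w UNIV" using assms unfolding smooth_on_def by blast
  then have d: "\<And>x. w differentiable at x" and c: "\<And>b. b \<in> Basis \<Longrightarrow> continuous_on UNIV (partial_deriv b w)" by auto
  show "continuous_on UNIV (grad w)" unfolding grad_def[abs_def]
    by (intro continuous_intros c)
  let ?F = "frechet_derivative w (at x)"
  have F: "(w has_derivative ?F) (at x)" using d frechet_derivative_works by blast
  then have lin: "linear ?F" by (rule has_derivative_linear)
  have "?F h = grad w x \<bullet> h" for h
  proof -
    have "?F h = ?F (\<Sum>b\<in>Basis. (h \<bullet> b) *\<^sub>R b)" by (simp add: euclidean_representation)
    also have "\<dots> = (\<Sum>b\<in>Basis. (h \<bullet> b) * ?F b)" 
      by (simp add: linear_sum[OF lin] linear_scale[OF lin])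
    also have "\<dots> = grad w x \<bullet> h"
      by (simp add: grad_def partial_deriv_def inner_sum_left) (simp add: inner_commute mult.commute)
    finally show ?thesis .
  qed
  then show "(w has_derivative (\<lambda>h. grad w x \<bullet> h)) (at x)" using F by (metis has_derivative_eq_rhs ext)
qed

abbreviation lebesgue_ball :: "'a::euclidean_space measure" where
  "lebesgue_ball \<equiv> lebesgue_on (ball 0 1)"

lemma integral_lebesgue_ball:
  fixes f :: "'a::euclidean_space \<Rightarrow> real"
  assumes [measurable]: "f \<in> borel_measurable borel"
  shows "(\<integral>x. f x \<partial>lebesgue_ball) = (\<integral>x. f x \<partial>lborel_on (ball 0 1))"
  by (simp add: integral_restrict_space integral_completion)

lemma square_integrable_lebesgue_ball:
  fixes f :: "'a::euclidean_space \<Rightarrow> 'b::euclidean_space"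
  assumes "continuous_on UNIV f"
  shows "square_integrable lebesgue_ball f"
  unfolding square_integrable_def
proof
  have m: "f \<in> borel_measurable borel" by (rule borel_measurable_continuous_onI[OF assms])
  then have "f \<in> borel_measurable lebesgue" by (simp add: measurable_completion)
  then show fm: "f \<in> borel_measurable lebesgue_ball" by (rule measurable_restrict_space1)
  obtain K where K: "K \<ge> 0" "\<And>x. x \<in> cball 0 1 \<Longrightarrow> norm (f x) \<le> K" using bounded_on_cball[OF assms] by blast
  interpret finite_measure "lebesgue_ball :: 'a measure"
    by (rule finite_measure_lebesgue_on) simp
  show "integrable lebesgue_ball (\<lambda>x. (norm (f x))\<^sup>2)"
    by (rule integrable_const_bound[where B = "K\<^sup>2"])
      (use K fm in \<open>auto simp: space_restrict_space intro!: power_mono AE_I2\<close>)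
qed

lemma square_integrable_sphere:
  fixes f :: "'a::euclidean_space \<Rightarrow> real"
  assumes "continuous_on UNIV f"
  shows "square_integrable sphere_measure f"
  unfolding square_integrable_def
proof
  have m[measurable]: "f \<in> borel_measurable borel" by (rule borel_measurable_continuous_onI[OF assms])
  show "f \<in> borel_measurable sphere_measure" by measurable
  obtain K where K: "K \<ge> 0" "\<And>x. x \<in> cball 0 1 \<Longrightarrow> norm (f x) \<le> K" using bounded_on_cball[OF assms] by blast
  interpret finite_measure "sphere_measure :: 'a measure" by (rule finite_measure_sphere_measure)
  show "integrable sphere_measure (\<lambda>x. (norm (f x))\<^sup>2)"
  proof (rule integrable_const_bound[where B = "K\<^sup>2"])
    have "AE x in (sphere_measure :: 'a measure). norm x \<le> 1"
      unfolding sphere_measure_def by (subst AE_distr_iff) (auto simp: norm_sgn)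
    then show "AE x in sphere_measure. norm ((norm (f x))\<^sup>2) \<le> K\<^sup>2"
      by eventually_elim (use K in \<open>simp add: abs_le_square_iff[symmetric]\<close>)
  qed measurable
qed

lemma square_integrable_indicator:
  assumes "finite_measure M" "A \<in> sets M"
  shows "square_integrable M (indicator A :: _ \<Rightarrow> real)"
proof -
  interpret finite_measure M by fact
  show ?thesis unfolding square_integrable_def
    using assms by (auto intro!: integrable_const_bound[where B = 1] AE_I2 split: split_indicator)
qed

lemma sphere_averages_close_L2:
  fixes w :: "'a::euclidean_space \<Rightarrow> real"
  assumes D: "\<And>x. (w has_derivative (\<lambda>h. g x \<bullet> h)) (at x)" and g: "continuous_on UNIV g"
    and A: "A \<in> sets borel" "A \<subseteq> sphere 0 1" and A': "A' \<in> sets borel" "A' \<subseteq> sphere 0 1"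
  shows "(measure sphere_measure A' * (\<integral>x. indicator A x * w x \<partial>sphere_measure) -
      measure sphere_measure A * (\<integral>x. indicator A' x * w x \<partial>sphere_measure))\<^sup>2 \<le>
    (4 * (real DIM('a))\<^sup>2 * 2 ^ DIM('a))\<^sup>2 * measure lborel (ball 0 1 :: 'a set) ^ 3 *
    (\<integral>x. (norm (g x))\<^sup>2 \<partial>lebesgue_ball)"
proof -
  let ?V = "measure lborel (ball 0 1 :: 'a set)" and ?K = "4 * (real DIM('a))\<^sup>2 * 2 ^ DIM('a)"
  let ?I = "\<integral>x. norm (g x) \<partial>lborel_on (ball 0 1)"
  have [measurable]: "g \<in> borel_measurable borel" by (rule borel_measurable_continuous_onI[OF g])
  have "(\<integral>x. 1 * norm (g x) \<partial>lebesgue_ball)\<^sup>2 \<le>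
      (\<integral>x. 1\<^sup>2 \<partial>(lebesgue_ball :: 'a measure)) * (\<integral>x. (norm (g x))\<^sup>2 \<partial>lebesgue_ball)"
    by (intro integral_mult_le_square_integrals square_integrable_lebesgue_ball continuous_intros g)
  also have "(\<integral>x. 1\<^sup>2 \<partial>(lebesgue_ball :: 'a measure)) = ?V"
    by (simp add: measure_restrict_space space_restrict_space)
  finally have I: "?I\<^sup>2 \<le> ?V * (\<integral>x. (norm (g x))\<^sup>2 \<partial>lebesgue_ball)"
    by (simp add: integral_lebesgue_ball)
  have "(measure sphere_measure A' * (\<integral>x. indicator A x * w x \<partial>sphere_measure) -
      measure sphere_measure A * (\<integral>x. indicator A' x * w x \<partial>sphere_measure))\<^sup>2 \<le> (?K * ?V * ?I)\<^sup>2"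
    using sphere_averages_close[OF assms] by (intro abs_le_square_iff[THEN iffD1]) simp
  also have "\<dots> = ?K\<^sup>2 * ?V\<^sup>2 * ?I\<^sup>2" by (simp only: power_mult_distrib)
  also have "\<dots> \<le> ?K\<^sup>2 * ?V\<^sup>2 * (?V * (\<integral>x. (norm (g x))\<^sup>2 \<partial>lebesgue_ball))"
    using I by (rule mult_left_mono) simp
  also have "\<dots> = ?K\<^sup>2 * ?V ^ 3 * (\<integral>x. (norm (g x))\<^sup>2 \<partial>lebesgue_ball)"
    by (simp only: power2_eq_square power3_eq_cube mult_ac)
  finally show ?thesis .
qed

text \<open>What the definition of the trace of a Sobolev function says about its gradient and its trace only, in terms of
  approximation by functions with continuous gradient. In this form it is visibly preserved by differences.\<close>
definition gradient_with_trace :: "('a::euclidean_space \<Rightarrow> 'a) \<Rightarrow> ('a \<Rightarrow> real) \<Rightarrow> bool" where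
  "gradient_with_trace G t \<longleftrightarrow>
     square_integrable lebesgue_ball G \<and> square_integrable sphere_measure t \<and>
     (\<exists>w g. (\<forall>k x. (w k has_derivative (\<lambda>h. g k x \<bullet> h)) (at x)) \<and> (\<forall>k. continuous_on UNIV (g k)) \<and>
        (\<lambda>k::nat. LINT x|lebesgue_ball. (norm (g k x - G x))\<^sup>2) \<longlonglongrightarrow> 0 \<and>
        (\<lambda>k. LINT x|sphere_measure. (w k x - t x)\<^sup>2) \<longlonglongrightarrow> 0)"

lemma has_trace_imp_gradient_with_trace:
  assumes "has_trace u G t" shows "gradient_with_trace G t"
proof -
  from assms obtain w where w: "\<And>k. smooth_on (w k) UNIV"
    "(\<lambda>k::nat. LINT x|lebesgue_ball. (norm (grad (w k) x - G x))\<^sup>2) \<longlonglongrightarrow> 0"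
    "(\<lambda>k. LINT x|sphere_measure. (w k x - t x)\<^sup>2) \<longlonglongrightarrow> 0"
    unfolding has_trace_def by blast
  moreover have "square_integrable lebesgue_ball G" "square_integrable sphere_measure t"
    using assms unfolding has_trace_def H1_on_def by blast+
  ultimately show ?thesis
    unfolding gradient_with_trace_def using smooth_on_UNIV_grad[OF w(1)]
    by (intro conjI exI[of _ w] exI[of _ "\<lambda>k. grad (w k)"] allI) auto
qed

lemma square_integral_diff_tendsto_0:
  fixes f g :: "nat \<Rightarrow> 'a \<Rightarrow> 'b::euclidean_space"
  assumes "\<And>k. square_integrable M (f k)" "\<And>k. square_integrable M (g k)"
    "(\<lambda>k. LINT x|M. (norm (f k x))\<^sup>2) \<longlonglongrightarrow> 0" "(\<lambda>k. LINT x|M. (norm (g k x))\<^sup>2) \<longlonglongrightarrow> 0"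
  shows "(\<lambda>k. LINT x|M. (norm (f k x - g k x))\<^sup>2) \<longlonglongrightarrow> 0"
proof (rule tendsto_sandwich[OF _ _ tendsto_const])
  have "(\<lambda>k. 2 * (LINT x|M. (norm (f k x))\<^sup>2) + 2 * (LINT x|M. (norm (g k x))\<^sup>2)) \<longlonglongrightarrow> 2 * 0 + 2 * 0"
    by (intro tendsto_intros assms)
  then show "(\<lambda>k. 2 * (LINT x|M. (norm (f k x))\<^sup>2) + 2 * (LINT x|M. (norm (g k x))\<^sup>2)) \<longlonglongrightarrow> 0" by simp
  have i: "integrable M (\<lambda>x. (norm (f k x))\<^sup>2)" "integrable M (\<lambda>x. (norm (g k x))\<^sup>2)"
    "integrable M (\<lambda>x. (norm (f k x - g k x))\<^sup>2)" for k
    using assms(1)[of k] assms(2)[of k] square_integrable_diff[OF assms(1,2)] by (auto simp: square_integrable_def)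
  have "(LINT x|M. (norm (f k x - g k x))\<^sup>2) \<le> (LINT x|M. 2 * (norm (f k x))\<^sup>2 + 2 * (norm (g k x))\<^sup>2)" for k
    by (intro integral_mono i Bochner_Integration.integrable_add integrable_mult_right norm_diff_power2_le)
  then show "\<forall>\<^sub>F k in sequentially. (LINT x|M. (norm (f k x - g k x))\<^sup>2) \<le>
      2 * (LINT x|M. (norm (f k x))\<^sup>2) + 2 * (LINT x|M. (norm (g k x))\<^sup>2)"
    using i by (intro always_eventually allI) simp
qed simp

lemma gradient_with_trace_diff:
  assumes "gradient_with_trace G t" "gradient_with_trace G' t'"
  shows "gradient_with_trace (\<lambda>x. G x - G' x) (\<lambda>x. t x - t' x)"
proof -
  from assms obtain w g w' g' where w: "\<And>k x. (w k has_derivative (\<lambda>h. g k x \<bullet> h)) (at x)" "\<And>k. continuous_on UNIV (g k)"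
        "(\<lambda>k::nat. LINT x|lebesgue_ball. (norm (g k x - G x))\<^sup>2) \<longlonglongrightarrow> 0"
        "(\<lambda>k. LINT x|sphere_measure. (norm (w k x - t x))\<^sup>2) \<longlonglongrightarrow> 0"
    and w': "\<And>k x. (w' k has_derivative (\<lambda>h. g' k x \<bullet> h)) (at x)" "\<And>k. continuous_on UNIV (g' k)"
        "(\<lambda>k::nat. LINT x|lebesgue_ball. (norm (g' k x - G' x))\<^sup>2) \<longlonglongrightarrow> 0"
        "(\<lambda>k. LINT x|sphere_measure. (norm (w' k x - t' x))\<^sup>2) \<longlonglongrightarrow> 0"
    unfolding gradient_with_trace_def by (auto simp: real_norm_def)
  have sq: "square_integrable lebesgue_ball G" "square_integrable lebesgue_ball G'"
    "square_integrable sphere_measure t" "square_integrable sphere_measure t'"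
    using assms by (auto simp: gradient_with_trace_def)
  have c: "continuous_on UNIV (w k)" "continuous_on UNIV (w' k)" for k
    by (rule gradient_continuous[OF w(1)], rule gradient_continuous[OF w'(1)])
  have swap: "(a - b) - (c - d) = (a - c) - (b - d)" for a b c d :: "'c::ab_group_add"
    by simp
  have "(\<lambda>k. LINT x|lebesgue_ball. (norm ((g k x - g' k x) - (G x - G' x)))\<^sup>2) \<longlonglongrightarrow> 0"
    unfolding swap[of "g _ _"] by (intro square_integral_diff_tendsto_0 w w' square_integrable_diff sq square_integrable_lebesgue_ball)
  moreover have "(\<lambda>k. LINT x|sphere_measure. (norm ((w k x - w' k x) - (t x - t' x)))\<^sup>2) \<longlonglongrightarrow> 0"
    unfolding swap[of "w _ _"] by (intro square_integral_diff_tendsto_0 w w' square_integrable_diff sq square_integrable_sphere c)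
  moreover have "((\<lambda>x. w k x - w' k x) has_derivative (\<lambda>h. (g k x - g' k x) \<bullet> h)) (at x)" for k x
    using has_derivative_diff[OF w(1) w'(1)] by (simp add: inner_diff_left)
  moreover have "continuous_on UNIV (\<lambda>x. g k x - g' k x)" for k
    by (intro continuous_intros w w')
  ultimately show ?thesis
    unfolding gradient_with_trace_def using square_integrable_diff[OF sq(1,2)] square_integrable_diff[OF sq(3,4)]
    by (intro conjI exI[of _ "\<lambda>k x. w k x - w' k x"] exI[of _ "\<lambda>k x. g k x - g' k x"])
      (simp_all add: real_norm_def)
qed

text \<open>The estimate for smooth functions passes to the limit; the factor 2 comes from comparing the squared norm of the
  approximating gradients with that of \<open>G\<close>.\<close>
lemma gradient_with_trace_averages:
  fixes G :: "'a::euclidean_space \<Rightarrow> 'a"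
  assumes Gt: "gradient_with_trace G t"
    and A: "A \<in> sets borel" "A \<subseteq> sphere 0 1" and A': "A' \<in> sets borel" "A' \<subseteq> sphere 0 1"
  defines "K \<equiv> (4 * (real DIM('a))\<^sup>2 * 2 ^ DIM('a))\<^sup>2 * measure lborel (ball 0 1 :: 'a set) ^ 3"
  shows "(measure sphere_measure A' * (\<integral>x. indicator A x * t x \<partial>sphere_measure) -
      measure sphere_measure A * (\<integral>x. indicator A' x * t x \<partial>sphere_measure))\<^sup>2 \<le>
      2 * K * (\<integral>x. (norm (G x))\<^sup>2 \<partial>lebesgue_ball)"
proof -
  from Gt obtain w g where w: "\<And>k x. (w k has_derivative (\<lambda>h. g k x \<bullet> h)) (at x)" "\<And>k. continuous_on UNIV (g k)"
        "(\<lambda>k::nat. LINT x|lebesgue_ball. (norm (g k x - G x))\<^sup>2) \<longlonglongrightarrow> 0"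
        "(\<lambda>k. LINT x|sphere_measure. (w k x - t x)\<^sup>2) \<longlonglongrightarrow> 0"
    unfolding gradient_with_trace_def by auto
  have sq: "square_integrable lebesgue_ball G" "square_integrable sphere_measure t"
    using Gt by (auto simp: gradient_with_trace_def)
  have c: "continuous_on UNIV (w k)" for k
    by (rule gradient_continuous[OF w(1)])
  have wsq: "square_integrable sphere_measure (\<lambda>x. w k x - t x)" for k
    by (intro square_integrable_diff sq square_integrable_sphere c)
  have ave: "(\<lambda>k. \<integral>x. indicator S x * w k x \<partial>sphere_measure) \<longlonglongrightarrow> (\<integral>x. indicator S x * t x \<partial>sphere_measure)"
    if S: "S \<in> sets borel" for S
  proof -
    have iS: "square_integrable sphere_measure (indicator S :: 'a \<Rightarrow> real)"
      using S by (intro square_integrable_indicator finite_measure_sphere_measure) simp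
    let ?d = "\<lambda>k. \<integral>x. indicator S x * (w k x - t x) \<partial>sphere_measure"
    have "(\<lambda>k. (?d k)\<^sup>2) \<longlonglongrightarrow> 0"
    proof (rule tendsto_sandwich[OF _ _ tendsto_const])
      show "(\<lambda>k. (\<integral>x. (indicator S x)\<^sup>2 \<partial>sphere_measure) * (\<integral>x. (w k x - t x)\<^sup>2 \<partial>sphere_measure)) \<longlonglongrightarrow> 0"
        using tendsto_mult_right_zero[OF w(4)] by blast
      show "\<forall>\<^sub>F k in sequentially. (?d k)\<^sup>2 \<le> (\<integral>x. (indicator S x)\<^sup>2 \<partial>sphere_measure) * (\<integral>x. (w k x - t x)\<^sup>2 \<partial>sphere_measure)"
        by (intro always_eventually allI integral_mult_le_square_integrals iS wsq)
    qed simp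
    then have "(\<lambda>k. sqrt ((?d k)\<^sup>2)) \<longlonglongrightarrow> sqrt 0" by (rule tendsto_real_sqrt)
    then have "?d \<longlonglongrightarrow> 0" by (simp add: tendsto_rabs_zero_iff)
    moreover have "?d k = (\<integral>x. indicator S x * w k x \<partial>sphere_measure) - (\<integral>x. indicator S x * t x \<partial>sphere_measure)" for k
      using square_integrable_mult[OF iS square_integrable_sphere[OF c]] square_integrable_mult[OF iS sq(2)]
      by (simp add: right_diff_distrib)
    ultimately have "(\<lambda>k. (\<integral>x. indicator S x * w k x \<partial>sphere_measure) -
        (\<integral>x. indicator S x * t x \<partial>sphere_measure)) \<longlonglongrightarrow> 0"
      by (simp only:)
    then show ?thesis by (rule LIM_zero_cancel)
  qed
  let ?X = "\<lambda>t. (measure sphere_measure A' * (\<integral>x. indicator A x * t x \<partial>sphere_measure) -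
      measure sphere_measure A * (\<integral>x. indicator A' x * t x \<partial>sphere_measure))\<^sup>2"
  have "K \<ge> 0" by (simp add: K_def)
  have bound: "?X (w k) \<le> 2 * K * (\<integral>x. (norm (g k x - G x))\<^sup>2 \<partial>lebesgue_ball) + 2 * K * (\<integral>x. (norm (G x))\<^sup>2 \<partial>lebesgue_ball)" for k
  proof -
    have sd: "square_integrable lebesgue_ball (\<lambda>x. g k x - G x)"
      by (intro square_integrable_diff sq square_integrable_lebesgue_ball w)
    have "?X (w k) \<le> K * (\<integral>x. (norm (g k x))\<^sup>2 \<partial>lebesgue_ball)"
      unfolding K_def by (rule sphere_averages_close_L2[OF w(1,2) A A'])
    also have "\<dots> \<le> K * (\<integral>x. 2 * (norm (g k x - G x))\<^sup>2 + 2 * (norm (G x))\<^sup>2 \<partial>lebesgue_ball)"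
    proof (intro mult_left_mono integral_mono \<open>K \<ge> 0\<close>)
      show "integrable lebesgue_ball (\<lambda>x. (norm (g k x))\<^sup>2)"
        using square_integrable_lebesgue_ball[OF w(2)] by (simp add: square_integrable_def)
      show "integrable lebesgue_ball (\<lambda>x. 2 * (norm (g k x - G x))\<^sup>2 + 2 * (norm (G x))\<^sup>2)"
        using sd sq by (auto simp: square_integrable_def)
      show "(norm (g k x))\<^sup>2 \<le> 2 * (norm (g k x - G x))\<^sup>2 + 2 * (norm (G x))\<^sup>2" for x
        using norm_diff_power2_le[of "g k x - G x" "- G x"] by simp
    qed
    also have "\<dots> = 2 * K * (\<integral>x. (norm (g k x - G x))\<^sup>2 \<partial>lebesgue_ball) + 2 * K * (\<integral>x. (norm (G x))\<^sup>2 \<partial>lebesgue_ball)"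
      using sd sq by (simp add: square_integrable_def distrib_left)
    finally show ?thesis .
  qed
  have "(\<lambda>k. ?X (w k)) \<longlonglongrightarrow> ?X t"
    by (intro tendsto_intros ave A A')
  moreover have "(\<lambda>k. 2 * K * (\<integral>x. (norm (g k x - G x))\<^sup>2 \<partial>lebesgue_ball) + 2 * K * (\<integral>x. (norm (G x))\<^sup>2 \<partial>lebesgue_ball))
      \<longlonglongrightarrow> 2 * K * 0 + 2 * K * (\<integral>x. (norm (G x))\<^sup>2 \<partial>lebesgue_ball)"
    by (intro tendsto_intros w)
  ultimately have "?X t \<le> 2 * K * 0 + 2 * K * (\<integral>x. (norm (G x))\<^sup>2 \<partial>lebesgue_ball)"
    by (rule LIMSEQ_le) (use bound in blast)
  then show ?thesis by simp
qed

section \<open>A priori bound for the voltages\<close>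

lemma coefficient_integrable:
  fixes G H :: "'a::euclidean_space \<Rightarrow> 'a"
  assumes "square_integrable lebesgue_ball G" "square_integrable lebesgue_ball H" "D \<in> sets borel"
  shows "integrable lebesgue_ball (\<lambda>x. (1 + (a - 1) * indicator D x) * (G x \<bullet> H x))"
proof -
  have m: "G \<in> borel_measurable lebesgue_ball" "H \<in> borel_measurable lebesgue_ball"
    using assms by (auto simp: square_integrable_def)
  have D: "indicator D \<in> borel_measurable (lebesgue_ball :: 'a measure)"
    using assms(3) by (intro measurable_restrict_space1 borel_measurable_indicator) simp
  have GH: "integrable lebesgue_ball (\<lambda>x. G x \<bullet> H x)"
  proof (rule Bochner_Integration.integrable_bound)
    show "integrable lebesgue_ball (\<lambda>x. norm (G x) * norm (H x))"
      using assms m by (intro square_integrable_mult) (auto simp: square_integrable_def)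
    show "AE x in lebesgue_ball. norm (G x \<bullet> H x) \<le> norm (norm (G x) * norm (H x))"
      using Cauchy_Schwarz_ineq2 by (intro AE_I2) (simp add: abs_mult)
  qed (use m in measurable)
  show ?thesis
  proof (rule Bochner_Integration.integrable_bound[OF integrable_mult_right[OF GH, of "1 + \<bar>a - 1\<bar>"]])
    show "(\<lambda>x. (1 + (a - 1) * indicator D x) * (G x \<bullet> H x)) \<in> borel_measurable lebesgue_ball"
      using m D by measurable
    show "AE x in lebesgue_ball. norm ((1 + (a - 1) * indicator D x) * (G x \<bullet> H x)) \<le>
        norm ((1 + \<bar>a - 1\<bar>) * (G x \<bullet> H x))"
    proof (rule AE_I2)
      fix x
      have "\<bar>1 + (a - 1) * indicator D x\<bar> \<le> 1 + \<bar>a - 1\<bar>" by (auto split: split_indicator)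
      then have "\<bar>1 + (a - 1) * indicator D x\<bar> * \<bar>G x \<bullet> H x\<bar> \<le> (1 + \<bar>a - 1\<bar>) * \<bar>G x \<bullet> H x\<bar>"
        by (intro mult_right_mono) auto
      then show "norm ((1 + (a - 1) * indicator D x) * (G x \<bullet> H x)) \<le> norm ((1 + \<bar>a - 1\<bar>) * (G x \<bullet> H x))"
        by (simp add: abs_mult)
    qed
  qed
qed

text \<open>Each of the two solutions is tested with itself and with the other one; the four identities combine to the energy of
  the difference.\<close>
lemma cem_energy_identity:
  fixes G\<^sub>1 G\<^sub>2 :: "'a::euclidean_space \<Rightarrow> 'a" and e :: "'l::finite \<Rightarrow> 'a set"
  assumes s1: "cem_solution a e z D I\<^sub>1 u\<^sub>1 G\<^sub>1 t\<^sub>1 h\<^sub>1 U\<^sub>1" and s2: "cem_solution a e z D I\<^sub>2 u\<^sub>2 G\<^sub>2 t\<^sub>2 h\<^sub>2 U\<^sub>2"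
    and D: "D \<in> sets borel"
  shows "(\<integral>x. (1 + (a - 1) * indicator D x) * (norm (G\<^sub>1 x - G\<^sub>2 x))\<^sup>2 \<partial>lebesgue_ball) =
    (\<integral>x. (h\<^sub>1 x - h\<^sub>2 x) * (t\<^sub>1 x - t\<^sub>2 x) \<partial>sphere_measure)"
proof -
  let ?A = "\<lambda>x. 1 + (a - 1) * indicator D x :: real"
  have H: "H1_on (ball 0 1) u\<^sub>1 G\<^sub>1 \<and> has_trace u\<^sub>1 G\<^sub>1 t\<^sub>1" "H1_on (ball 0 1) u\<^sub>2 G\<^sub>2 \<and> has_trace u\<^sub>2 G\<^sub>2 t\<^sub>2"
    and W: "weak_solution_with_normal_deriv a D G\<^sub>1 h\<^sub>1" "weak_solution_with_normal_deriv a D G\<^sub>2 h\<^sub>2"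
    using s1 s2 by (auto simp: cem_solution_def)
  have sq: "square_integrable lebesgue_ball G\<^sub>1" "square_integrable lebesgue_ball G\<^sub>2"
    "square_integrable sphere_measure h\<^sub>1" "square_integrable sphere_measure h\<^sub>2"
    "square_integrable sphere_measure t\<^sub>1" "square_integrable sphere_measure t\<^sub>2"
    using H W by (auto simp: H1_on_def has_trace_def weak_solution_with_normal_deriv_def)
  have id: "(\<integral>x. ?A x * (G\<^sub>1 x \<bullet> G\<^sub>1 x) \<partial>lebesgue_ball) = (\<integral>x. h\<^sub>1 x * t\<^sub>1 x \<partial>sphere_measure)"
    "(\<integral>x. ?A x * (G\<^sub>1 x \<bullet> G\<^sub>2 x) \<partial>lebesgue_ball) = (\<integral>x. h\<^sub>1 x * t\<^sub>2 x \<partial>sphere_measure)"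
    "(\<integral>x. ?A x * (G\<^sub>2 x \<bullet> G\<^sub>1 x) \<partial>lebesgue_ball) = (\<integral>x. h\<^sub>2 x * t\<^sub>1 x \<partial>sphere_measure)"
    "(\<integral>x. ?A x * (G\<^sub>2 x \<bullet> G\<^sub>2 x) \<partial>lebesgue_ball) = (\<integral>x. h\<^sub>2 x * t\<^sub>2 x \<partial>sphere_measure)"
    using H W unfolding weak_solution_with_normal_deriv_def by blast+
  have "(\<lambda>x. ?A x * (norm (G\<^sub>1 x - G\<^sub>2 x))\<^sup>2) = (\<lambda>x. (?A x * (G\<^sub>1 x \<bullet> G\<^sub>1 x) - ?A x * (G\<^sub>1 x \<bullet> G\<^sub>2 x)) -
      (?A x * (G\<^sub>2 x \<bullet> G\<^sub>1 x) - ?A x * (G\<^sub>2 x \<bullet> G\<^sub>2 x)))"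
    by (simp add: fun_eq_iff power2_norm_eq_inner inner_diff_left inner_diff_right right_diff_distrib)
  then have "(\<integral>x. ?A x * (norm (G\<^sub>1 x - G\<^sub>2 x))\<^sup>2 \<partial>lebesgue_ball) =
     ((\<integral>x. h\<^sub>1 x * t\<^sub>1 x \<partial>sphere_measure) - (\<integral>x. h\<^sub>1 x * t\<^sub>2 x \<partial>sphere_measure)) -
     ((\<integral>x. h\<^sub>2 x * t\<^sub>1 x \<partial>sphere_measure) - (\<integral>x. h\<^sub>2 x * t\<^sub>2 x \<partial>sphere_measure))"
    using coefficient_integrable[OF sq(1,1) D] coefficient_integrable[OF sq(1,2) D]
      coefficient_integrable[OF sq(2,1) D] coefficient_integrable[OF sq(2,2) D]
    by (simp add: id[symmetric])
  also have "\<dots> = (\<integral>x. (h\<^sub>1 x * t\<^sub>1 x - h\<^sub>1 x * t\<^sub>2 x) - (h\<^sub>2 x * t\<^sub>1 x - h\<^sub>2 x * t\<^sub>2 x) \<partial>sphere_measure)"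
    using sq by (simp add: square_integrable_mult)
  also have "\<dots> = (\<integral>x. (h\<^sub>1 x - h\<^sub>2 x) * (t\<^sub>1 x - t\<^sub>2 x) \<partial>sphere_measure)"
    by (simp add: algebra_simps)
  finally show ?thesis .
qed

locale electrodes =
  fixes e :: "'l::finite \<Rightarrow> 'a::euclidean_space set"
  assumes borel: "\<And>l. e l \<in> sets borel" and on_sphere: "\<And>l. e l \<subseteq> sphere 0 1"
    and disjoint: "\<And>k l. k \<noteq> l \<Longrightarrow> e k \<inter> e l = {}"
    and positive: "\<And>l. measure sphere_measure (e l) > 0"

lemma electrodesI:
  fixes e :: "'l::finite \<Rightarrow> 'a::euclidean_space set"
  assumes ne: "\<And>l. e l \<noteq> {}" and op: "\<And>l. openin (top_of_set (sphere 0 1)) (e l)"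
    and disj: "\<And>k l. k \<noteq> l \<Longrightarrow> closure (e k) \<inter> closure (e l) = {}"
  shows "electrodes e"
proof
  fix l
  obtain T where T: "open T" "e l = sphere 0 1 \<inter> T" using op[of l] by (auto simp: openin_open)
  show borel: "e l \<in> sets borel" unfolding T(2) using T(1) by (intro sets.Int) auto
  show "e l \<subseteq> sphere 0 1" unfolding T(2) by auto
  have eq: "solid_cone (e l) = ball 0 1 \<inter> - {0} \<inter> sgn -` T"
    unfolding T(2) solid_cone_def by (auto simp: norm_sgn)
  have "open (- {0} \<inter> sgn -` T)"
    by (intro continuous_open_preimage T(1)) (auto simp: sgn_div_norm intro!: continuous_intros)
  then have o: "open (solid_cone (e l))" unfolding eq by (simp add: Int_assoc open_Int)
  obtain p where p: "p \<in> e l" using ne by blast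
  then have np: "norm p = 1" unfolding T(2) by simp
  then have "sgn ((1/2) *\<^sub>R p) = p" by (simp add: sgn_div_norm)
  then have "(1/2) *\<^sub>R p \<in> solid_cone (e l)" using p np by (simp add: solid_cone_def)
  then obtain r where r: "r > 0" "ball ((1/2) *\<^sub>R p) r \<subseteq> solid_cone (e l)"
    using o by (metis open_contains_ball)
  have "bounded (solid_cone (e l))"
    by (rule bounded_subset[OF bounded_ball[of 0 1]]) (auto simp: solid_cone_def)
  then have "solid_cone (e l) \<in> fmeasurable lborel"
    using o emeasure_bounded_finite[of "solid_cone (e l)"] by (simp add: fmeasurable_def)
  then have "measure lborel (ball ((1/2) *\<^sub>R p) r) \<le> measure lborel (solid_cone (e l))"
    using r by (intro measure_mono_fmeasurable) auto
  then have "measure lborel (solid_cone (e l)) > 0"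
    using content_ball_pos[OF r(1), of "(1/2) *\<^sub>R p"] by linarith
  then show "measure sphere_measure (e l) > 0" using borel by (simp add: measure_sphere_measure)
next
  fix k l :: 'l assume "k \<noteq> l"
  then show "e k \<inter> e l = {}" using disj[of k l] closure_subset[of "e k"] closure_subset[of "e l"] by blast
qed

context electrodes
begin

abbreviation area :: "'l \<Rightarrow> real" where "area l \<equiv> measure sphere_measure (e l)"

text \<open>On an electrode \<open>h t = U h - z h^2\<close>, and the integral of \<open>h^2\<close> is at least
  \<open>(I l)^2 / area l\<close> by Cauchy-Schwarz. The power at the electrode is thus at most
  \<open>I l * (area l * U l - z l * I l) / area l\<close>, where the bracket is the voltage.\<close>
lemma electrode_power_le:
  assumes t: "square_integrable sphere_measure t" and h: "square_integrable sphere_measure h"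
    and z: "\<And>l. 0 \<le> z l"
    and bc: "\<And>l. AE x in sphere_measure. x \<in> e l \<longrightarrow> t x + z l * h x = U l"
    and out: "AE x in sphere_measure. x \<notin> (\<Union>l. e l) \<longrightarrow> h x = 0"
    and I: "\<And>l. (\<integral>x. indicator (e l) x * h x \<partial>sphere_measure) = I l"
  shows "(\<integral>x. indicator (e l) x * t x \<partial>sphere_measure) = area l * U l - z l * I l"
    and "(\<integral>x. h x * t x \<partial>sphere_measure) \<le>
      (\<Sum>l\<in>UNIV. I l * (\<integral>x. indicator (e l) x * t x \<partial>sphere_measure) / area l)"
proof -
  interpret finite_measure "sphere_measure :: 'a measure" by (rule finite_measure_sphere_measure)
  have e: "square_integrable sphere_measure (indicator (e l) :: 'a \<Rightarrow> real)" for l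
    by (intro square_integrable_indicator finite_measure_sphere_measure) (simp add: borel)
  have m[measurable]: "t \<in> borel_measurable borel" "h \<in> borel_measurable borel"
    using t h by (auto simp: square_integrable_def cong: measurable_cong_sets)
  note [measurable] = borel
  have ih: "integrable sphere_measure (\<lambda>x. indicator (e l) x * h x)" for l
    by (rule square_integrable_mult[OF e h])
  have ihh: "integrable sphere_measure (\<lambda>x. indicator (e l) x * (h x)\<^sup>2)" for l
  proof -
    have "integrable sphere_measure (\<lambda>x. (h x)\<^sup>2)" using h by (simp add: square_integrable_def)
    then show ?thesis using integrable_mult_indicator[of "e l" sphere_measure "\<lambda>x. (h x)\<^sup>2"] borel by simp
  qed
  have iht: "integrable sphere_measure (\<lambda>x. indicator (e l) x * (h x * t x))" for l
    using integrable_mult_indicator[of "e l" sphere_measure "\<lambda>x. h x * t x"] square_integrable_mult[OF h t] borel by simp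
  have ie: "integrable sphere_measure (indicator (e l) :: 'a \<Rightarrow> real)" for l
    using borel by (intro integrable_const_bound[where B = 1]) (auto split: split_indicator)
  have V: "(\<integral>x. indicator (e l) x * t x \<partial>sphere_measure) = area l * U l - z l * I l" for l
  proof -
    have "(\<integral>x. indicator (e l) x * t x \<partial>sphere_measure) =
        (\<integral>x. indicator (e l) x * U l - z l * (indicator (e l) x * h x) \<partial>sphere_measure)"
    proof (rule integral_cong_AE)
      show "AE x in sphere_measure. indicator (e l) x * t x = indicator (e l) x * U l - z l * (indicator (e l) x * h x)"
        using bc[of l] by eventually_elim (auto split: split_indicator)
    qed measurable
    also have "\<dots> = area l * U l - z l * I l"
      using ie ih I by simp
    finally show ?thesis .
  qed
  show "(\<integral>x. indicator (e l) x * t x \<partial>sphere_measure) = area l * U l - z l * I l" by (rule V)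
  have ht: "(\<integral>x. indicator (e l) x * (h x * t x) \<partial>sphere_measure) =
      U l * I l - z l * (\<integral>x. indicator (e l) x * (h x)\<^sup>2 \<partial>sphere_measure)" for l
  proof -
    have "(\<integral>x. indicator (e l) x * (h x * t x) \<partial>sphere_measure) =
        (\<integral>x. U l * (indicator (e l) x * h x) - z l * (indicator (e l) x * (h x)\<^sup>2) \<partial>sphere_measure)"
    proof (rule integral_cong_AE)
      show "AE x in sphere_measure. indicator (e l) x * (h x * t x) =
          U l * (indicator (e l) x * h x) - z l * (indicator (e l) x * (h x)\<^sup>2)"
        using bc[of l]
      proof eventually_elim
        case (elim x)
        then show ?case
          by (auto simp: power2_eq_square algebra_simps split: split_indicator simp flip: elim)
      qed
    qed measurable
    also have "\<dots> = U l * I l - z l * (\<integral>x. indicator (e l) x * (h x)\<^sup>2 \<partial>sphere_measure)"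
      using ih ihh I by simp
    finally show ?thesis .
  qed
  have "(I l)\<^sup>2 / area l \<le> (\<integral>x. indicator (e l) x * (h x)\<^sup>2 \<partial>sphere_measure)" for l
  proof -
    have sq: "square_integrable sphere_measure (\<lambda>x. indicator (e l) x * h x)"
    proof -
      have "(\<lambda>x. (norm (indicator (e l) x * h x))\<^sup>2) = (\<lambda>x. indicator (e l) x * (h x)\<^sup>2)"
        by (auto simp: fun_eq_iff split: split_indicator)
      then show ?thesis using ihh[of l] unfolding square_integrable_def by simp
    qed
    have eqs: "(\<lambda>x. indicator (e l) x * (indicator (e l) x * h x)) = (\<lambda>x. indicator (e l) x * h x)"
      "(\<lambda>x. (indicator (e l) x * h x)\<^sup>2) = (\<lambda>x. indicator (e l) x * (h x)\<^sup>2)"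
      "(\<lambda>x. (indicator (e l) x)\<^sup>2) = (indicator (e l) :: 'a \<Rightarrow> real)"
      by (auto simp: fun_eq_iff split: split_indicator)
    have "(I l)\<^sup>2 \<le> area l * (\<integral>x. indicator (e l) x * (h x)\<^sup>2 \<partial>sphere_measure)"
      using integral_mult_le_square_integrals[OF e[of l] sq] unfolding eqs I by simp
    then show ?thesis using positive[of l] by (simp add: field_simps)
  qed
  then have le: "U l * I l - z l * (\<integral>x. indicator (e l) x * (h x)\<^sup>2 \<partial>sphere_measure) \<le>
      I l * (\<integral>x. indicator (e l) x * t x \<partial>sphere_measure) / area l" for l
  proof -
    assume *: "\<And>l. (I l)\<^sup>2 / area l \<le> (\<integral>x. indicator (e l) x * (h x)\<^sup>2 \<partial>sphere_measure)"
    have "I l * (\<integral>x. indicator (e l) x * t x \<partial>sphere_measure) / area l = U l * I l - z l * ((I l)\<^sup>2 / area l)"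
      unfolding V using positive[of l] by (simp add: power2_eq_square field_simps)
    then show ?thesis using mult_left_mono[OF *[of l] z[of l]] by linarith
  qed
  have "(\<integral>x. h x * t x \<partial>sphere_measure) = (\<integral>x. (\<Sum>l\<in>UNIV. indicator (e l) x * (h x * t x)) \<partial>sphere_measure)"
  proof (rule integral_cong_AE)
    show "AE x in sphere_measure. h x * t x = (\<Sum>l\<in>UNIV. indicator (e l) x * (h x * t x))"
      using out
    proof eventually_elim
      case (elim x)
      show ?case
      proof (cases "\<exists>l. x \<in> e l")
        case True
        then obtain l where l: "x \<in> e l" by blast
        have "indicator (e k) x = (if k = l then 1 else 0 :: real)" for k
          using disjoint[of k l] l by (auto split: split_indicator)
        then show ?thesis by (simp add: if_distrib[of "\<lambda>c. c * _"] cong: if_cong)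
      next
        case False
        then show ?thesis using elim by simp
      qed
    qed
  qed measurable
  also have "\<dots> = (\<Sum>l\<in>UNIV. U l * I l - z l * (\<integral>x. indicator (e l) x * (h x)\<^sup>2 \<partial>sphere_measure))"
    by (subst Bochner_Integration.integral_sum) (auto simp: iht ht)
  also have "\<dots> \<le> (\<Sum>l\<in>UNIV. I l * (\<integral>x. indicator (e l) x * t x \<partial>sphere_measure) / area l)"
    by (intro sum_mono le)
  finally show "(\<integral>x. h x * t x \<partial>sphere_measure) \<le>
      (\<Sum>l\<in>UNIV. I l * (\<integral>x. indicator (e l) x * t x \<partial>sphere_measure) / area l)" .
qed

text \<open>With \<open>E\<close> the squared norm of the gradient of the difference of the solutions, the averages of the trace give
  \<open>\<bar>V\<bar> \<le> c * sqrt E\<close>, and the power gives \<open>\<mu> * E \<le> J * c * sqrt E\<close>, where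
  \<open>J\<close> is the sum on the right hand side. Division by \<open>sqrt E\<close> and substitution of the second
  estimate in the first bound \<open>V\<close> by \<open>c^2 * J / \<mu>\<close>. Two solutions instead of one serve both
  purposes of the estimate: the zero solution as second argument makes it an a priori bound, equal current patterns make it
  a uniqueness statement.\<close>
lemma voltage_difference_bound:
  assumes "a > 0"
  shows "\<exists>M>0. \<forall>z D I\<^sub>1 u\<^sub>1 G\<^sub>1 t\<^sub>1 h\<^sub>1 U\<^sub>1 I\<^sub>2 u\<^sub>2 G\<^sub>2 t\<^sub>2 h\<^sub>2 U\<^sub>2 l. (\<forall>l. 0 \<le> z l) \<longrightarrow> D \<in> sets borel \<longrightarrow>
    cem_solution a e z D I\<^sub>1 u\<^sub>1 G\<^sub>1 t\<^sub>1 h\<^sub>1 U\<^sub>1 \<longrightarrow> cem_solution a e z D I\<^sub>2 u\<^sub>2 G\<^sub>2 t\<^sub>2 h\<^sub>2 U\<^sub>2 \<longrightarrow>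
    \<bar>(LINT x:e l|sphere_measure. t\<^sub>1 x) - (LINT x:e l|sphere_measure. t\<^sub>2 x)\<bar> \<le>
      M * (\<Sum>k\<in>UNIV. \<bar>I\<^sub>1 $ k - I\<^sub>2 $ k\<bar> / area k)"
proof -
  define K where "K = 2 * ((4 * (real DIM('a))\<^sup>2 * 2 ^ DIM('a))\<^sup>2 * measure lborel (ball 0 1 :: 'a set) ^ 3)"
  define S where "S = (\<Sum>l\<in>UNIV. area l)"
  define c where "c = real CARD('l) * sqrt K / S"
  define \<mu> where "\<mu> = min 1 a"
  have K: "0 \<le> K" by (simp add: K_def)
  have S: "S > 0" unfolding S_def by (rule sum_pos) (auto simp: positive)
  have c: "c \<ge> 0" using S by (simp add: c_def K)
  have \<mu>: "\<mu> > 0" using assms by (simp add: \<mu>_def)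
  have "\<bar>(LINT x:e l|sphere_measure. t\<^sub>1 x) - (LINT x:e l|sphere_measure. t\<^sub>2 x)\<bar> \<le>
      c\<^sup>2 / \<mu> * (\<Sum>k\<in>UNIV. \<bar>I\<^sub>1 $ k - I\<^sub>2 $ k\<bar> / area k)"
    if z: "\<forall>l. 0 \<le> z l" and D: "D \<in> sets borel"
      and s1: "cem_solution a e z D I\<^sub>1 u\<^sub>1 G\<^sub>1 t\<^sub>1 h\<^sub>1 U\<^sub>1" and s2: "cem_solution a e z D I\<^sub>2 u\<^sub>2 G\<^sub>2 t\<^sub>2 h\<^sub>2 U\<^sub>2"
    for z D I\<^sub>1 u\<^sub>1 G\<^sub>1 t\<^sub>1 h\<^sub>1 U\<^sub>1 I\<^sub>2 u\<^sub>2 G\<^sub>2 t\<^sub>2 h\<^sub>2 U\<^sub>2 l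
  proof -
    define t h G U I where "t = (\<lambda>x. t\<^sub>1 x - t\<^sub>2 x)" and "h = (\<lambda>x. h\<^sub>1 x - h\<^sub>2 x)" and "G = (\<lambda>x. G\<^sub>1 x - G\<^sub>2 x)"
      and "U = (\<lambda>l. U\<^sub>1 $ l - U\<^sub>2 $ l)" and "I = (\<lambda>l. I\<^sub>1 $ l - I\<^sub>2 $ l)"
    define V where "V l = (\<integral>x. indicator (e l) x * t x \<partial>sphere_measure)" for l
    define E where "E = (\<integral>x. (norm (G x))\<^sup>2 \<partial>lebesgue_ball)"
    define J where "J = (\<Sum>k\<in>UNIV. \<bar>I k\<bar> / area k)"
    have J: "J \<ge> 0" unfolding J_def by (intro sum_nonneg) simp
    have sq: "square_integrable lebesgue_ball G\<^sub>1" "square_integrable lebesgue_ball G\<^sub>2"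
      "square_integrable sphere_measure h\<^sub>1" "square_integrable sphere_measure h\<^sub>2"
      "square_integrable sphere_measure t\<^sub>1" "square_integrable sphere_measure t\<^sub>2"
      using s1 s2 by (auto simp: cem_solution_def H1_on_def has_trace_def weak_solution_with_normal_deriv_def)
    have tr: "gradient_with_trace G t"
      unfolding G_def t_def using s1 s2
      by (intro gradient_with_trace_diff has_trace_imp_gradient_with_trace) (auto simp: cem_solution_def)
    have ht: "square_integrable sphere_measure t" "square_integrable sphere_measure h"
      unfolding t_def h_def by (intro square_integrable_diff sq)+
    have ind: "square_integrable sphere_measure (indicator (e l) :: 'a \<Rightarrow> real)" for l
      by (intro square_integrable_indicator finite_measure_sphere_measure) (simp add: borel)
    have bc: "AE x in sphere_measure. x \<in> e l \<longrightarrow> t x + z l * h x = U l" for l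
    proof -
      have "AE x in sphere_measure. x \<in> e l \<longrightarrow> t\<^sub>1 x + z l * h\<^sub>1 x = U\<^sub>1 $ l"
        "AE x in sphere_measure. x \<in> e l \<longrightarrow> t\<^sub>2 x + z l * h\<^sub>2 x = U\<^sub>2 $ l"
        using s1 s2 by (auto simp: cem_solution_def)
      then show ?thesis by eventually_elim (auto simp: t_def h_def U_def algebra_simps)
    qed
    have out: "AE x in sphere_measure. x \<notin> (\<Union>l. e l) \<longrightarrow> h x = 0"
    proof -
      have "AE x in sphere_measure. x \<notin> (\<Union>l. e l) \<longrightarrow> h\<^sub>1 x = 0"
        "AE x in sphere_measure. x \<notin> (\<Union>l. e l) \<longrightarrow> h\<^sub>2 x = 0"
        using s1 s2 unfolding cem_solution_def by blast+
      then show ?thesis by eventually_elim (auto simp: h_def)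
    qed
    have I: "(\<integral>x. indicator (e l) x * h x \<partial>sphere_measure) = I l" for l
    proof -
      have "(\<integral>x. indicator (e l) x * h\<^sub>1 x \<partial>sphere_measure) = I\<^sub>1 $ l" "(\<integral>x. indicator (e l) x * h\<^sub>2 x \<partial>sphere_measure) = I\<^sub>2 $ l"
        using s1 s2 by (auto simp: cem_solution_def set_lebesgue_integral_def)
      then show ?thesis
        using square_integrable_mult[OF ind sq(3)] square_integrable_mult[OF ind sq(4)]
        by (simp add: h_def I_def right_diff_distrib)
    qed
    note power = electrode_power_le[OF ht z[rule_format] bc out I, folded V_def]
    have "(\<Sum>l\<in>UNIV. area l * U l - z l * I l) =
        (\<Sum>l\<in>UNIV. area l * U\<^sub>1 $ l - z l * I\<^sub>1 $ l) - (\<Sum>l\<in>UNIV. area l * U\<^sub>2 $ l - z l * I\<^sub>2 $ l)"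
      unfolding sum_subtractf[symmetric] by (intro sum.cong) (auto simp: U_def I_def algebra_simps)
    also have "\<dots> = 0" using s1 s2 by (simp add: cem_solution_def)
    finally have V0: "(\<Sum>l\<in>UNIV. V l) = 0" by (simp add: power(1))
    have V_le: "\<bar>V l\<bar> \<le> c * sqrt E" for l
    proof -
      have "\<bar>area k * V l - area l * V k\<bar> \<le> sqrt (K * E)" for k
      proof -
        have "(area k * V l - area l * V k)\<^sup>2 \<le> K * E"
          unfolding V_def K_def E_def by (rule gradient_with_trace_averages[OF tr borel on_sphere borel on_sphere])
        then show ?thesis using real_le_rsqrt real_sqrt_abs real_sqrt_le_mono by metis
      qed
      then have le: "(\<Sum>k\<in>UNIV. \<bar>area k * V l - area l * V k\<bar>) \<le> (\<Sum>k\<in>(UNIV::'l set). sqrt (K * E))"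
        by (intro sum_mono) auto
      have "S * \<bar>V l\<bar> = \<bar>S * V l\<bar>" using S by (simp add: abs_mult)
      also have "S * V l = (\<Sum>k\<in>UNIV. area k * V l - area l * V k)"
        using V0 by (simp add: sum_subtractf S_def sum_distrib_right flip: sum_distrib_left)
      also have "\<bar>\<dots>\<bar> \<le> (\<Sum>k\<in>UNIV. \<bar>area k * V l - area l * V k\<bar>)"
        by (rule sum_abs)
      also note le
      finally have "S * \<bar>V l\<bar> \<le> real CARD('l) * sqrt (K * E)"
        by simp
      then show ?thesis using S by (simp add: c_def real_sqrt_mult field_simps)
    qed
    have E0: "0 \<le> E" by (simp add: E_def)
    have "\<mu> * E = (\<integral>x. \<mu> * (norm (G x))\<^sup>2 \<partial>lebesgue_ball)" by (simp add: E_def)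
    also have "\<dots> \<le> (\<integral>x. (1 + (a - 1) * indicator D x) * (norm (G x))\<^sup>2 \<partial>lebesgue_ball)"
    proof (rule integral_mono)
      have "square_integrable lebesgue_ball G" unfolding G_def by (intro square_integrable_diff sq)
      then show "integrable lebesgue_ball (\<lambda>x. \<mu> * (norm (G x))\<^sup>2)"
        "integrable lebesgue_ball (\<lambda>x. (1 + (a - 1) * indicator D x) * (norm (G x))\<^sup>2)"
        using coefficient_integrable[of G G D a] D by (auto simp: square_integrable_def power2_norm_eq_inner)
      show "\<mu> * (norm (G x))\<^sup>2 \<le> (1 + (a - 1) * indicator D x) * (norm (G x))\<^sup>2" for x
        by (rule mult_right_mono) (auto simp: \<mu>_def split: split_indicator)
    qed
    also have "\<dots> = (\<integral>x. h x * t x \<partial>sphere_measure)"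
      unfolding G_def h_def t_def by (rule cem_energy_identity[OF s1 s2 D])
    also have "\<dots> \<le> (\<Sum>l\<in>UNIV. I l * V l / area l)" by (rule power(2))
    also have "\<dots> \<le> (\<Sum>l\<in>UNIV. \<bar>I l\<bar> / area l * (c * sqrt E))"
    proof (rule sum_mono)
      fix l
      have "I l * V l / area l \<le> \<bar>I l * V l\<bar> / area l"
        using positive[of l] by (intro divide_right_mono) auto
      also have "\<dots> = \<bar>I l\<bar> / area l * \<bar>V l\<bar>" by (simp add: abs_mult)
      also have "\<dots> \<le> \<bar>I l\<bar> / area l * (c * sqrt E)" by (intro mult_left_mono V_le) simp
      finally show "I l * V l / area l \<le> \<bar>I l\<bar> / area l * (c * sqrt E)" .
    qed
    also have "\<dots> = J * (c * sqrt E)" by (simp add: J_def sum_distrib_right)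
    finally have "\<mu> * E \<le> J * (c * sqrt E)" .
    then have "\<mu> * sqrt E * sqrt E \<le> J * c * sqrt E" using E0 by (simp add: mult.assoc)
    then have sE: "\<mu> * sqrt E \<le> J * c"
      using E0 J c by (cases "E = 0") (auto simp: mult_le_cancel_right)
    have "\<mu> * \<bar>V l\<bar> \<le> \<mu> * (c * sqrt E)" using V_le[of l] \<mu> by (intro mult_left_mono) auto
    also have "\<dots> = c * (\<mu> * sqrt E)" by simp
    also have "\<dots> \<le> c * (J * c)" by (rule mult_left_mono[OF sE c])
    finally have "\<bar>V l\<bar> \<le> c\<^sup>2 / \<mu> * J"
      using \<mu> by (simp add: power2_eq_square field_simps)
    moreover have "V l = (LINT x:e l|sphere_measure. t\<^sub>1 x) - (LINT x:e l|sphere_measure. t\<^sub>2 x)"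
      using square_integrable_mult[OF ind sq(5)] square_integrable_mult[OF ind sq(6)]
      by (simp add: V_def t_def set_lebesgue_integral_def right_diff_distrib)
    ultimately show ?thesis by (simp add: J_def I_def)
  qed
  note * = this
  have le: "c\<^sup>2 / \<mu> * J \<le> (c\<^sup>2 / \<mu> + 1) * J" if "0 \<le> J" for J using that by (simp add: distrib_right)
  show ?thesis
  \<comment> \<open>the summand 1 makes the constant positive\<close>
  proof (intro exI[of _ "c\<^sup>2 / \<mu> + 1"] conjI allI impI)
    show "0 < c\<^sup>2 / \<mu> + 1" using \<mu> by (simp add: add_nonneg_pos)
  next
    fix z D I\<^sub>1 u\<^sub>1 G\<^sub>1 t\<^sub>1 h\<^sub>1 U\<^sub>1 I\<^sub>2 u\<^sub>2 G\<^sub>2 t\<^sub>2 h\<^sub>2 U\<^sub>2 l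
    assume A: "\<forall>l. 0 \<le> z l" "D \<in> sets borel"
      "cem_solution a e z D I\<^sub>1 u\<^sub>1 G\<^sub>1 t\<^sub>1 h\<^sub>1 U\<^sub>1" "cem_solution a e z D I\<^sub>2 u\<^sub>2 G\<^sub>2 t\<^sub>2 h\<^sub>2 U\<^sub>2"
    show "\<bar>(LINT x:e l|sphere_measure. t\<^sub>1 x) - (LINT x:e l|sphere_measure. t\<^sub>2 x)\<bar> \<le>
      (c\<^sup>2 / \<mu> + 1) * (\<Sum>k\<in>UNIV. \<bar>I\<^sub>1 $ k - I\<^sub>2 $ k\<bar> / area k)"
      by (rule order_trans[OF *[OF A] le]) (simp add: sum_nonneg)
  qed
qed

end

section \<open>Boundedness of the resistance matrices\<close>

lemma partial_deriv_0: "partial_deriv b (\<lambda>_. 0) = (\<lambda>_. 0)"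
  by (simp add: partial_deriv_def fun_eq_iff)

lemma smooth_on_0: "smooth_on (\<lambda>_. 0) S"
proof -
  have "Ck_on k (\<lambda>_::'a. 0) S" for k
    by (induction k) (simp_all add: partial_deriv_0)
  then show ?thesis by (simp add: smooth_on_def)
qed

lemma cem_solution_0: "cem_solution a e z D 0 (\<lambda>_. 0) (\<lambda>_. 0) (\<lambda>_. 0) (\<lambda>_. 0) 0"
proof -
  have H1: "H1_on \<Omega> (\<lambda>_. 0) (\<lambda>_. 0)" for \<Omega> :: "'b set"
    by (simp add: H1_on_def square_integrable_def)
  moreover have "has_trace (\<lambda>_::'b. 0) (\<lambda>_. 0) (\<lambda>_. 0)"
    unfolding has_trace_def using H1
    by (auto simp: square_integrable_def smooth_on_0 grad_def partial_deriv_0 intro!: exI[of _ "\<lambda>_ _. 0"])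
  ultimately show ?thesis
    by (simp add: cem_solution_def weak_solution_with_normal_deriv_def square_integrable_def
        set_lebesgue_integral_def)
qed

text \<open>The orthogonal projection of a coordinate vector onto the current patterns. A resistance matrix takes the same value
  at both, since it vanishes on constants.\<close>
definition unit_pattern :: "'l::finite \<Rightarrow> real ^ 'l" where
  "unit_pattern j = (\<chi> l. (if l = j then 1 else 0) - 1 / real CARD('l))"

lemma sum_unit_pattern: "(\<Sum>l\<in>UNIV. unit_pattern (j :: 'l::finite) $ l) = 0"
  by (simp add: unit_pattern_def sum_subtractf)

lemma unit_pattern_le: "\<bar>unit_pattern (j :: 'l::finite) $ l\<bar> \<le> 1"
proof -
  have "\<bar>(if l = j then 1 else 0) - q\<bar> \<le> 1" if "0 \<le> q" "q \<le> 1" for q :: real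
    using that by auto
  moreover have "0 \<le> 1 / real CARD('l)" "1 / real CARD('l) \<le> 1" by (simp_all add: Suc_leI)
  ultimately show ?thesis unfolding unit_pattern_def vec_lambda_beta by blast
qed

lemma resistance_matrix_entry:
  fixes R :: "real ^ 'l::finite ^ 'l"
  assumes "R *v (\<chi> l. 1) = 0"
  shows "R $ i $ j = (R *v unit_pattern j) $ i"
proof -
  have "unit_pattern j = axis j 1 - (1 / real CARD('l)) *\<^sub>R (\<chi> l. 1)"
    by (simp add: vec_eq_iff unit_pattern_def axis_def)
  then have "R *v unit_pattern j = R *v axis j 1 - (1 / real CARD('l)) *\<^sub>R (R *v (\<chi> l. 1))"
    by (simp add: matrix_vector_mult_diff_distrib matrix_vector_mult_scaleR)
  then show ?thesis using assms by (simp add: matrix_vector_mul_component inner_axis)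
qed

context electrodes
begin

text \<open>Uniqueness makes \<open>resistance_matrix\<close> the matrix with the defining property, whose entries are voltages for
  unit patterns. Where no matrix has that property, the definite description denotes one fixed matrix
  \<open>R0\<close>, the same for all inclusions and impedances, and the bound is taken large enough to include it.\<close>
lemma resistance_matrix_bounded:
  assumes "a > 0"
  shows "\<exists>M>0. \<forall>z D i j. (\<forall>l. 0 \<le> z l) \<longrightarrow> D \<in> sets borel \<longrightarrow> \<bar>resistance_matrix a e z D $ i $ j\<bar> \<le> M"
proof -
  obtain M where M: "M > 0" "\<And>z D I\<^sub>1 u\<^sub>1 G\<^sub>1 t\<^sub>1 h\<^sub>1 U\<^sub>1 I\<^sub>2 u\<^sub>2 G\<^sub>2 t\<^sub>2 h\<^sub>2 U\<^sub>2 l. \<forall>l. 0 \<le> z l \<Longrightarrow> D \<in> sets borel \<Longrightarrow>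
    cem_solution a e z D I\<^sub>1 u\<^sub>1 G\<^sub>1 t\<^sub>1 h\<^sub>1 U\<^sub>1 \<Longrightarrow> cem_solution a e z D I\<^sub>2 u\<^sub>2 G\<^sub>2 t\<^sub>2 h\<^sub>2 U\<^sub>2 \<Longrightarrow>
    \<bar>(LINT x:e l|sphere_measure. t\<^sub>1 x) - (LINT x:e l|sphere_measure. t\<^sub>2 x)\<bar> \<le>
      M * (\<Sum>k\<in>UNIV. \<bar>I\<^sub>1 $ k - I\<^sub>2 $ k\<bar> / area k)"
    using voltage_difference_bound[OF assms] by blast
  define R0 where "R0 = (THE R :: real ^ 'l ^ 'l. False)"
  define B1 where "B1 = M * (\<Sum>k\<in>UNIV. 1 / area k)"
  define B0 where "B0 = (\<Sum>i\<in>UNIV. \<Sum>j\<in>UNIV. \<bar>R0 $ i $ j\<bar>)"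
  have B1: "B1 > 0" unfolding B1_def using M(1) by (intro mult_pos_pos sum_pos) (auto simp: positive)
  have B0: "\<bar>R0 $ i $ j\<bar> \<le> B0" for i j
  proof -
    have "\<bar>R0 $ i $ j\<bar> \<le> (\<Sum>j\<in>UNIV. \<bar>R0 $ i $ j\<bar>)" by (rule member_le_sum) auto
    also have "\<dots> \<le> B0" unfolding B0_def by (rule member_le_sum) (auto intro: sum_nonneg)
    finally show ?thesis .
  qed
  have "\<bar>resistance_matrix a e z D $ i $ j\<bar> \<le> B0 + B1"
    if z: "\<forall>l. 0 \<le> z l" and D: "D \<in> sets borel" for z D i j
  proof (cases "\<exists>R. is_resistance_matrix a e z D R")
    case False
    then have "resistance_matrix a e z D = R0" by (simp add: resistance_matrix_def R0_def)
    then show ?thesis using B0[of i j] B1 by simp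
  next
    case True
    have entry: "\<exists>u G t h U. cem_solution a e z D (unit_pattern j) u G t h U \<and> R $ i $ j = (LINT x:e i|sphere_measure. t x)"
      if R: "is_resistance_matrix a e z D R" for R i j
    proof -
      obtain u G t h U where "cem_solution a e z D (unit_pattern j) u G t h U"
        "R *v unit_pattern j = (\<chi> l. LINT x:e l|sphere_measure. t x)"
        using R sum_unit_pattern[of j] unfolding is_resistance_matrix_def by blast
      moreover have "R $ i $ j = (R *v unit_pattern j) $ i"
        using R by (intro resistance_matrix_entry) (simp add: is_resistance_matrix_def)
      ultimately have "R $ i $ j = (LINT x:e i|sphere_measure. t x)" by simp
      with \<open>cem_solution a e z D (unit_pattern j) u G t h U\<close> show ?thesis by blast
    qed
    obtain R where R: "is_resistance_matrix a e z D R" using True by blast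
    have "R' = R" if R': "is_resistance_matrix a e z D R'" for R'
    proof -
      have "R' $ i $ j = R $ i $ j" for i j
      proof -
        obtain u G t h U where 1: "cem_solution a e z D (unit_pattern j) u G t h U" "R $ i $ j = (LINT x:e i|sphere_measure. t x)"
          using entry[OF R] by blast
        obtain u' G' t' h' U' where 2: "cem_solution a e z D (unit_pattern j) u' G' t' h' U'" "R' $ i $ j = (LINT x:e i|sphere_measure. t' x)"
          using entry[OF R'] by blast
        show ?thesis using M(2)[OF z D 1(1) 2(1), of i] 1(2) 2(2) by simp
      qed
      then show ?thesis by (simp add: vec_eq_iff)
    qed
    then have eq: "resistance_matrix a e z D = R"
      unfolding resistance_matrix_def using R by (intro the_equality)
    obtain u G t h U where 1: "cem_solution a e z D (unit_pattern j) u G t h U" "R $ i $ j = (LINT x:e i|sphere_measure. t x)"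
      using entry[OF R] by blast
    have "\<bar>R $ i $ j\<bar> \<le> M * (\<Sum>k\<in>UNIV. \<bar>unit_pattern j $ k\<bar> / area k)"
      using M(2)[OF z D 1(1) cem_solution_0, of i] 1(2) by (simp add: set_lebesgue_integral_def)
    also have "\<dots> \<le> B1"
      unfolding B1_def using M(1) by (intro mult_left_mono sum_mono divide_right_mono unit_pattern_le) auto
    finally show ?thesis unfolding eq using B0[of i j] by simp
  qed
  moreover have "B0 + B1 > 0" using B1 B0[of undefined undefined] by linarith
  ultimately show ?thesis by blast
qed

end

section \<open>Counting\<close>

text \<open>Entries are rounded down to multiples of \<open>\<eta>\<close>; there are fewer rounded matrices than subsets.\<close>
lemma close_matrices_pigeonhole:
  fixes R :: "nat set \<Rightarrow> real ^ 'l::finite ^ 'l"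
  assumes M: "\<And>S i j. S \<subseteq> {..<n} \<Longrightarrow> \<bar>R S $ i $ j\<bar> \<le> M" and \<eta>: "\<eta> > 0"
    and n: "(2 * M / \<eta> + 2) ^ (CARD('l) * CARD('l)) < 2 ^ n"
  shows "\<exists>S T. S \<subseteq> {..<n} \<and> T \<subseteq> {..<n} \<and> S \<noteq> T \<and> (\<forall>i j. \<bar>R S $ i $ j - R T $ i $ j\<bar> \<le> \<eta>)"
proof -
  define f where "f S = (\<lambda>p. \<lfloor>R S $ fst p $ snd p / \<eta>\<rfloor>)" for S
  let ?T = "{\<lfloor>- M / \<eta>\<rfloor>..\<lfloor>M / \<eta>\<rfloor>}" and ?F = "(UNIV :: ('l \<times> 'l) set) \<rightarrow>\<^sub>E {\<lfloor>- M / \<eta>\<rfloor>..\<lfloor>M / \<eta>\<rfloor>}"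
  have "0 \<le> \<bar>R {} $ undefined $ undefined\<bar>" by simp
  also have "\<dots> \<le> M" by (rule M) simp
  finally have M0: "0 \<le> M" .
  have "f ` Pow {..<n} \<subseteq> ?F"
  proof (rule image_subsetI)
    fix S assume "S \<in> Pow {..<n}"
    then have "- M \<le> R S $ i $ j" "R S $ i $ j \<le> M" for i j using M[of S i j] by auto
    then have "- M / \<eta> \<le> R S $ i $ j / \<eta>" "R S $ i $ j / \<eta> \<le> M / \<eta>" for i j
      using \<eta> by (intro divide_right_mono; simp)+
    then show "f S \<in> ?F" unfolding f_def PiE_UNIV_domain by (auto intro!: floor_mono)
  qed
  moreover have "finite ?F" by (intro finite_PiE) auto
  ultimately have "card (f ` Pow {..<n}) \<le> card ?F" by (rule card_mono[rotated])
  also have "\<dots> = card ?T ^ (CARD('l) * CARD('l))" by (simp add: card_funcsetE)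
  finally have "real (card (f ` Pow {..<n})) \<le> real (card ?T) ^ (CARD('l) * CARD('l))"
    by (metis of_nat_le_iff of_nat_power)
  also have "\<dots> \<le> (2 * M / \<eta> + 2) ^ (CARD('l) * CARD('l))"
  proof (rule power_mono)
    have "real (card ?T) \<le> real_of_int (\<lfloor>M / \<eta>\<rfloor> - \<lfloor>- M / \<eta>\<rfloor> + 1)"
    proof -
      have "\<lfloor>- M / \<eta>\<rfloor> \<le> \<lfloor>M / \<eta>\<rfloor>" using M0 \<eta> by (intro floor_mono divide_right_mono) auto
      then show ?thesis by simp
    qed
    also have "\<dots> \<le> M / \<eta> - (- M / \<eta> - 1) + 1" by linarith
    finally show "real (card ?T) \<le> 2 * M / \<eta> + 2" by simp
  qed simp
  also note n
  finally have "card (f ` Pow {..<n}) < card (Pow {..<n})"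
    by (simp add: card_Pow)
  then have "\<not> inj_on f (Pow {..<n})" by (rule pigeonhole)
  then obtain S T where ST: "S \<subseteq> {..<n}" "T \<subseteq> {..<n}" "S \<noteq> T" "f S = f T"
    by (auto simp: inj_on_def)
  have "\<bar>R S $ i $ j - R T $ i $ j\<bar> \<le> \<eta>" for i j
  proof -
    have "\<lfloor>R S $ i $ j / \<eta>\<rfloor> = \<lfloor>R T $ i $ j / \<eta>\<rfloor>" using fun_cong[OF ST(4), of "(i, j)"] by (simp add: f_def)
    then have "\<bar>R S $ i $ j / \<eta> - R T $ i $ j / \<eta>\<bar> \<le> 1" by linarith
    then have "\<bar>R S $ i $ j - R T $ i $ j\<bar> / \<eta> \<le> 1" using \<eta> by (simp add: diff_divide_distrib[symmetric])
    then show ?thesis using \<eta> by (simp add: divide_le_eq)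
  qed
  then show ?thesis using ST by blast
qed

text \<open>With \<open>y = \<epsilon> powr - \<alpha>\<close>, the left hand side of the last inequality is at most
  \<open>exp (K * y * ln 2)\<close> for the constant \<open>K\<close> of the proof, so \<open>n\<close> is taken just above
  \<open>K * y\<close>. The other requirements follow from \<open>\<epsilon> * y ^ i \<le> sqrt \<epsilon>\<close> for
  \<open>i \<le> m\<close>, which is the condition \<open>2 m \<alpha> \<le> 1\<close>.\<close>
lemma count_of_bumps:
  fixes M \<alpha> \<kappa> :: real and m k :: nat
  assumes M: "M > 0" and m: "m \<ge> 1" and \<alpha>: "0 < \<alpha>" "2 * real m * \<alpha> \<le> 1" and \<kappa>: "\<kappa> > 0"
  shows "\<exists>\<epsilon>\<^sub>1>0. \<forall>\<epsilon>. 0 < \<epsilon> \<and> \<epsilon> < \<epsilon>\<^sub>1 \<longrightarrow> \<epsilon> \<le> 1/4 \<and>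
    (\<exists>n\<ge>1. 4 * \<epsilon> * real n \<le> 1 \<and> \<epsilon> * real n ^ m \<le> \<kappa> \<and>
       (2 * M / exp (- (\<epsilon> powr - \<alpha>)) + 2) ^ k < 2 ^ n)"
proof -
  define K where "K = real k * (1 + ln (2 * M + 3)) / ln 2"
  have lnM: "0 \<le> ln (2 * M + 3)" using M by simp
  have K: "0 \<le> K" using lnM by (simp add: K_def)
  \<comment> \<open>one term for each requirement; \<open>c\<close> is a bound for \<open>sqrt \<epsilon>\<close>\<close>
  define c where "c = min (1/2) (min (1 / (4 * (K + 2))) (\<kappa> / (K + 2) ^ m))"
  have c: "0 < c" "c \<le> 1/2" "4 * (K + 2) * c \<le> 1" "(K + 2) ^ m * c \<le> \<kappa>"
  proof -
    show "0 < c" using K \<kappa> by (simp add: c_def)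
    show "c \<le> 1/2" unfolding c_def by (rule min.cobounded1)
    have "c \<le> 1 / (4 * (K + 2))" by (simp add: c_def)
    then show "4 * (K + 2) * c \<le> 1" using K by (simp add: field_simps)
    have "c \<le> \<kappa> / (K + 2) ^ m" by (simp add: c_def)
    then show "(K + 2) ^ m * c \<le> \<kappa>" using K by (simp add: field_simps)
  qed
  have "\<epsilon> \<le> 1/4 \<and> (\<exists>n\<ge>1. 4 * \<epsilon> * real n \<le> 1 \<and> \<epsilon> * real n ^ m \<le> \<kappa> \<and>
       (2 * M / exp (- (\<epsilon> powr - \<alpha>)) + 2) ^ k < 2 ^ n)" if \<epsilon>: "0 < \<epsilon>" "\<epsilon> < c\<^sup>2" for \<epsilon>
  proof -
    have "c\<^sup>2 \<le> (1/2)\<^sup>2" using c by (intro power_mono) auto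
    then have \<epsilon>4: "\<epsilon> \<le> 1/4" using \<epsilon> by (simp add: power2_eq_square)
    have sq: "sqrt \<epsilon> \<le> c" using \<epsilon> c by (simp add: real_le_lsqrt less_imp_le)
    define y where "y = \<epsilon> powr - \<alpha>"
    have y1: "1 \<le> y"
      using powr_mono'[of "- \<alpha>" 0 \<epsilon>] \<epsilon> \<epsilon>4 \<alpha> by (simp add: y_def)
    \<comment> \<open>\<open>\<epsilon> * y ^ i\<close> is the power of \<open>\<epsilon>\<close> with exponent \<open>1 - \<alpha> i \<ge> 1 / 2\<close>\<close>
    have y_pow: "\<epsilon> * y ^ i \<le> c" if "1 \<le> i" "i \<le> m" for i
    proof -
      have "y ^ i = \<epsilon> powr (- \<alpha> * real i)"
        using \<epsilon> by (simp add: y_def powr_powr flip: powr_realpow)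
      then have "\<epsilon> * y ^ i = \<epsilon> powr (1 - \<alpha> * real i)" using \<epsilon> by (simp add: powr_diff powr_minus divide_inverse)
      also have "\<dots> \<le> \<epsilon> powr (1/2)"
      proof (rule powr_mono')
        have "\<alpha> * real i \<le> \<alpha> * real m" using \<alpha> that by (intro mult_left_mono) auto
        then show "1/2 \<le> 1 - \<alpha> * real i" using \<alpha>(2) by (simp add: mult.commute)
      qed (use \<epsilon> \<epsilon>4 in auto)
      also have "\<dots> = sqrt \<epsilon>" using \<epsilon> by (simp add: powr_half_sqrt)
      finally show ?thesis using sq by simp
    qed
    define n where "n = nat \<lceil>K * y\<rceil> + 1"
    have Ky: "0 \<le> K * y" using K y1 by simp
    have n: "K * y < real n" "real n \<le> K * y + 2" unfolding n_def using Ky by linarith+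
    have n2: "real n \<le> (K + 2) * y" using n(2) y1 by (simp add: distrib_right)
    have n1: "1 \<le> n" by (simp add: n_def)
    have "4 * \<epsilon> * real n \<le> 4 * \<epsilon> * ((K + 2) * y)" using \<epsilon> n2 by (intro mult_left_mono) auto
    also have "\<dots> = 4 * (K + 2) * (\<epsilon> * y ^ 1)" by simp
    also have "\<dots> \<le> 4 * (K + 2) * c" using K m by (intro mult_left_mono y_pow) auto
    finally have A: "4 * \<epsilon> * real n \<le> 1" using c by linarith
    have "\<epsilon> * real n ^ m \<le> \<epsilon> * ((K + 2) * y) ^ m" using \<epsilon> n2 by (intro mult_left_mono power_mono) auto
    also have "\<dots> = (K + 2) ^ m * (\<epsilon> * y ^ m)" by (simp add: power_mult_distrib)
    also have "\<dots> \<le> (K + 2) ^ m * c" using K m by (intro mult_left_mono y_pow) auto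
    finally have B: "\<epsilon> * real n ^ m \<le> \<kappa>" using c by linarith
    have "2 * M / exp (- y) + 2 \<le> (2 * M + 3) * exp y"
    proof -
      have "1 \<le> exp y" using y1 by simp
      moreover have "2 * M / exp (- y) = 2 * M * exp y" by (simp add: exp_minus divide_inverse)
      moreover have "(2 * M + 3) * exp y = 2 * M * exp y + 3 * exp y" by (rule distrib_right)
      ultimately show ?thesis by linarith
    qed
    also have "\<dots> = exp (ln (2 * M + 3) + y)" using M by (simp add: exp_add)
    also have "\<dots> \<le> exp ((1 + ln (2 * M + 3)) * y)"
      using mult_left_mono[OF y1 lnM] by (simp add: distrib_right)
    finally have "(2 * M / exp (- y) + 2) ^ k \<le> exp ((1 + ln (2 * M + 3)) * y) ^ k"
      using M by (intro power_mono) auto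
    also have "\<dots> = exp (K * y * ln 2)"
      by (simp add: K_def exp_of_nat_mult[symmetric] mult_ac)
    also have "\<dots> < exp (real n * ln 2)" using n(1) by simp
    also have "\<dots> = 2 ^ n" by (simp add: exp_of_nat_mult)
    finally show ?thesis using A B n1 \<epsilon>4 unfolding y_def by blast
  qed
  then show ?thesis using c(1) by (intro exI[of _ "c\<^sup>2"]) auto
qed

theorem proposition2p4:
  fixes m :: nat and \<beta> a Z :: real
    and e :: "'l::finite \<Rightarrow> (real ^ 'n::finite) set"
  assumes "CARD('n) \<ge> 2" and "m \<ge> 1" and "\<beta> > 0"
    and "a > 0" and "a \<noteq> 1" and "Z > 0"
    and "CARD('l) \<ge> 2"
    and "\<And>l. e l \<noteq> {}"
    and "\<And>l. openin (top_of_set (sphere 0 1)) (e l)"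
    and "\<And>l. connected (e l)"
    and "\<And>l. smooth_boundary_in_sphere (e l)"
    and "\<And>k l. k \<noteq> l \<Longrightarrow> closure (e k) \<inter> closure (e l) = {}"
  shows "\<exists>\<epsilon>\<^sub>1 > 0. \<exists>C > 0. \<forall>z :: 'l \<Rightarrow> real. (\<forall>l. z l \<ge> Z) \<longrightarrow>
    (\<forall>\<epsilon>. 0 < \<epsilon> \<and> \<epsilon> < \<epsilon>\<^sub>1 \<longrightarrow>
      (\<exists>D1 \<in> Y_class m \<beta> (1/4) 0 (1/2). \<exists>D2 \<in> Y_class m \<beta> (1/4) 0 (1/2).
         hausdorff_dist D1 (cball 0 (1/2)) \<le> \<epsilon> \<and>
         hausdorff_dist D2 (cball 0 (1/2)) \<le> \<epsilon> \<and>
         hausdorff_dist D1 D2 \<ge> \<epsilon> \<and>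
         onorm (\<lambda>I. (resistance_matrix a e z D1 - resistance_matrix a e z D2) *v I)
           \<le> C * exp (- (\<epsilon> powr (- (real CARD('n) - 1) / (2 * real m * real CARD('n)))))))"
proof -
  define \<alpha> where "\<alpha> = (real CARD('n) - 1) / (2 * real m * real CARD('n))"
  have \<alpha>: "0 < \<alpha>" "2 * real m * \<alpha> \<le> 1"
    using assms(1,2) by (auto simp: \<alpha>_def field_simps)
  have \<alpha>_eq: "- (real CARD('n) - 1) / (2 * real m * real CARD('n)) = - \<alpha>" by (simp add: \<alpha>_def minus_divide_left)
  interpret electrodes e by (rule electrodesI) (use assms in auto)
  obtain M where M: "M > 0" "\<And>z D i j. \<forall>l. 0 \<le> z l \<Longrightarrow> D \<in> sets borel \<Longrightarrow> \<bar>resistance_matrix a e z D $ i $ j\<bar> \<le> M"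
    using resistance_matrix_bounded[OF \<open>a > 0\<close>] by blast
  obtain b :: "real ^ 'n" where b: "b \<in> Basis" using nonempty_Basis by blast
  have dim: "DIM(real ^ 'n) \<ge> 2" using assms(1) by simp
  obtain \<kappa> where \<kappa>: "\<kappa> > 0" "\<And>\<epsilon> n. 0 < \<epsilon> \<Longrightarrow> \<epsilon> \<le> 1/4 \<Longrightarrow> 1 \<le> n \<Longrightarrow> 4 * \<epsilon> * real n \<le> 1 \<Longrightarrow> \<epsilon> * real n ^ m \<le> \<kappa> \<Longrightarrow>
    \<exists>D. \<forall>S \<subseteq> {..<n}. D S \<in> Y_class m \<beta> (1/4) 0 (1/2) \<and> D S \<in> sets (borel :: (real ^ 'n) measure) \<and>
       hausdorff_dist (D S) (cball 0 (1/2)) \<le> \<epsilon> \<and>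
       (\<forall>T \<subseteq> {..<n}. S \<noteq> T \<longrightarrow> \<epsilon> \<le> hausdorff_dist (D S) (D T))"
    using exists_many_zonal_bodies[OF b dim \<open>\<beta> > 0\<close>, of m] by blast
  obtain \<epsilon>\<^sub>1 where \<epsilon>\<^sub>1: "\<epsilon>\<^sub>1 > 0" "\<And>\<epsilon>. 0 < \<epsilon> \<and> \<epsilon> < \<epsilon>\<^sub>1 \<Longrightarrow> \<epsilon> \<le> 1/4 \<and>
    (\<exists>n\<ge>1. 4 * \<epsilon> * real n \<le> 1 \<and> \<epsilon> * real n ^ m \<le> \<kappa> \<and>
       (2 * M / exp (- (\<epsilon> powr - \<alpha>)) + 2) ^ (CARD('l) * CARD('l)) < 2 ^ n)"
    using count_of_bumps[OF M(1) \<open>m \<ge> 1\<close> \<alpha> \<kappa>(1), of "CARD('l) * CARD('l)"] by blast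
  define C where "C = real CARD('l) * real CARD('l)"
  have "\<exists>D1 \<in> Y_class m \<beta> (1/4) 0 (1/2). \<exists>D2 \<in> Y_class m \<beta> (1/4) 0 (1/2).
         hausdorff_dist D1 (cball 0 (1/2)) \<le> \<epsilon> \<and>
         hausdorff_dist D2 (cball 0 (1/2)) \<le> \<epsilon> \<and>
         hausdorff_dist D1 D2 \<ge> \<epsilon> \<and>
         onorm (\<lambda>I. (resistance_matrix a e z D1 - resistance_matrix a e z D2) *v I)
           \<le> C * exp (- (\<epsilon> powr - \<alpha>))"
    if z: "\<forall>l. z l \<ge> Z" and \<epsilon>: "0 < \<epsilon> \<and> \<epsilon> < \<epsilon>\<^sub>1" for z \<epsilon>
  proof -
    let ?\<eta> = "exp (- (\<epsilon> powr - \<alpha>))"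
    have z0: "\<forall>l. 0 \<le> z l" using z \<open>Z > 0\<close> by (metis less_le_trans less_imp_le)
    obtain n where n: "\<epsilon> \<le> 1/4" "1 \<le> n" "4 * \<epsilon> * real n \<le> 1" "\<epsilon> * real n ^ m \<le> \<kappa>"
      "(2 * M / ?\<eta> + 2) ^ (CARD('l) * CARD('l)) < 2 ^ n"
      using \<epsilon>\<^sub>1(2)[OF \<epsilon>] by blast
    obtain D where D: "\<And>S. S \<subseteq> {..<n} \<Longrightarrow> D S \<in> Y_class m \<beta> (1/4) 0 (1/2) \<and> D S \<in> sets (borel :: (real ^ 'n) measure) \<and>
       hausdorff_dist (D S) (cball 0 (1/2)) \<le> \<epsilon> \<and>
       (\<forall>T \<subseteq> {..<n}. S \<noteq> T \<longrightarrow> \<epsilon> \<le> hausdorff_dist (D S) (D T))"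
      using \<kappa>(2)[of \<epsilon> n] \<epsilon> n by blast
    have "\<exists>S T. S \<subseteq> {..<n} \<and> T \<subseteq> {..<n} \<and> S \<noteq> T \<and>
        (\<forall>i j. \<bar>resistance_matrix a e z (D S) $ i $ j - resistance_matrix a e z (D T) $ i $ j\<bar> \<le> ?\<eta>)"
    proof (rule close_matrices_pigeonhole[OF _ _ n(5)])
      fix S i j assume "S \<subseteq> {..<n}"
      then show "\<bar>resistance_matrix a e z (D S) $ i $ j\<bar> \<le> M" using D by (intro M(2) z0) blast
    qed simp
    then obtain S T where ST: "S \<subseteq> {..<n}" "T \<subseteq> {..<n}" "S \<noteq> T"
      "\<And>i j. \<bar>(resistance_matrix a e z (D S) - resistance_matrix a e z (D T)) $ i $ j\<bar> \<le> ?\<eta>"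
      by auto
    have "onorm ((*v) (resistance_matrix a e z (D S) - resistance_matrix a e z (D T))) \<le> C * ?\<eta>"
      unfolding C_def by (rule onorm_le_matrix_component[OF ST(4)])
    then show ?thesis using D[OF ST(1)] D[OF ST(2)] ST by blast
  qed
  moreover have "C > 0" by (simp add: C_def)
  ultimately show ?thesis unfolding \<alpha>_eq using \<epsilon>\<^sub>1(1) by blast
qed

end
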